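(* The candidate surface branched covers of degree $d$ inducing a candidate 2-orbifold cover $S(2,2,2,2)\dashrightarrow S(2,2,2,2)$ are the following, with $\widetilde\Sigma=\Sigma=S$ and $k\geq 1$: \begin{enumerate} \item $d=2k+1$, partitions $(2^k,1),(2^k,1),(2^k,1),(2^k,1)$; \item $d=2k+2$, partitions $(2^k,1,1),(2^k,1,1),(2^{k+1}),(2^{k+1})$; \item $d=2k+4$, partitions $(2^k,1,1,1,1),(2^{k+2}),(2^{k+2}),(2^{k+2})$. \end{enumerate} Those of types 1 and 2 are always realizable; one of type 3 is realizable if and only if $d$ is a multiple of $4$.
   Context: $S$ is the 2-sphere. A partition of $d$ is a finite unordered list (multiset) of positive integers with sum $d$; $\ell(\Pi)$ is the number of entries of $\Pi$; $(a^m,b,\ldots)$ means that $a$ is repeated $m$ times. For closed connected orientable surfaces $\widetilde\Sigma,\Sigma$, a branched cover $f:\widetilde\Sigma\to\Sigma$ is a map locally modelled on $(\mathbb{C},0)\to(\mathbb{C},0)$, $z\mapsto z^k$ with $k\geq 1$; $k$ is the local degree at the source point, and a point of $\Sigma$ having a preimage with local degree $>1$ is a branching point. The degree $d$ of $f$ is the degree of the genuine cover obtained by removing the branching points and their preimages; the local degrees at the preimages of a branching point form a partition of $d$. A candidate surface branched cover consists of closed connected orientable surfaces $\widetilde\Sigma,\Sigma$ (up to homeomorphism), integers $d\geq 2$ and $n\geq 1$, and an unordered collection (repetitions allowed) $\Pi_1,\ldots,\Pi_n$ of partitions of $d$, each with at least one entry $>1$, satisfying the Riemann-Hurwitz condition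 $\chi(\widetilde\Sigma)-\sum_i\ell(\Pi_i)=d\,(\chi(\Sigma)-n)$. It is realizable if there is a degree-$d$ branched cover $f:\widetilde\Sigma\to\Sigma$ with $n$ branching points whose associated partitions of local degrees are $\Pi_1,\ldots,\Pi_n$. A 2-orbifold $\Sigma(p_1,\ldots,p_n)$ is a closed connected orientable surface $\Sigma$ with $n$ cone points of orders $p_i\geq 2$. With $\Pi_i=(d_{ij})_j$, set $p_i=\mathrm{lcm}_j\, d_{ij}$ and $p_{ij}=p_i/d_{ij}$. The induced candidate 2-orbifold cover is $\widetilde X\dashrightarrow X$ with $X=\Sigma(p_1,\ldots,p_n)$ and $\widetilde X=\widetilde\Sigma((p_{ij})_{i,j})$, where orders equal to $1$ are dropped. *)

theory Defs
  imports "HOL-Homology.Homology" "HOL-Library.Multiset"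
begin

section \<open>Closed connected orientable surfaces\<close>

definition locally_planar :: "'a topology \<Rightarrow> bool" where
  "locally_planar X \<longleftrightarrow>
     (\<forall>x\<in>topspace X. \<exists>U (A :: complex set).
        openin X U \<and> x \<in> U \<and> open A \<and> subtopology X U homeomorphic_space top_of_set A)"

text \<open>Orientability is meant in the sense of singular homology: one can choose generators of all
  the local homology groups \<open>H\<^sub>2(X, X - x)\<close> so that, locally, the chosen generators come from a
  common class in \<open>H\<^sub>2(X, X - U)\<close>.\<close>

definition local_homology :: "'a topology \<Rightarrow> 'a set \<Rightarrow> 'a chain set monoid" where
  "local_homology X U = relative_homology_group 2 X (topspace X - U)"

definition orientable_surface :: "'a topology \<Rightarrow> bool" where
  "orientable_surface X \<longleftrightarrow>
     (\<exists>\<mu>. (\<forall>x\<in>topspace X.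
             \<mu> x \<in> carrier (local_homology X {x}) \<and>
             subgroup_generated (local_homology X {x}) {\<mu> x} = local_homology X {x}) \<and>
          (\<forall>x\<in>topspace X. \<exists>U. openin X U \<and> x \<in> U \<and>
             (\<exists>a\<in>carrier (local_homology X U). \<forall>y\<in>U.
                hom_induced 2 X (topspace X - U) X (topspace X - {y}) id a = \<mu> y)))"

text \<open>Second countability is automatic, by compactness.\<close>

definition closed_connected_orientable_surface :: "'a topology \<Rightarrow> bool" where
  "closed_connected_orientable_surface X \<longleftrightarrow>
     topspace X \<noteq> {} \<and> compact_space X \<and> Hausdorff_space X \<and> connected_space X \<and>
     locally_planar X \<and> orientable_surface X"

abbreviation S2 :: "(nat \<Rightarrow> real) topology" where
  "S2 \<equiv> nsphere 2"

section \<open>Euler characteristic\<close>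

definition abelian_independent :: "('g, 'm) monoid_scheme \<Rightarrow> 'g set \<Rightarrow> bool" where
  "abelian_independent G B \<longleftrightarrow>
     (\<forall>c :: 'g \<Rightarrow> int.
        finprod G (\<lambda>b. b [^]\<^bsub>G\<^esub> c b) B = \<one>\<^bsub>G\<^esub> \<longrightarrow> (\<forall>b\<in>B. c b = 0))"

text \<open>The supremum is only meaningful for abelian groups of finite rank.\<close>

definition abelian_rank :: "('g, 'm) monoid_scheme \<Rightarrow> nat" where
  "abelian_rank G = Sup {card B | B. finite B \<and> B \<subseteq> carrier G \<and> abelian_independent G B}"

definition betti :: "nat \<Rightarrow> 'a topology \<Rightarrow> nat" where
  "betti p X = abelian_rank (homology_group (int p) X)"

definition euler_characteristic :: "'a topology \<Rightarrow> int" where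
  "euler_characteristic X = (\<Sum>p | betti p X \<noteq> 0. (-1) ^ p * int (betti p X))"

section \<open>Branched covers\<close>

text \<open>In suitable complex charts centred at \<open>x\<close> and at \<open>f x\<close>, the map \<open>f\<close> is \<open>z \<mapsto> z\<^sup>k\<close>.\<close>

definition locally_power_map ::
  "'a topology \<Rightarrow> 'b topology \<Rightarrow> ('a \<Rightarrow> 'b) \<Rightarrow> 'a \<Rightarrow> nat \<Rightarrow> bool" where
  "locally_power_map X Y f x k \<longleftrightarrow> 1 \<le> k \<and>
     (\<exists>U V (A :: complex set) (B :: complex set) \<phi> \<psi>.
        openin X U \<and> x \<in> U \<and> openin Y V \<and> f ` U \<subseteq> V \<and> open A \<and> open B \<and>
        homeomorphic_map (subtopology X U) (top_of_set A) \<phi> \<and> \<phi> x = 0 \<and>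
        homeomorphic_map (subtopology Y V) (top_of_set B) \<psi> \<and> \<psi> (f x) = 0 \<and>
        (\<forall>u\<in>U. \<psi> (f u) = \<phi> u ^ k))"

definition branched_cover :: "'a topology \<Rightarrow> 'b topology \<Rightarrow> ('a \<Rightarrow> 'b) \<Rightarrow> bool" where
  "branched_cover X Y f \<longleftrightarrow>
     continuous_map X Y f \<and> (\<forall>x\<in>topspace X. \<exists>k. locally_power_map X Y f x k)"

definition local_degree :: "'a topology \<Rightarrow> 'b topology \<Rightarrow> ('a \<Rightarrow> 'b) \<Rightarrow> 'a \<Rightarrow> nat" where
  "local_degree X Y f x = (THE k. locally_power_map X Y f x k)"

definition fibre :: "'a topology \<Rightarrow> ('a \<Rightarrow> 'b) \<Rightarrow> 'b \<Rightarrow> 'a set" where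
  "fibre X f y = {x \<in> topspace X. f x = y}"

definition branching_points :: "'a topology \<Rightarrow> 'b topology \<Rightarrow> ('a \<Rightarrow> 'b) \<Rightarrow> 'b set" where
  "branching_points X Y f = {y \<in> topspace Y. \<exists>x\<in>fibre X f y. 1 < local_degree X Y f x}"

definition has_degree :: "'a topology \<Rightarrow> 'b topology \<Rightarrow> ('a \<Rightarrow> 'b) \<Rightarrow> nat \<Rightarrow> bool" where
  "has_degree X Y f d \<longleftrightarrow>
     (\<forall>y \<in> topspace Y - branching_points X Y f. finite (fibre X f y) \<and> card (fibre X f y) = d)"

definition local_degrees :: "'a topology \<Rightarrow> 'b topology \<Rightarrow> ('a \<Rightarrow> 'b) \<Rightarrow> 'b \<Rightarrow> nat multiset" where
  "local_degrees X Y f y = image_mset (local_degree X Y f) (mset_set (fibre X f y))"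

section \<open>Candidate surface branched covers\<close>

definition partition_of :: "nat \<Rightarrow> nat multiset \<Rightarrow> bool" where
  "partition_of d P \<longleftrightarrow> (\<forall>e\<in>#P. 0 < e) \<and> sum_mset P = d"

text \<open>The covering surface \<open>X\<close> and the covered surface \<open>Y\<close> are given by representatives of their
  homeomorphism classes; the number \<open>n\<close> of partitions is \<open>size Ps\<close>.\<close>

definition candidate_branched_cover ::
  "'a topology \<Rightarrow> 'b topology \<Rightarrow> nat \<Rightarrow> nat multiset multiset \<Rightarrow> bool" where
  "candidate_branched_cover X Y d Ps \<longleftrightarrow>
     closed_connected_orientable_surface X \<and> closed_connected_orientable_surface Y \<and>
     2 \<le> d \<and> 1 \<le> size Ps \<and>
     (\<forall>P\<in>#Ps. partition_of d P \<and> (\<exists>e\<in>#P. 1 < e)) \<and>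
     euler_characteristic X - (\<Sum>P\<in>#Ps. int (size P)) =
       int d * (euler_characteristic Y - int (size Ps))"

definition realizable ::
  "'a topology \<Rightarrow> 'b topology \<Rightarrow> nat \<Rightarrow> nat multiset multiset \<Rightarrow> bool" where
  "realizable X Y d Ps \<longleftrightarrow>
     (\<exists>f. branched_cover X Y f \<and> has_degree X Y f d \<and> finite (branching_points X Y f) \<and>
          image_mset (local_degrees X Y f) (mset_set (branching_points X Y f)) = Ps)"

section \<open>Induced candidate orbifold covers\<close>

text \<open>The 2-orbifold \<open>X(p\<^sub>1,\<dots>,p\<^sub>n)\<close> is encoded as the pair of \<open>X\<close> and the multiset of its cone
  orders, and is considered up to homeomorphism of the underlying surface.\<close>

type_synonym 'a orbifold = "'a topology \<times> nat multiset"

definition same_orbifold :: "'a orbifold \<Rightarrow> 'b orbifold \<Rightarrow> bool" where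
  "same_orbifold Q R \<longleftrightarrow> fst Q homeomorphic_space fst R \<and> snd Q = snd R"

definition induced_order :: "nat multiset \<Rightarrow> nat" where
  "induced_order P = Lcm (set_mset P)"

definition induced_target :: "'b topology \<Rightarrow> nat multiset multiset \<Rightarrow> 'b orbifold" where
  "induced_target Y Ps = (Y, image_mset induced_order Ps)"

definition induced_source :: "'a topology \<Rightarrow> nat multiset multiset \<Rightarrow> 'a orbifold" where
  "induced_source X Ps =
     (X, \<Sum>P\<in>#Ps. filter_mset (\<lambda>p. p \<noteq> 1) (image_mset (\<lambda>e. induced_order P div e) P))"

definition induces_orbifold_cover ::
  "'a topology \<Rightarrow> 'b topology \<Rightarrow> nat multiset multiset \<Rightarrow> 'c orbifold \<Rightarrow> 'e orbifold \<Rightarrow> bool" where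
  "induces_orbifold_cover X Y Ps Q R \<longleftrightarrow>
     same_orbifold (induced_source X Ps) Q \<and> same_orbifold (induced_target Y Ps) R"

abbreviation S2_2222 :: "(nat \<Rightarrow> real) orbifold" where
  "S2_2222 \<equiv> (S2, {#2, 2, 2, 2#})"

definition partitions_type1 :: "nat \<Rightarrow> nat multiset multiset" where
  "partitions_type1 k = replicate_mset 4 (replicate_mset k 2 + {#1#})"

definition partitions_type2 :: "nat \<Rightarrow> nat multiset multiset" where
  "partitions_type2 k =
     {#replicate_mset k 2 + {#1, 1#}, replicate_mset k 2 + {#1, 1#},
       replicate_mset (k + 1) 2, replicate_mset (k + 1) 2#}"

definition partitions_type3 :: "nat \<Rightarrow> nat multiset multiset" where
  "partitions_type3 k =
     {#replicate_mset k 2 + {#1, 1, 1, 1#},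
       replicate_mset (k + 2) 2, replicate_mset (k + 2) 2, replicate_mset (k + 2) 2#}"

end

(* The pillowcase S(2,2,2,2) is the quotient of the plane by the group generated by the translations
   of the lattice 2Z[i] and by z |-> -z; its cone points are the images of Z[i]. A map (x,y) |-> (ax,by)
   with a, b positive integers descends to a branched self-cover of degree ab, whose local degree at
   the image of z is the cone order at (ax,by) divided by the one at (x,y). Choosing (a,b) = (d,1), or
   (d/2,2) when 4 divides d, realizes all the claimed partitions.

   Conversely, let f realize type 3, and let c2, c3, c4 be the branching points above which all local
   degrees are 2. Put c2 and c3 at 0 and infinity. Since f has only double zeros and poles and its
   source is simply connected, f has a continuous square root h. The number of preimages of y under h,
   counted with local degrees, does not depend on y off {0, infinity}; comparing the two square roots
   of c4, which have only preimages of local degree 2, shows that the fibre over c4, which has d/2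
   elements, has even cardinality. *)
theory Submission
  imports Defs "HOL-Complex_Analysis.Complex_Analysis"
begin

text \<open>The three types are the three ways to distribute four source cone points. Over a target
  cone point of order 2 all entries are 1 or 2, and exactly the entries 1 give cone points upstairs.
  So the four partitions contain four ones in all, each number of ones having the parity of
  \<open>d\<close>: 1+1+1+1, 2+2+0+0 or 4+0+0+0. On the cone points, a copy of (Z/2)^2, rescaling
  acts as the diagonal matrix (a, b) modulo 2, and its rank 2, 1 or 0 gives these same
  distributions; rank 0 means that both factors are even.

  Two obstacles shape the rest. The quotient has to be recognized as a sphere, with charts in which
  rescaling, although only real-linear, is literally a power map. And a branched cover is here only
  a continuous map, so its square root is built topologically: on the plane left after removing one
  pole, local roots exist around every zero and pole because the local degree there is even, and
  they are glued. The root is a lift of the map through squaring, and its degree is constant because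
  the punctured plane is connected.\<close>

section \<open>The topology and homology of the sphere\<close>

text \<open>Moves the sphere from a space of sequences into a Euclidean space, where punctured
  spheres and path-connectedness are at hand.\<close>

lemma S2_homeomorphic_sphere:
  "S2 homeomorphic_space top_of_set (sphere (0::complex \<times> real) 1)"
proof -
  define f :: "(nat \<Rightarrow> real) \<Rightarrow> complex \<times> real" where "f = (\<lambda>x. (Complex (x 0) (x 1), x 2))"
  define g :: "complex \<times> real \<Rightarrow> nat \<Rightarrow> real" where
    "g = (\<lambda>(z, t) i. if i = 0 then Re z else if i = 1 then Im z else if i = 2 then t else 0)"
  have sum3: "(\<Sum>i\<le>2. (x i)\<^sup>2) = (x 0)\<^sup>2 + (x 1)\<^sup>2 + (x 2)\<^sup>2" for x :: "nat \<Rightarrow> real"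
    by (simp add: numeral_2_eq_2)
  have top: "topspace S2 = {x. (x 0)\<^sup>2 + (x 1)\<^sup>2 + (x 2)\<^sup>2 = 1 \<and> (\<forall>i>2. x i = 0)}"
    by (auto simp: nsphere sum3)
  have mem: "(z, t) \<in> sphere (0::complex \<times> real) 1 \<longleftrightarrow> (Re z)\<^sup>2 + (Im z)\<^sup>2 + t\<^sup>2 = 1" for z t
    by (simp add: norm_Pair cmod_def)
  have "continuous_map S2 euclidean (\<lambda>x. complex_of_real (x 0) + \<i> * complex_of_real (x 1))"
    by (intro continuous_map_add continuous_map_compose[OF continuous_map_nsphere_projection, unfolded o_def])
       (auto intro!: continuous_intros)
  then have "continuous_map S2 (prod_topology euclidean euclidean) f"
    unfolding f_def Complex_eq
    by (intro continuous_map_pairedI continuous_map_nsphere_projection)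
  moreover have "f \<in> topspace S2 \<rightarrow> sphere 0 1"
    unfolding top f_def Pi_iff mem by auto
  ultimately have cf: "continuous_map S2 (top_of_set (sphere 0 1)) f"
    by (simp add: continuous_map_in_subtopology euclidean_product_topology)
  have "continuous_map (top_of_set (sphere 0 1)) (powertop_real UNIV) g"
    unfolding continuous_map_componentwise_UNIV
  proof
    fix i :: nat
    consider "i = 0" | "i = 1" | "i = 2" | "i > 2" by linarith
    then show "continuous_map (top_of_set (sphere 0 1)) euclideanreal (\<lambda>x. g x i)"
      by cases (auto simp: g_def case_prod_beta intro!: continuous_intros)
  qed
  moreover have "g \<in> topspace (top_of_set (sphere 0 1)) \<rightarrow> topspace S2"
    unfolding top Pi_iff by (auto simp: g_def mem simp del: mem_sphere mem_sphere_0)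
  ultimately have cg: "continuous_map (top_of_set (sphere 0 1)) S2 g"
    by (auto simp: nsphere continuous_map_in_subtopology image_subset_iff Pi_iff)
  have "homeomorphic_maps S2 (top_of_set (sphere 0 1)) f g"
    unfolding homeomorphic_maps_def
  proof (intro conjI cf cg ballI)
    fix x assume "x \<in> topspace S2"
    then show "g (f x) = x" unfolding top by (auto simp: f_def g_def fun_eq_iff)
  next
    fix y :: "complex \<times> real"
    show "f (g y) = y" by (cases y) (auto simp: f_def g_def complex_eq_iff)
  qed
  then show ?thesis
    using homeomorphic_maps_imp_homeomorphic_space by blast
qed

lemma homeomorphic_space_punctured:
  assumes "X homeomorphic_space top_of_set (S :: 'b::topological_space set)" "x \<in> topspace X"
  obtains s where "s \<in> S" "subtopology X (topspace X - {x}) homeomorphic_space top_of_set (S - {s})"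
proof -
  obtain f where f: "homeomorphic_map X (top_of_set S) f"
    using assms homeomorphic_space by blast
  then have im: "f ` topspace X = S" and inj: "inj_on f (topspace X)"
    by (auto simp: homeomorphic_eq_everything_map)
  have "f ` (topspace X - {x}) = S - {f x}"
    using im inj assms(2) by (auto simp: inj_on_def)
  then have "homeomorphic_map (subtopology X (topspace X - {x})) (subtopology (top_of_set S) (S - {f x})) f"
    by (intro homeomorphic_map_subtopologies[OF f]) auto
  moreover have "subtopology (top_of_set S) (S - {f x}) = top_of_set (S - {f x})"
    by (simp add: subtopology_subtopology Int_absorb1)
  ultimately have "subtopology X (topspace X - {x}) homeomorphic_space top_of_set (S - {f x})"
    using homeomorphic_space by metis
  then show thesis using that im assms(2) by blast
qed

text \<open>Stereographic projection. It supplies the charts of the sphere and, later, the planes on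
  which square roots are taken.\<close>

lemma punctured_S2_homeomorphic_plane:
  assumes "X homeomorphic_space S2" "x \<in> topspace X"
  shows "subtopology X (topspace X - {x}) homeomorphic_space (euclidean :: complex topology)"
proof -
  have "X homeomorphic_space top_of_set (sphere (0::complex \<times> real) 1)"
    using assms(1) S2_homeomorphic_sphere homeomorphic_space_trans by blast
  then obtain s where s: "s \<in> sphere (0::complex \<times> real) 1"
    "subtopology X (topspace X - {x}) homeomorphic_space top_of_set (sphere 0 1 - {s})"
    using homeomorphic_space_punctured[OF _ assms(2)] by metis
  have "sphere (0::complex \<times> real) 1 - {s} homeomorphic (UNIV :: complex set)"
    using s(1) by (intro homeomorphic_punctured_sphere_affine) auto
  then have "top_of_set (sphere 0 1 - {s}) homeomorphic_space (euclidean :: complex topology)"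
    by (metis homeomorphic_space_iff_homeomorphic subtopology_UNIV)
  then show ?thesis using s(2) homeomorphic_space_trans by blast
qed

lemma sphere_space_properties:
  assumes "X homeomorphic_space S2"
  shows "topspace X \<noteq> {}" "compact_space X" "Hausdorff_space X" "path_connected_space X"
    "connected_space X" "t1_space X"
proof -
  have h: "X homeomorphic_space top_of_set (sphere (0::complex \<times> real) 1)"
    using assms S2_homeomorphic_sphere homeomorphic_space_trans by blast
  have "(1, 0) \<in> sphere (0::complex \<times> real) 1" by (simp add: norm_Pair)
  then show "topspace X \<noteq> {}"
    using homeomorphic_empty_space[OF h] by (metis empty_iff null_topspace_iff_trivial topspace_euclidean_subtopology)
  show "compact_space X" using homeomorphic_compact_space[OF h]
    by (simp add: compact_space_subtopology)
  show "Hausdorff_space X" using homeomorphic_Hausdorff_space[OF h]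
    by (simp add: Hausdorff_space_subtopology)
  then show "t1_space X" by (simp add: Hausdorff_imp_t1_space)
  have "path_connected (sphere (0::complex \<times> real) 1)"
    by (rule path_connected_sphere) simp
  then show "path_connected_space X" using homeomorphic_path_connected_space[OF h]
    by (simp add: path_connected_space_euclidean_subtopology)
  then show "connected_space X" by (rule path_connected_imp_connected_space)
qed

lemma sphere_space_other_point:
  assumes "X homeomorphic_space S2" "x \<in> topspace X"
  obtains y where "y \<in> topspace X" "y \<noteq> x"
proof -
  have "topspace (subtopology X (topspace X - {x})) \<noteq> {}"
    using homeomorphic_empty_space[OF punctured_S2_homeomorphic_plane[OF assms]]
    by (metis UNIV_I empty_iff null_topspace_iff_trivial topspace_euclidean)
  then show thesis using that by auto
qed

lemma locally_planar_S2:
  assumes X: "X homeomorphic_space S2"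
  shows "locally_planar X"
  unfolding locally_planar_def
proof
  fix x assume "x \<in> topspace X"
  then obtain y where y: "y \<in> topspace X" "y \<noteq> x" using sphere_space_other_point[OF X] by blast
  show "\<exists>U (A :: complex set).
        openin X U \<and> x \<in> U \<and> open A \<and> subtopology X U homeomorphic_space top_of_set A"
  proof (intro exI conjI)
    show "openin X (topspace X - {y})"
      using sphere_space_properties(6)[OF X] y by (simp add: closedin_t1_singleton openin_diff)
    show "subtopology X (topspace X - {y}) homeomorphic_space top_of_set (UNIV :: complex set)"
      using punctured_S2_homeomorphic_plane[OF X y(1)] by simp
  qed (use y \<open>x \<in> topspace X\<close> in auto)
qed

section \<open>Orientability and Euler characteristic of the sphere\<close>

lemma reduced_homology_group_S2:
  assumes "X homeomorphic_space S2"
  shows "reduced_homology_group 2 X \<cong> integer_group"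
    "p \<noteq> 2 \<Longrightarrow> trivial_group (reduced_homology_group p X)"
proof -
  have iso: "reduced_homology_group p X \<cong> reduced_homology_group p S2" for p
    by (rule homeomorphic_space_imp_isomorphic_reduced_homology_groups[OF assms])
  show "reduced_homology_group 2 X \<cong> integer_group"
    using iso[of 2] reduced_homology_group_nsphere(1)[of 2] iso_trans by fastforce
  show "trivial_group (reduced_homology_group p X)" if "p \<noteq> 2"
    using iso[of p] that isomorphic_group_triviality reduced_homology_group_nsphere(2)[of p 2]
    by fastforce
qed

text \<open>The complement of a point is contractible, so restriction from the second homology of
  the sphere to each local homology group is an isomorphism. One global generator therefore orients
  every point, and the whole space serves as the neighbourhood \<open>U\<close>.\<close>

lemma orientable_surface_S2:
  assumes X: "X homeomorphic_space S2"
  shows "orientable_surface X"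
proof -
  let ?R = "reduced_homology_group 2 X"
  let ?h = "\<lambda>x. hom_induced 2 X {} X (topspace X - {x}) id"
  have H: "?R = homology_group 2 X"
    by (rule un_reduced_homology_group) simp
  have "cyclic_group ?R"
    using reduced_homology_group_S2(1)[OF X] cyclic_integer_group isomorphic_group_cyclicity
      group_integer_group group_reduced_homology_group by blast
  then obtain g where g: "g \<in> carrier ?R" "subgroup_generated ?R {g} = ?R"
    by (auto simp: cyclic_group_def)
  have iso: "?h x \<in> iso ?R (local_homology X {x})" if "x \<in> topspace X" for x
    unfolding local_homology_def
  proof (rule iso_reduced_homology_by_contractible)
    show "contractible_space (subtopology X (topspace X - {x}))"
      using homeomorphic_space_contractibility[OF punctured_S2_homeomorphic_plane[OF X that]]
        contractible_space_top_of_set[of "UNIV :: complex set"] convex_imp_contractible[of "UNIV :: complex set"]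
      by simp
    show "topspace X \<inter> (topspace X - {x}) \<noteq> {}"
      using sphere_space_other_point[OF X that] by blast
  qed
  have gen: "?h x g \<in> carrier (local_homology X {x}) \<and>
      subgroup_generated (local_homology X {x}) {?h x g} = local_homology X {x}"
    if "x \<in> topspace X" for x
  proof -
    have hom: "?h x \<in> hom ?R (local_homology X {x})" and im: "?h x ` carrier ?R = carrier (local_homology X {x})"
      using iso[OF that] by (auto simp: iso_def bij_betw_def)
    have grp: "group (local_homology X {x})" by (simp add: local_homology_def)
    interpret group_hom ?R "local_homology X {x}" "?h x"
      using hom grp by (simp add: group_hom_def group_hom_axioms_def)
    have "carrier (subgroup_generated (local_homology X {x}) (?h x ` {g})) = carrier (local_homology X {x})"
      using subgroup_generated_by_image[of "{g}"] g im by simp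
    then have "carrier (subgroup_generated (local_homology X {x}) {?h x g}) = carrier (local_homology X {x})"
      by simp
    then show ?thesis
      using hom g(1) by (auto simp: hom_def subgroup_generated_def intro!: monoid.equality)
  qed
  have "\<exists>U. openin X U \<and> x \<in> U \<and>
      (\<exists>a\<in>carrier (local_homology X U). \<forall>y\<in>U. hom_induced 2 X (topspace X - U) X (topspace X - {y}) id a = ?h y g)"
    if "x \<in> topspace X" for x
    using that g(1) by (intro exI[of _ "topspace X"] conjI bexI[of _ g]) (auto simp: local_homology_def H)
  then show ?thesis
    unfolding orientable_surface_def using gen by (intro exI[of _ "\<lambda>x. ?h x g"]) blast
qed

lemma abelian_rank_trivial:
  assumes "trivial_group G"
  shows "abelian_rank G = 0"
proof -
  interpret group G using assms by (simp add: trivial_group_def)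
  have c: "carrier G = {\<one>\<^bsub>G\<^esub>}" using assms by (simp add: trivial_group_def)
  then interpret comm_group G by unfold_locales auto
  have "B = {}" if "B \<subseteq> carrier G" "abelian_independent G B" for B
  proof -
    \<comment> \<open>In a trivial group the constant coefficient 1 is a relation on every set, so
      only the empty set is independent.\<close>
    have "finprod G (\<lambda>b. b [^]\<^bsub>G\<^esub> (1::int)) B = \<one>\<^bsub>G\<^esub>"
      using that(1) c by (intro finprod_one_eqI) auto
    moreover have "1 = (0::int)" if "b \<in> B" "finprod G (\<lambda>b. b [^]\<^bsub>G\<^esub> (1::int)) B = \<one>\<^bsub>G\<^esub>" for b
      using \<open>abelian_independent G B\<close>[unfolded abelian_independent_def, rule_format, of "\<lambda>_. 1"] that by blast
    ultimately show ?thesis by (metis equals0I zero_neq_one)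
  qed
  then have "{card B | B. finite B \<and> B \<subseteq> carrier G \<and> abelian_independent G B} \<subseteq> {0}"
    by auto
  moreover have "Sup A = 0" if "A \<subseteq> {0}" for A :: "nat set"
    using that subset_singletonD by fastforce
  ultimately show ?thesis unfolding abelian_rank_def by blast
qed

lemma abelian_rank_integer:
  assumes "comm_group G" "G \<cong> integer_group"
  shows "abelian_rank G = 1"
proof -
  interpret comm_group G by fact
  obtain h where h: "h \<in> iso G integer_group" using assms(2) by (auto simp: is_iso_def)
  then have hom: "h \<in> hom G integer_group" and bij: "bij_betw h (carrier G) UNIV"
    by (auto simp: iso_def)
  interpret group_hom G integer_group h
    using hom by (simp add: group_hom_def group_hom_axioms_def is_group)
  have inj: "x = y" if "h x = h y" "x \<in> carrier G" "y \<in> carrier G" for x y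
    using that bij by (auto simp: bij_betw_def inj_on_def)
  have hpow: "h (x [^]\<^bsub>G\<^esub> c) = c * h x" if "x \<in> carrier G" for x and c :: int
    using hom_int_pow[of x c] that by (simp add: group_int_pow_integer_group mult.commute)
  have h1: "h \<one>\<^bsub>G\<^esub> = 0" using hom_one by simp
  obtain g where g: "g \<in> carrier G" "h g = 1"
    using bij_betw_imp_surj_on[OF bij] by (metis UNIV_I imageE)
  have "abelian_independent G {g}"
    unfolding abelian_independent_def
  proof (intro allI impI ballI)
    fix c :: "_ \<Rightarrow> int" and b
    assume "finprod G (\<lambda>b. b [^]\<^bsub>G\<^esub> c b) {g} = \<one>\<^bsub>G\<^esub>" "b \<in> {g}"
    then have "g [^]\<^bsub>G\<^esub> c g = \<one>\<^bsub>G\<^esub>" using g by simp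
    then have "c g = 0" using hpow[OF g(1), of "c g"] h1 g(2) by simp
    then show "c b = 0" using \<open>b \<in> {g}\<close> by simp
  qed
  then have 1: "1 \<in> {card B | B. finite B \<and> B \<subseteq> carrier G \<and> abelian_independent G B}"
    using g by (auto intro!: exI[of _ "{g}"])
  have le: "card B \<le> 1" if B: "finite B" "B \<subseteq> carrier G" "abelian_independent G B" for B
  proof (rule ccontr)
    assume "\<not> card B \<le> 1"
    then obtain a b where ab: "a \<in> B" "b \<in> B" "a \<noteq> b"
      using card_le_Suc0_iff_eq[OF B(1)] by auto
    then have abG: "a \<in> carrier G" "b \<in> carrier G" using B by auto
    \<comment> \<open>With \<open>h\<close> identifying the group with the integers, a and b satisfy
      the relation with coefficients \<open>h b\<close> and \<open>- h a\<close>; both vanish only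
      if a = b.\<close>
    define c where "c = (\<lambda>x. if x = a then h b else if x = b then - h a else 0)"
    have "finprod G (\<lambda>x. x [^]\<^bsub>G\<^esub> c x) B = finprod G (\<lambda>x. x [^]\<^bsub>G\<^esub> c x) {a, b}"
      using ab abG B by (intro finprod_mono_neutral_cong_right) (auto simp: c_def)
    also have "\<dots> = a [^]\<^bsub>G\<^esub> h b \<otimes>\<^bsub>G\<^esub> b [^]\<^bsub>G\<^esub> (- h a)"
      using ab abG by (simp add: c_def)
    also have "\<dots> = \<one>\<^bsub>G\<^esub>"
      using abG by (intro inj) (simp_all add: hpow h1 del: int_pow_neg)
    finally have "\<forall>x\<in>B. c x = 0" using B(3) by (auto simp: abelian_independent_def)
    then have "h b = 0" "h a = 0" using ab by (auto simp: c_def split: if_splits)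
    then show False using inj[of a b] abG ab by simp
  qed
  have "Sup {card B | B. finite B \<and> B \<subseteq> carrier G \<and> abelian_independent G B} = 1"
    by (rule cSup_eq_maximum[OF 1]) (use le in auto)
  then show ?thesis by (simp add: abelian_rank_def)
qed

lemma euler_characteristic_S2:
  assumes X: "X homeomorphic_space S2"
  shows "euler_characteristic X = 2"
proof -
  have "homology_group 0 X \<cong> integer_group"
    using isomorphic_integer_zeroth_homology_group sphere_space_properties[OF X] by blast
  then have b0: "betti 0 X = 1"
    unfolding betti_def by (intro abelian_rank_integer) (auto simp: abelian_homology_group)
  have "homology_group 2 X \<cong> integer_group"
    using reduced_homology_group_S2(1)[OF X] un_reduced_homology_group[of 2 X] by simp
  then have b2: "betti 2 X = 1"
    unfolding betti_def by (intro abelian_rank_integer) (auto simp: abelian_homology_group)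
  have bp: "betti p X = 0" if "p \<noteq> 0" "p \<noteq> 2" for p
    unfolding betti_def
    using reduced_homology_group_S2(2)[OF X, of "int p"] un_reduced_homology_group[of "int p" X] that
    by (intro abelian_rank_trivial) auto
  have "betti p X \<noteq> 0 \<longleftrightarrow> p \<in> {0, 2}" for p
    using b0 b2 bp[of p] by (cases "p = 0"; cases "p = 2") simp_all
  then have "{p. betti p X \<noteq> 0} = {0, 2}" by blast
  then show ?thesis by (simp add: euler_characteristic_def b0 b2)
qed

lemma closed_connected_orientable_surface_S2:
  assumes "X homeomorphic_space S2"
  shows "closed_connected_orientable_surface X"
  using sphere_space_properties[OF assms] locally_planar_S2[OF assms] orientable_surface_S2[OF assms]
  by (simp add: closed_connected_orientable_surface_def)

section \<open>Partitions into ones and twos\<close>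

lemma Lcm_eq_2_iff:
  fixes A :: "nat set"
  assumes "0 \<notin> A" "finite A"
  shows "Lcm A = 2 \<longleftrightarrow> A \<subseteq> {1, 2} \<and> 2 \<in> A"
proof
  assume L: "Lcm A = 2"
  have sub: "A \<subseteq> {1, 2}"
  proof
    fix a assume a: "a \<in> A"
    then have "a dvd 2" using L dvd_Lcm by metis
    then have "a \<le> 2" by (simp add: dvd_imp_le)
    moreover have "a \<noteq> 0" using a assms by metis
    ultimately show "a \<in> {1, 2}" by auto
  qed
  moreover have "2 \<in> A"
  proof (rule ccontr)
    assume "2 \<notin> A"
    then have "\<And>a. a \<in> A \<Longrightarrow> a dvd 1" using sub by auto
    then have "Lcm A dvd 1" by (rule Lcm_least)
    then show False using L by simp
  qed
  ultimately show "A \<subseteq> {1, 2} \<and> 2 \<in> A" by blast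
next
  assume A: "A \<subseteq> {1, 2} \<and> 2 \<in> A"
  then have "Lcm A dvd 2" by (intro Lcm_least) auto
  moreover have "2 dvd Lcm A" using A by (simp add: dvd_Lcm)
  ultimately show "Lcm A = 2" by (rule dvd_antisym)
qed

lemma mset_ones_twos:
  fixes P :: "nat multiset"
  assumes "set_mset P \<subseteq> {1, 2}"
  shows "P = replicate_mset (count P 2) 2 + replicate_mset (count P 1) 1"
    and "size P = count P 1 + count P 2" and "sum_mset P = count P 1 + 2 * count P 2"
proof -
  show P: "P = replicate_mset (count P 2) 2 + replicate_mset (count P 1) 1"
  proof (rule multiset_eqI)
    fix x show "count P x = count (replicate_mset (count P 2) 2 + replicate_mset (count P 1) 1) x"
      using assms by (cases "x \<in># P") (auto simp: not_in_iff)
  qed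
  have "size P = size (replicate_mset (count P 2) 2 + replicate_mset (count P 1) (1::nat))"
    using P by simp
  then show "size P = count P 1 + count P 2" by simp
  have "sum_mset P = sum_mset (replicate_mset (count P 2) 2 + replicate_mset (count P 1) (1::nat))"
    using P by simp
  then show "sum_mset P = count P 1 + 2 * count P 2" by simp
qed

lemma induced_order_eq_2:
  assumes "partition_of d P"
  shows "induced_order P = 2 \<longleftrightarrow> set_mset P \<subseteq> {1, 2} \<and> 2 \<in># P"
  unfolding induced_order_def
  using assms by (intro Lcm_eq_2_iff) (auto simp: partition_of_def)

text \<open>An entry 2 yields order 1, which is dropped, and an entry 1 yields order 2. Counting
  ones is thus counting source cone points.\<close>

lemma source_orders_ones_twos:
  fixes P :: "nat multiset"
  assumes "set_mset P \<subseteq> {1, 2}"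
  shows "filter_mset (\<lambda>p. p \<noteq> 1) (image_mset (\<lambda>e. 2 div e) P) = replicate_mset (count P 1) 2"
proof -
  have "filter_mset (\<lambda>p. p \<noteq> 1) (image_mset (\<lambda>e. 2 div e) P)
      = filter_mset (\<lambda>p. p \<noteq> 1) (image_mset (\<lambda>e. 2 div e)
          (replicate_mset (count P 2) 2 + replicate_mset (count P 1) 1))"
    using mset_ones_twos(1)[OF assms] by simp
  also have "\<dots> = replicate_mset (count P 1) 2"
  proof -
    have "filter_mset (\<lambda>p. p \<noteq> 1) (replicate_mset m (1::nat)) = {#}"
      "filter_mset (\<lambda>p. p \<noteq> 1) (replicate_mset m (2::nat)) = replicate_mset m 2" for m
      by (induction m) auto
    then show ?thesis by simp
  qed
  finally show ?thesis .
qed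

lemma size_4_cases:
  assumes "size M = 4"
  obtains a b c d where "M = {#a, b, c, d#}"
proof -
  have "size M = Suc (Suc (Suc (Suc 0)))" using assms by simp
  then obtain a N where N: "M = add_mset a N" "size N = Suc (Suc (Suc 0))"
    using size_eq_Suc_imp_eq_union[of M] by fastforce
  then obtain b N' where N': "N = add_mset b N'" "size N' = Suc (Suc 0)"
    using size_eq_Suc_imp_eq_union[of N] by fastforce
  then obtain c N'' where N'': "N' = add_mset c N''" "size N'' = Suc 0"
    using size_eq_Suc_imp_eq_union[of N'] by fastforce
  then obtain e where "N'' = {#e#}" using size_1_singleton_mset by auto
  then show thesis using that N N' N'' by blast
qed

text \<open>All four numbers have the parity of \<open>d\<close>. If \<open>d\<close> is odd, each
  is at least 1, so all equal 1; if \<open>d\<close> is even, their halves sum to 2.\<close>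

lemma four_counts_cases:
  fixes b1 b2 b3 b4 d a1 a2 a3 a4 :: nat
  assumes "b1 + b2 + b3 + b4 = 4" "d = b1 + 2 * a1" "d = b2 + 2 * a2" "d = b3 + 2 * a3" "d = b4 + 2 * a4"
  shows "{#b1, b2, b3, b4#} \<in> {{#1, 1, 1, 1#}, {#2, 2, 0, 0#}, {#4, 0, 0, 0#}}"
proof -
  have par: "even b1 \<longleftrightarrow> even d" "even b2 \<longleftrightarrow> even d" "even b3 \<longleftrightarrow> even d" "even b4 \<longleftrightarrow> even d"
    using assms(2-5) by presburger+
  show ?thesis
  proof (cases "even d")
    case True
    then obtain c1 c2 c3 c4 where c: "b1 = 2 * c1" "b2 = 2 * c2" "b3 = 2 * c3" "b4 = 2 * c4"
      using par by (auto elim!: evenE)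
    then have sum: "c1 + c2 + c3 + c4 = 2" using assms(1) by simp
    then have "c1 \<in> {0, 1, 2}" "c2 \<in> {0, 1, 2}" "c3 \<in> {0, 1, 2}" "c4 = 2 - c1 - c2 - c3" by auto
    then show ?thesis unfolding c using sum
      by (elim insertE emptyE; simp add: add_mset_commute)
  next
    case False
    then have "b1 \<noteq> 0" "b2 \<noteq> 0" "b3 \<noteq> 0" "b4 \<noteq> 0" using par by (metis even_zero)+
    then have "b1 = 1" "b2 = 1" "b3 = 1" "b4 = 1" using assms(1) by linarith+
    then show ?thesis by simp
  qed
qed

text \<open>The partition of \<open>d\<close> with exactly \<open>b\<close> ones and otherwise twos.
  The truncated subtraction and division are exact when \<open>b \<le> d\<close> and
  \<open>b\<close> has the parity of \<open>d\<close>; only then is it a partition of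
  \<open>d\<close>.\<close>

definition ones_twos :: "nat \<Rightarrow> nat \<Rightarrow> nat multiset" where
  "ones_twos d b = replicate_mset ((d - b) div 2) 2 + replicate_mset b 1"

lemma partitions_ones_twos:
  "partitions_type1 k = image_mset (ones_twos (2 * k + 1)) {#1, 1, 1, 1#}"
  "partitions_type2 k = image_mset (ones_twos (2 * k + 2)) {#2, 2, 0, 0#}"
  "partitions_type3 k = image_mset (ones_twos (2 * k + 4)) {#4, 0, 0, 0#}"
proof -
  have "ones_twos (2 * m + b) b = replicate_mset m 2 + replicate_mset b 1" for m b
    by (simp add: ones_twos_def)
  from this[of k 1] this[of k 2] this[of k 4] this[of "k + 1" 0] this[of "k + 2" 0]
  show
    "partitions_type1 k = image_mset (ones_twos (2 * k + 1)) {#1, 1, 1, 1#}"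
    "partitions_type2 k = image_mset (ones_twos (2 * k + 2)) {#2, 2, 0, 0#}"
    "partitions_type3 k = image_mset (ones_twos (2 * k + 4)) {#4, 0, 0, 0#}"
    by (simp_all add: partitions_type1_def partitions_type2_def partitions_type3_def numeral_eq_Suc)
qed

text \<open>Reduces both the classification of candidates and the branch data of the constructed
  covers to counting ones.\<close>

lemma partition_determined_by_ones:
  assumes "partition_of d P" "set_mset P \<subseteq> {1, 2}"
  shows "P = ones_twos d (count P 1)"
proof -
  have "d = count P 1 + 2 * count P 2"
    using mset_ones_twos(3)[OF assms(2)] assms(1) by (simp add: partition_of_def)
  then have "(d - count P 1) div 2 = count P 2" by simp
  then show ?thesis using mset_ones_twos(1)[OF assms(2)] by (simp add: ones_twos_def)
qed

lemma induced_source_ones: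
  assumes "\<And>P. P \<in># Ps \<Longrightarrow> induced_order P = 2 \<and> set_mset P \<subseteq> {1, 2}"
  shows "snd (induced_source X Ps) = replicate_mset (\<Sum>P\<in>#Ps. count P 1) 2"
proof -
  have "snd (induced_source X Ps) = (\<Sum>P\<in>#Ps. replicate_mset (count P 1) 2)"
    unfolding induced_source_def snd_conv
    using assms source_orders_ones_twos by (intro arg_cong[where f = sum_mset] image_mset_cong) auto
  also have "\<dots> = replicate_mset (\<Sum>P\<in>#Ps. count P 1) 2"
    by (induction Ps) (auto simp: multiset_eq_iff)
  finally show ?thesis .
qed

text \<open>Target orders 2 force entries 1 and 2 with at least one 2 in each partition; the four
  source cone points say that there are four ones in total, and parity leaves three
  distributions.\<close>

lemma candidates_iff_types:
  assumes X: "X homeomorphic_space S2" and Y: "Y homeomorphic_space S2"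
  shows "candidate_branched_cover X Y d Ps \<and> induces_orbifold_cover X Y Ps S2_2222 S2_2222 \<longleftrightarrow>
     (\<exists>k::nat. k \<ge> 1 \<and> (d = 2 * k + 1 \<and> Ps = partitions_type1 k \<or>
            d = 2 * k + 2 \<and> Ps = partitions_type2 k \<or>
            d = 2 * k + 4 \<and> Ps = partitions_type3 k))" (is "?L \<longleftrightarrow> ?R")
proof
  assume L: ?L
  then have part: "partition_of d P" if "P \<in># Ps" for P
    using that by (auto simp: candidate_branched_cover_def)
  have tgt: "image_mset induced_order Ps = {#2, 2, 2, 2#}"
    and src: "snd (induced_source X Ps) = {#2, 2, 2, 2#}"
    using L by (auto simp: induces_orbifold_cover_def same_orbifold_def induced_target_def)
  have ord: "induced_order P = 2" if "P \<in># Ps" for P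
  proof -
    have "induced_order P \<in># image_mset induced_order Ps" using that by simp
    then show ?thesis unfolding tgt by auto
  qed
  then have P12: "set_mset P \<subseteq> {1, 2}" "2 \<in># P" if "P \<in># Ps" for P
    using induced_order_eq_2[OF part[OF that]] that by auto
  have ones: "(\<Sum>P\<in>#Ps. count P 1) = 4"
  proof -
    have "size (replicate_mset (\<Sum>P\<in>#Ps. count P 1) (2::nat)) = size {#2, 2, 2, 2::nat#}"
      using src induced_source_ones[of Ps X] ord P12 by metis
    then show ?thesis by simp
  qed
  have "size Ps = 4"
    using arg_cong[OF tgt, of size] by simp
  then obtain P1 P2 P3 P4 where Ps: "Ps = {#P1, P2, P3, P4#}" by (rule size_4_cases)
  have d: "d = count P 1 + 2 * count P 2" if "P \<in># Ps" for P
    using mset_ones_twos(3)[OF P12(1)[OF that]] part[OF that] by (simp add: partition_of_def)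
  have Pseq: "Ps = image_mset (ones_twos d) (image_mset (\<lambda>P. count P 1) Ps)"
  proof -
    have "image_mset (\<lambda>P. P) Ps = image_mset (\<lambda>P. ones_twos d (count P 1)) Ps"
      using partition_determined_by_ones part P12 by (intro image_mset_cong) blast
    then show ?thesis by (simp add: multiset.map_comp o_def)
  qed
  have "image_mset (\<lambda>P. count P 1) Ps \<in> {{#1, 1, 1, 1#}, {#2, 2, 0, 0#}, {#4, 0, 0, 0#}}"
    unfolding Ps image_mset_add_mset image_mset_empty
    using ones d by (intro four_counts_cases[of _ _ _ _ d "count P1 2" "count P2 2" "count P3 2" "count P4 2"])
      (auto simp: Ps)
  \<comment> \<open>Here k is the number of twos of a partition with \<open>b\<close> ones; it is
    positive because the least common multiple of the entries is 2.\<close>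
  moreover have "\<exists>k. k \<ge> 1 \<and> d = 2 * k + b" if b: "b \<in># image_mset (\<lambda>P. count P 1) Ps" for b
  proof -
    obtain P where P: "P \<in># Ps" "b = count P 1" using b by auto
    then have "d = 2 * count P 2 + b" "count P 2 \<ge> 1" using d[OF P(1)] P12(2)[OF P(1)] by auto
    then show ?thesis by blast
  qed
  ultimately consider k where "k \<ge> 1" "d = 2 * k + 1" "image_mset (\<lambda>P. count P 1) Ps = {#1, 1, 1, 1#}"
    | k where "k \<ge> 1" "d = 2 * k + 2" "image_mset (\<lambda>P. count P 1) Ps = {#2, 2, 0, 0#}"
    | k where "k \<ge> 1" "d = 2 * k + 4" "image_mset (\<lambda>P. count P 1) Ps = {#4, 0, 0, 0#}"
    by (metis (no_types, lifting) insertE singletonD union_single_eq_member)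
  then show ?R
    by cases (use Pseq partitions_ones_twos in metis)+
next
  assume ?R
  then obtain k where k: "k \<ge> 1" and cases: "d = 2 * k + 1 \<and> Ps = partitions_type1 k \<or>
            d = 2 * k + 2 \<and> Ps = partitions_type2 k \<or> d = 2 * k + 4 \<and> Ps = partitions_type3 k"
    by blast
  have euler: "euler_characteristic X = 2" "euler_characteristic Y = 2"
    using euler_characteristic_S2 X Y by auto
  have surf: "closed_connected_orientable_surface X" "closed_connected_orientable_surface Y"
    using closed_connected_orientable_surface_S2 X Y by auto
  have P: "partition_of d P \<and> set_mset P \<subseteq> {1, 2} \<and> 2 \<in># P" if "P \<in># Ps" for P
    using that cases k
    by (auto simp: partitions_type1_def partitions_type2_def partitions_type3_def partition_of_def
        numeral_eq_Suc split: if_splits)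
  have size: "size Ps = 4" and ones: "(\<Sum>P\<in>#Ps. count P 1) = 4"
    using cases by (auto simp: partitions_type1_def partitions_type2_def partitions_type3_def numeral_eq_Suc)
  \<comment> \<open>Riemann-Hurwitz for spheres and four partitions reads 2 - L = d (2 - 4), so the
    total length L must be 2d + 2.\<close>
  have rh: "(\<Sum>P\<in>#Ps. int (size P)) = 2 * int d + 2" and d: "2 \<le> d"
    using cases k by (auto simp: partitions_type1_def partitions_type2_def partitions_type3_def numeral_eq_Suc)
  have "candidate_branched_cover X Y d Ps"
    unfolding candidate_branched_cover_def euler rh size
    using surf d P by (force intro: bexI[of _ 2])
  moreover have ord: "induced_order P = 2" if "P \<in># Ps" for P
    using induced_order_eq_2 P[OF that] by blast
  have "image_mset induced_order Ps = image_mset (\<lambda>_. 2) Ps"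
    using ord by (intro image_mset_cong) auto
  then have "image_mset induced_order Ps = {#2, 2, 2, 2#}"
    using size by (simp add: image_mset_const_eq numeral_eq_Suc)
  moreover have "snd (induced_source X Ps) = {#2, 2, 2, 2#}"
    using induced_source_ones[of Ps X] ord P ones by (simp add: numeral_eq_Suc)
  ultimately show ?L using X Y
    by (auto simp: induces_orbifold_cover_def same_orbifold_def induced_target_def induced_source_def)
qed

section \<open>Local degrees\<close>

lemma homeomorphic_map_to_open_properties:
  assumes "homeomorphic_map (subtopology X U) (top_of_set A) \<phi>" "openin X U" "open (A :: 'c::topological_space set)"
  shows "inj_on \<phi> U" "\<phi> ` U = A"
    and "\<And>S. open S \<Longrightarrow> openin X {u \<in> U. \<phi> u \<in> S}"
    and "\<And>W. openin X W \<Longrightarrow> W \<subseteq> U \<Longrightarrow> open (\<phi> ` W)"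
proof -
  have sub: "U \<subseteq> topspace X" using assms(2) by (rule openin_subset)
  then have top: "topspace (subtopology X U) = U" by auto
  have everything: "continuous_map (subtopology X U) (top_of_set A) \<phi>"
      "open_map (subtopology X U) (top_of_set A) \<phi>" "\<phi> ` U = A" "inj_on \<phi> U"
    using assms(1) top by (auto simp: homeomorphic_eq_everything_map)
  show "inj_on \<phi> U" "\<phi> ` U = A" by fact+
  show "openin X {u \<in> U. \<phi> u \<in> S}" if "open S" for S
  proof -
    have "openin (top_of_set A) (A \<inter> S)" using that by (simp add: openin_open_Int)
    then have "openin (subtopology X U) {u \<in> topspace (subtopology X U). \<phi> u \<in> A \<inter> S}"
      using everything(1) by (simp only: continuous_map_def)
    moreover have "{u \<in> topspace (subtopology X U). \<phi> u \<in> A \<inter> S} = {u \<in> U. \<phi> u \<in> S}"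
      using top everything(3) by auto
    ultimately show ?thesis using assms(2) by (simp add: openin_open_subtopology)
  qed
  show "open (\<phi> ` W)" if "openin X W" "W \<subseteq> U" for W
  proof -
    have "openin (subtopology X U) W" using that assms(2) by (simp add: openin_open_subtopology)
    then have "openin (top_of_set A) (\<phi> ` W)" using everything(2) by (auto simp: open_map_def)
    then show ?thesis using assms(3) by (simp add: openin_open_eq)
  qed
qed

lemma locally_power_map_imp_topspace:
  assumes "locally_power_map X Y f x k"
  shows "x \<in> topspace X" "f x \<in> topspace Y" "1 \<le> k"
  using assms unfolding locally_power_map_def by (meson image_subset_iff openin_subset subsetD)+

text \<open>Provides values close to \<open>f x\<close> but different from it, at which preimages
  can be counted.\<close>

lemma locally_power_map_not_isolated:
  assumes "locally_power_map X Y f x k" "openin Y V'" "f x \<in> V'"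
  obtains y where "y \<in> V'" "y \<noteq> f x"
proof -
  obtain U V \<psi> and B :: "complex set" where *: "openin Y V" "f ` U \<subseteq> V" "x \<in> U" "open B"
      "homeomorphic_map (subtopology Y V) (top_of_set B) \<psi>"
    using assms(1) unfolding locally_power_map_def by metis
  note \<psi> = homeomorphic_map_to_open_properties[OF *(5,1,4)]
  have "open (\<psi> ` (V \<inter> V'))" using * assms(2) by (intro \<psi>(4)) auto
  moreover have "\<psi> (f x) \<in> \<psi> ` (V \<inter> V')" using * assms(3) by auto
  ultimately have "\<psi> ` (V \<inter> V') \<noteq> {\<psi> (f x)}" using not_open_singleton by metis
  then obtain y where "y \<in> V \<inter> V'" "\<psi> y \<noteq> \<psi> (f x)"
    using \<open>\<psi> (f x) \<in> \<psi> ` (V \<inter> V')\<close> by blast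
  then show thesis using that[of y] by auto
qed

text \<open>The preimages of a nearby value are the k-th roots of its nonzero coordinate. This reads
  off \<open>k\<close> without charts; uniqueness of the local degree, finiteness of fibres and the
  sheet count below all rest on it.\<close>

lemma locally_power_map_count:
  assumes "locally_power_map X Y f x k" "openin X W" "x \<in> W"
  obtains N V where "openin X N" "x \<in> N" "N \<subseteq> W" "openin Y V" "f x \<in> V"
    "{u \<in> N. f u = f x} = {x}"
    "\<And>y. y \<in> V \<Longrightarrow> y \<noteq> f x \<Longrightarrow> finite {u \<in> N. f u = y} \<and> card {u \<in> N. f u = y} = k"
proof -
  obtain U V \<phi> \<psi> and A B :: "complex set" where *: "1 \<le> k" "openin X U" "x \<in> U" "openin Y V"
      "f ` U \<subseteq> V" "open A" "open B" "\<phi> x = 0" "\<psi> (f x) = 0" "\<And>u. u \<in> U \<Longrightarrow> \<psi> (f u) = \<phi> u ^ k"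
    and h: "homeomorphic_map (subtopology X U) (top_of_set A) \<phi>"
      "homeomorphic_map (subtopology Y V) (top_of_set B) \<psi>"
    using assms(1) unfolding locally_power_map_def by metis
  note \<phi> = homeomorphic_map_to_open_properties[OF h(1) *(2,6)]
  note \<psi> = homeomorphic_map_to_open_properties[OF h(2) *(4,7)]
  have "open (\<phi> ` (U \<inter> W))" "0 \<in> \<phi> ` (U \<inter> W)"
    using * assms by (auto intro!: \<phi>(4) image_eqI[of _ _ x])
  then obtain r where r: "r > 0" "ball 0 r \<subseteq> \<phi> ` (U \<inter> W)" by (meson open_contains_ball)
  have k: "k > 0" using * by simp
  define N where "N = {u \<in> U. \<phi> u \<in> ball 0 r}"
  \<comment> \<open>Radius \<open>r ^ k\<close> in the target, so that every k-th root of a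
    coordinate in this ball lies in the ball of radius \<open>r\<close>.\<close>
  define V' where "V' = {y \<in> V. \<psi> y \<in> ball 0 (r ^ k)}"
  have N: "openin X N" unfolding N_def by (rule \<phi>(3)) auto
  have NW: "N \<subseteq> W"
  proof
    fix u assume "u \<in> N"
    then have "u \<in> U" "\<phi> u \<in> \<phi> ` (U \<inter> W)" using r by (auto simp: N_def)
    then show "u \<in> W" using \<phi>(1) by (metis IntD1 IntD2 image_iff inj_onD)
  qed
  have V': "openin Y V'" unfolding V'_def by (rule \<psi>(3)) auto
  have img: "\<phi> ` {u \<in> N. f u = y} = {z. z ^ k = \<psi> y}" if y: "y \<in> V'" for y
  proof -
    have "\<exists>u\<in>N. f u = y \<and> \<phi> u = z" if z: "z ^ k = \<psi> y" for z
    proof -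
      have "norm z ^ k < r ^ k" using y z by (metis V'_def mem_Collect_eq mem_ball_0 norm_power)
      then have "norm z < r" using r(1) by (simp add: power_less_imp_less_base)
      then obtain u where u: "u \<in> U" "\<phi> u = z" using r(2) by force
      then have "\<psi> (f u) = \<psi> y" using * z by simp
      then have "f u = y" using \<psi>(1) u(1) *(5) y by (auto simp: V'_def inj_on_def)
      then show ?thesis using u \<open>norm z < r\<close> by (auto simp: N_def)
    qed
    then show ?thesis using * by (auto simp: N_def image_iff)
  qed
  have inj: "inj_on \<phi> {u \<in> N. f u = y}" for y
    using \<phi>(1) by (auto simp: N_def inj_on_def)
  have xN: "x \<in> N" using * r by (simp add: N_def)
  have fxV: "f x \<in> V'" using * r k by (auto simp: V'_def zero_power)
  show thesis
  proof (rule that[OF N xN NW V' fxV])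
    have "\<phi> ` {u \<in> N. f u = f x} = \<phi> ` {x}" using img[OF fxV] * k by simp
    then show "{u \<in> N. f u = f x} = {x}"
      using inj_on_image_eq_iff[OF \<phi>(1), of "{u \<in> N. f u = f x}" "{x}"] *(3) by (auto simp: N_def)
    fix y assume y: "y \<in> V'" "y \<noteq> f x"
    have "y \<in> V" "f x \<in> V" using y(1) fxV by (auto simp: V'_def)
    then have "\<psi> y \<noteq> \<psi> (f x)" using inj_onD[OF \<psi>(1)] y(2) by metis
    then have "\<psi> y \<noteq> 0" using *(9) by simp
    then have "card {z. z ^ k = \<psi> y} = k" using k by (intro card_nth_roots) auto
    moreover have "bij_betw \<phi> {u \<in> N. f u = y} {z. z ^ k = \<psi> y}"
      using img[OF y(1)] inj by (simp add: bij_betw_def)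
    ultimately have "card {u \<in> N. f u = y} = k" by (simp add: bij_betw_same_card)
    then show "finite {u \<in> N. f u = y} \<and> card {u \<in> N. f u = y} = k"
      using k card_gt_0_iff[of "{u \<in> N. f u = y}"] by simp
  qed
qed

text \<open>Choosing the neighbourhood for \<open>k\<close> inside the one for \<open>l\<close> and
  counting preimages of one common value gives \<open>k \<le> l\<close>, and symmetry does the rest.
  Hence the definite description in \<open>local_degree\<close> is meaningful.\<close>

lemma locally_power_map_unique:
  assumes k: "locally_power_map X Y f x k" and l: "locally_power_map X Y f x l"
  shows "k = l"
proof -
  have "k \<le> l" if k: "locally_power_map X Y f x k" and l: "locally_power_map X Y f x l" for k l
  proof -
    obtain N V where N: "openin X N" "x \<in> N" "N \<subseteq> topspace X" "openin Y V" "f x \<in> V"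
        "{u \<in> N. f u = f x} = {x}"
        "\<And>y. y \<in> V \<Longrightarrow> y \<noteq> f x \<Longrightarrow> finite {u \<in> N. f u = y} \<and> card {u \<in> N. f u = y} = l"
      by (rule locally_power_map_count[OF l openin_topspace locally_power_map_imp_topspace(1)[OF l]]) blast
    obtain N' V' where N': "openin X N'" "x \<in> N'" "N' \<subseteq> N" "openin Y V'" "f x \<in> V'"
        "{u \<in> N'. f u = f x} = {x}"
        "\<And>y. y \<in> V' \<Longrightarrow> y \<noteq> f x \<Longrightarrow> finite {u \<in> N'. f u = y} \<and> card {u \<in> N'. f u = y} = k"
      by (rule locally_power_map_count[OF k N(1,2)]) blast
    obtain y where "y \<in> V \<inter> V'" "y \<noteq> f x"
      using locally_power_map_not_isolated[OF k, of "V \<inter> V'"] N N' by auto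
    then have fin: "finite {u \<in> N. f u = y}" and card: "card {u \<in> N'. f u = y} = k"
        "card {u \<in> N. f u = y} = l"
      using N(7)[of y] N'(7)[of y] by simp_all
    have "{u \<in> N'. f u = y} \<subseteq> {u \<in> N. f u = y}" using N'(3) by blast
    then have "card {u \<in> N'. f u = y} \<le> card {u \<in> N. f u = y}" by (rule card_mono[OF fin])
    then show "k \<le> l" using card by simp
  qed
  then show ?thesis using k l by (simp add: antisym)
qed

lemma local_degree_eqI:
  assumes "locally_power_map X Y f x k"
  shows "local_degree X Y f x = k"
  unfolding local_degree_def using assms locally_power_map_unique[OF _ assms] by (rule the_equality)

lemma locally_power_map_local_degree:
  assumes "branched_cover X Y f" "x \<in> topspace X"
  shows "locally_power_map X Y f x (local_degree X Y f x)"
proof -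
  obtain k where k: "locally_power_map X Y f x k"
    using assms by (auto simp: branched_cover_def)
  show ?thesis using local_degree_eqI[OF k] k by simp
qed

text \<open>Each point of the source has a neighbourhood that contains no fibre point except
  possibly itself; compactness leaves finitely many such neighbourhoods.\<close>

lemma finite_fibre:
  assumes f: "branched_cover X Y f" and X: "compact_space X" and Y: "t1_space Y"
  shows "finite (fibre X f y)"
proof -
  have cont: "continuous_map X Y f" using f by (simp add: branched_cover_def)
  have "\<exists>N. openin X N \<and> x \<in> N \<and> N \<inter> fibre X f y \<subseteq> {x}" if x: "x \<in> topspace X" for x
  proof (cases "f x = y")
    case True
    obtain N where "openin X N" "x \<in> N" "{u \<in> N. f u = f x} = {x}"
      by (rule locally_power_map_count[OF locally_power_map_local_degree[OF f x] openin_topspace x]) blast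
    then show ?thesis using True by (intro exI[of _ N]) (auto simp: fibre_def)
  next
    case False
    have "openin Y (topspace Y - {y})"
      using Y by (metis closedin_t1_singleton Diff_insert0 Diff_empty openin_diff openin_topspace)
    then have "openin X {u \<in> topspace X. f u \<in> topspace Y - {y}}"
      using cont by (rule openin_continuous_map_preimage[rotated])
    then show ?thesis
      using False x cont by (intro exI[of _ "{u \<in> topspace X. f u \<in> topspace Y - {y}}"])
        (auto simp: fibre_def continuous_map_def)
  qed
  then obtain N where N: "\<And>x. x \<in> topspace X \<Longrightarrow> openin X (N x) \<and> x \<in> N x \<and> N x \<inter> fibre X f y \<subseteq> {x}"
    by metis
  have "\<forall>U\<in>N ` topspace X. openin X U" "topspace X \<subseteq> \<Union>(N ` topspace X)" using N by blast+
  then obtain F where F: "finite F" "F \<subseteq> N ` topspace X" "topspace X \<subseteq> \<Union>F"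
    using X unfolding compact_space_def compactin_def by meson
  then obtain C where C: "C \<subseteq> topspace X" "finite C" "F = N ` C"
    using finite_subset_image[OF F(1,2)] by metis
  have "fibre X f y \<subseteq> C"
  proof
    fix u assume u: "u \<in> fibre X f y"
    then obtain x where "x \<in> C" "u \<in> N x" using F(3) C(3) by (auto simp: fibre_def)
    then show "u \<in> C" using N C(1) u by blast
  qed
  then show ?thesis using C(2) finite_subset by blast
qed

section \<open>The pillowcase\<close>

text \<open>The orbit relation of the pillowcase group, in real coordinates.\<close>

definition pillow_eq :: "complex \<Rightarrow> complex \<Rightarrow> bool" where
  "pillow_eq z w \<longleftrightarrow> (\<exists>(m::int) (n::int).
     Re w = Re z + 2 * real_of_int m \<and> Im w = Im z + 2 * real_of_int n \<or> Re w = - Re z + 2 * real_of_int m \<and> Im w = - Im z + 2 * real_of_int n)"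

text \<open>An explicit embedding of the quotient in 3-space. The two cosines determine each
  coordinate up to sign and translation; the product of sines is unchanged when both signs flip and
  changes sign when only one does, so it separates the two cases.\<close>

definition pillow :: "complex \<Rightarrow> complex \<times> real" where
  "pillow z = (Complex (cos (pi * Re z)) (cos (pi * Im z)), sin (pi * Re z) * sin (pi * Im z))"

lemma cos_pi_eq_iff:
  "cos (pi * x) = cos (pi * y) \<longleftrightarrow> (\<exists>n::int. y = x + 2 * real_of_int n \<or> y = - x + 2 * real_of_int n)"
proof -
  have "cos (pi * y) = cos (pi * x) \<longleftrightarrow> (\<exists>n\<in>\<int>. pi * y = pi * x + 2 * n * pi \<or> pi * y = - (pi * x) + 2 * n * pi)"
    by (rule cos_eq)
  also have "\<dots> \<longleftrightarrow> (\<exists>n\<in>\<int>. y = x + 2 * n \<or> y = - x + 2 * n)"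
  proof -
    have "(pi * y = pi * x + 2 * n * pi) = (y = x + 2 * n)" "(pi * y = - (pi * x) + 2 * n * pi) = (y = - x + 2 * n)" for n
    proof -
      have "pi * x + 2 * n * pi = pi * (x + 2 * n)" "- (pi * x) + 2 * n * pi = pi * (- x + 2 * n)"
        by (simp_all add: algebra_simps)
      then show "(pi * y = pi * x + 2 * n * pi) = (y = x + 2 * n)"
        "(pi * y = - (pi * x) + 2 * n * pi) = (y = - x + 2 * n)" by (metis mult_cancel_left pi_neq_zero)+
    qed
    then show ?thesis by simp
  qed
  also have "\<dots> \<longleftrightarrow> (\<exists>n::int. y = x + 2 * real_of_int n \<or> y = - x + 2 * real_of_int n)"
    by (auto simp: Ints_def)
  finally show ?thesis by (simp add: eq_commute)
qed

lemma sin_pi_shift: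
  fixes n :: int
  shows "sin (pi * (x + 2 * real_of_int n)) = sin (pi * x)" "sin (pi * (- x + 2 * real_of_int n)) = - sin (pi * x)"
    "cos (pi * (x + 2 * real_of_int n)) = cos (pi * x)" "cos (pi * (- x + 2 * real_of_int n)) = cos (pi * x)"
proof -
  have e: "pi * (y + 2 * real_of_int n) = pi * y + 2 * pi * real_of_int n" for y
    by (simp add: algebra_simps)
  have s: "sin (2 * pi * real_of_int n) = 0" "cos (2 * pi * real_of_int n) = 1"
    using sin_int_2pin[of n] cos_int_2pin[of n] by simp_all
  have *: "sin (pi * (y + 2 * real_of_int n)) = sin (pi * y)" "cos (pi * (y + 2 * real_of_int n)) = cos (pi * y)" for y
    unfolding e sin_add cos_add s by simp_all
  show "sin (pi * (x + 2 * real_of_int n)) = sin (pi * x)" "cos (pi * (x + 2 * real_of_int n)) = cos (pi * x)"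
    by (rule *)+
  show "sin (pi * (- x + 2 * real_of_int n)) = - sin (pi * x)" "cos (pi * (- x + 2 * real_of_int n)) = cos (pi * x)"
    unfolding * by simp_all
qed

lemma sin_pi_eq_0_iff: "sin (pi * x) = 0 \<longleftrightarrow> x \<in> \<int>"
proof -
  have "sin (pi * x) = 0 \<longleftrightarrow> (\<exists>i::int. pi * x = pi * i)"
    unfolding sin_zero_iff_int2 by (simp add: mult.commute)
  then show ?thesis by (auto simp: Ints_def)
qed

text \<open>The delicate case is a sign change in only one coordinate. Then the third component is
  its own negative, so some coordinate is an integer, and for an integer coordinate a sign change is
  also a translation.\<close>

lemma pillow_eq_iff: "pillow z = pillow w \<longleftrightarrow> pillow_eq z w"
proof
  assume "pillow_eq z w"
  then show "pillow z = pillow w"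
    unfolding pillow_eq_def pillow_def by (elim exE disjE conjE) (simp_all only: sin_pi_shift, simp_all)
next
  assume eq: "pillow z = pillow w"
  then obtain m n :: int where m: "Re w = Re z + 2 * real_of_int m \<or> Re w = - Re z + 2 * real_of_int m"
    and n: "Im w = Im z + 2 * real_of_int n \<or> Im w = - Im z + 2 * real_of_int n"
    unfolding pillow_def prod.inject complex.inject cos_pi_eq_iff by blast
  have sn: "sin (pi * Re z) * sin (pi * Im z) = sin (pi * Re w) * sin (pi * Im w)"
    using eq by (simp add: pillow_def)
  have int: "Re z \<in> \<int> \<or> Im z \<in> \<int>" if "sin (pi * Re w) * sin (pi * Im w) = - (sin (pi * Re z) * sin (pi * Im z))"
    using sn that sin_pi_eq_0_iff by fastforce
  have both: "(\<exists>m'::int. x = - x + 2 * m')" if "x \<in> \<int>" for x :: real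
    using that by (auto simp: Ints_def)
  consider "Re w = Re z + 2 * real_of_int m" "Im w = Im z + 2 * real_of_int n" | "Re w = - Re z + 2 * real_of_int m" "Im w = - Im z + 2 * real_of_int n"
    | "Re w = Re z + 2 * real_of_int m" "Im w = - Im z + 2 * real_of_int n" | "Re w = - Re z + 2 * real_of_int m" "Im w = Im z + 2 * real_of_int n"
    using m n by blast
  then show "pillow_eq z w"
  proof cases
    case 3
    have "sin (pi * Re w) * sin (pi * Im w) = - (sin (pi * Re z) * sin (pi * Im z))"
      unfolding 3 sin_pi_shift by simp
    then have "Re z \<in> \<int> \<or> Im z \<in> \<int>" by (rule int)
    then show ?thesis
    proof
      assume "Re z \<in> \<int>"
      then obtain i where "Re z = of_int i" by (auto simp: Ints_def)
      \<comment> \<open>With \<open>Re z = i\<close>, the value \<open>Re z + 2 * m\<close> equals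
        \<open>- Re z + 2 * (i + m)\<close>, so both signs become negative. The remaining shifts
        below arise the same way.\<close>
      then show ?thesis unfolding pillow_eq_def using 3
        by (intro exI[of _ "i + m"] exI[of _ n]) simp
    next
      assume "Im z \<in> \<int>"
      then obtain i where "Im z = of_int i" by (auto simp: Ints_def)
      then show ?thesis unfolding pillow_eq_def using 3
        by (intro exI[of _ m] exI[of _ "n - i"]) simp
    qed
  next
    case 4
    have "sin (pi * Re w) * sin (pi * Im w) = - (sin (pi * Re z) * sin (pi * Im z))"
      unfolding 4 sin_pi_shift by simp
    then have "Re z \<in> \<int> \<or> Im z \<in> \<int>" by (rule int)
    then show ?thesis
    proof
      assume "Re z \<in> \<int>"
      then obtain i where "Re z = of_int i" by (auto simp: Ints_def)
      then show ?thesis unfolding pillow_eq_def using 4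
        by (intro exI[of _ "m - i"] exI[of _ n]) simp
    next
      assume "Im z \<in> \<int>"
      then obtain i where "Im z = of_int i" by (auto simp: Ints_def)
      then show ?thesis unfolding pillow_eq_def using 4
        by (intro exI[of _ m] exI[of _ "n + i"]) simp
    qed
  qed (unfold pillow_eq_def, blast+)
qed

lemma pillow_surface:
  assumes "pillow z = (Complex a b, c)"
  shows "c\<^sup>2 = (1 - a\<^sup>2) * (1 - b\<^sup>2)" "a\<^sup>2 \<le> 1" "b\<^sup>2 \<le> 1"
proof -
  have abc: "a = cos (pi * Re z)" "b = cos (pi * Im z)" "c = sin (pi * Re z) * sin (pi * Im z)"
    using assms by (auto simp: pillow_def)
  show "c\<^sup>2 = (1 - a\<^sup>2) * (1 - b\<^sup>2)"
    unfolding abc by (simp add: power_mult_distrib sin_squared_eq)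
  show "a\<^sup>2 \<le> 1" "b\<^sup>2 \<le> 1" unfolding abc by (simp_all add: abs_square_le_1)
qed

lemma pillow_nonzero: "pillow z \<noteq> 0"
proof
  assume "pillow z = 0"
  then have "pillow z = (Complex 0 0, 0)" by (simp add: zero_prod_def complex_eq_iff)
  then show False using pillow_surface(1)[of z 0 0 0] by simp
qed

text \<open>The surface \<open>c\<^sup>2 = (1 - a\<^sup>2) (1 - b\<^sup>2)\<close> meets every ray from the origin once, so that radial
  projection identifies it with the round sphere.\<close>
lemma pillow_star_shaped:
  assumes "pillow w = t *\<^sub>R pillow z" "t > 0"
  shows "t \<ge> 1"
proof (rule ccontr)
  assume "\<not> 1 \<le> t"
  then have "t < 1" by simp
  then have t: "t\<^sup>2 < 1" "0 < t\<^sup>2" using assms(2) by (auto simp: abs_square_less_1)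
  obtain a b c where abc: "pillow z = (Complex a b, c)" by (metis complex.collapse surj_pair)
  then have "pillow w = (Complex (t * a) (t * b), t * c)"
    using assms(1) by (simp add: complex_eq_iff)
  from pillow_surface[OF this] have w: "t\<^sup>2 * c\<^sup>2 = (1 - t\<^sup>2 * a\<^sup>2) * (1 - t\<^sup>2 * b\<^sup>2)"
    by (simp add: power_mult_distrib)
  have z: "c\<^sup>2 = (1 - a\<^sup>2) * (1 - b\<^sup>2)" "a\<^sup>2 \<le> 1" "b\<^sup>2 \<le> 1" using pillow_surface[OF abc] by auto
  have "t\<^sup>2 * a\<^sup>2 \<le> a\<^sup>2" "t\<^sup>2 * b\<^sup>2 \<le> b\<^sup>2" using t by (simp_all add: mult_left_le_one_le)
  \<comment> \<open>Shrinking by t < 1 does not decrease the right-hand side of the surface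
    equation, but multiplies the left-hand side by t squared. This forces c = 0, and then the
    right-hand side at the shrunk point is strictly positive, a contradiction.\<close>
  then have "(1 - a\<^sup>2) * (1 - b\<^sup>2) \<le> (1 - t\<^sup>2 * a\<^sup>2) * (1 - t\<^sup>2 * b\<^sup>2)"
    using z by (intro mult_mono) auto
  then have "c\<^sup>2 \<le> t\<^sup>2 * c\<^sup>2" using w z by simp
  then have "c = 0" using t by (smt (verit) mult_less_cancel_right2 zero_less_power2)
  have "t\<^sup>2 * a\<^sup>2 < 1" "t\<^sup>2 * b\<^sup>2 < 1" using t z
    by (metis less_le_trans mult.commute mult_left_le mult_right_le_one_le order_le_less_trans zero_le_power2)+
  then have "0 < (1 - t\<^sup>2 * a\<^sup>2) * (1 - t\<^sup>2 * b\<^sup>2)" by simp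
  moreover have "(1 - t\<^sup>2 * a\<^sup>2) * (1 - t\<^sup>2 * b\<^sup>2) = 0" using w[symmetric] \<open>c = 0\<close> by simp
  ultimately show False by linarith
qed

text \<open>Two points of the surface on one ray differ by factors t and 1/t, both of which are at
  least 1 by star-shapedness.\<close>

lemma normalized_pillow_eq_iff: "sgn (pillow z) = sgn (pillow w) \<longleftrightarrow> pillow_eq z w"
proof
  assume eq: "sgn (pillow z) = sgn (pillow w)"
  define t where "t = norm (pillow w) / norm (pillow z)"
  have t: "t > 0" using pillow_nonzero by (simp add: t_def)
  have nz: "norm (pillow w) > 0" "norm (pillow z) > 0" using pillow_nonzero by simp_all
  have "pillow w = norm (pillow w) *\<^sub>R sgn (pillow w)" using pillow_nonzero[of w] by (simp add: sgn_div_norm)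
  also have "\<dots> = t *\<^sub>R pillow z" unfolding eq[symmetric] by (simp add: sgn_div_norm t_def divide_inverse)
  finally have w: "pillow w = t *\<^sub>R pillow z" .
  then have "pillow z = (1 / t) *\<^sub>R pillow w" using t by simp
  then have "1 / t \<ge> 1" using t by (intro pillow_star_shaped) auto
  moreover have "t \<ge> 1" using w t by (rule pillow_star_shaped)
  ultimately have "t = 1" using t by (simp add: field_simps)
  then have "pillow z = pillow w" using w by simp
  then show "pillow_eq z w" unfolding pillow_eq_iff .
next
  assume "pillow_eq z w"
  then show "sgn (pillow z) = sgn (pillow w)" using pillow_eq_iff by metis
qed

lemma pillow_surjI:
  assumes "c\<^sup>2 = (1 - a\<^sup>2) * (1 - b\<^sup>2)" "a\<^sup>2 \<le> 1" "b\<^sup>2 \<le> 1"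
  obtains z where "pillow z = (Complex a b, c)"
proof -
  have ab: "-1 \<le> a" "a \<le> 1" "-1 \<le> b" "b \<le> 1" using assms(2,3) by (simp_all add: abs_square_le_1 abs_le_iff)
  define x y where "x = arccos a / pi" and "y = arccos b / pi"
  have cs: "cos (pi * x) = a" "cos (pi * y) = b" using ab by (simp_all add: x_def y_def)
  define s where "s = (sin (pi * x) * sin (pi * y))"
  have "s\<^sup>2 = c\<^sup>2"
    unfolding s_def assms(1) by (simp add: power_mult_distrib sin_squared_eq cs)
  then consider "s = c" | "s = - c" by (auto simp: power2_eq_iff)
  then show thesis
  proof cases
    case 1
    then show thesis using that[of "Complex x y"] cs by (simp add: pillow_def s_def)
  next
    case 2
    \<comment> \<open>Replacing y by -y keeps both cosines and flips the sign of the product of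
      sines.\<close>
    then show thesis using that[of "Complex x (- y)"] cs by (simp add: pillow_def s_def)
  qed
qed

text \<open>The surface equation is solved along the ray through \<open>v\<close> by the
  intermediate value theorem.\<close>

lemma normalized_pillow_surj:
  assumes "norm v = 1"
  obtains z where "sgn (pillow z) = v"
proof -
  obtain a b c where v: "v = (Complex a b, c)" by (metis complex.collapse surj_pair)
  then have n: "a\<^sup>2 + b\<^sup>2 + c\<^sup>2 = 1" using assms by (simp add: norm_Pair cmod_def)
  \<comment> \<open>At t = 1/M the ray leaves the region where both of the first two coordinates
    have modulus at most 1, and there the product in the surface equation vanishes. M = 0 is the
    case of the two poles, which already lie on the surface.\<close>
  define M where "M = max (\<bar>a\<bar>) (\<bar>b\<bar>)"
  have "\<exists>t>0. (t * c)\<^sup>2 = (1 - (t * a)\<^sup>2) * (1 - (t * b)\<^sup>2) \<and> (t * a)\<^sup>2 \<le> 1 \<and> (t * b)\<^sup>2 \<le> 1"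
  proof (cases "M = 0")
    case True
    then have "a = 0" "b = 0" by (auto simp: M_def max_def split: if_splits)
    then show ?thesis using n by (intro exI[of _ 1]) simp
  next
    case False
    then have M: "M > 0" by (auto simp: M_def)
    let ?g = "\<lambda>t. (1 - (t * a)\<^sup>2) * (1 - (t * b)\<^sup>2) - (t * c)\<^sup>2"
    have ab: "\<bar>a\<bar> \<le> M" "\<bar>b\<bar> \<le> M" "\<bar>a\<bar> = M \<or> \<bar>b\<bar> = M" by (auto simp: M_def)
    have "(1 / M * a)\<^sup>2 = 1 \<or> (1 / M * b)\<^sup>2 = 1"
      using ab(3) M by (auto simp: abs_square_eq_1)
    then have "?g (1 / M) \<le> 0" by auto
    moreover have "?g 0 \<ge> 0" by simp
    ultimately have "\<exists>t\<ge>0. t \<le> 1 / M \<and> ?g t = 0"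
      using M by (intro IVT2') (auto intro!: continuous_intros)
    then obtain t where t: "0 \<le> t" "t \<le> 1 / M" "?g t = 0" by auto
    then have "t \<noteq> 0" by auto
    have "\<bar>t * x\<bar> \<le> 1" if "\<bar>x\<bar> \<le> M" for x
    proof -
      have "\<bar>t * x\<bar> \<le> 1 / M * M" unfolding abs_mult using t M that by (intro mult_mono) auto
      then show ?thesis using M by simp
    qed
    then show ?thesis using t \<open>t \<noteq> 0\<close> ab by (intro exI[of _ t]) (auto simp: abs_square_le_1)
  qed
  then obtain t where t: "t > 0" "(t * c)\<^sup>2 = (1 - (t * a)\<^sup>2) * (1 - (t * b)\<^sup>2)" "(t * a)\<^sup>2 \<le> 1" "(t * b)\<^sup>2 \<le> 1"
    by blast
  then obtain z where "pillow z = (Complex (t * a) (t * b), t * c)" using pillow_surjI by metis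
  then have "pillow z = t *\<^sub>R v" by (simp add: v complex_eq_iff)
  then have "sgn (pillow z) = v" using t assms by (simp add: sgn_div_norm)
  then show thesis by (rule that)
qed

section \<open>The sphere as an open quotient of the plane\<close>

lemma pillow_eq_fundamental_domain:
  obtains w where "pillow_eq z w" "0 \<le> Re w" "Re w < 2" "0 \<le> Im w" "Im w < 2"
    "\<exists>(m::int) (n::int). Re w = Re z + 2 * real_of_int m \<and> Im w = Im z + 2 * real_of_int n"
proof -
  have "\<exists>m::int. 0 \<le> x + 2 * real_of_int m \<and> x + 2 * real_of_int m < 2" for x :: real
  proof (intro exI[of _ "- \<lfloor>x / 2\<rfloor>"])
    show "0 \<le> x + 2 * real_of_int (- \<lfloor>x / 2\<rfloor>) \<and> x + 2 * real_of_int (- \<lfloor>x / 2\<rfloor>) < 2"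
      using floor_correct[of "x / 2"] by simp linarith
  qed
  then obtain m n :: int where "0 \<le> Re z + 2 * real_of_int m \<and> Re z + 2 * real_of_int m < 2"
      "0 \<le> Im z + 2 * real_of_int n \<and> Im z + 2 * real_of_int n < 2"
    by metis
  then show thesis
    by (intro that[of "Complex (Re z + 2 * real_of_int m) (Im z + 2 * real_of_int n)"]) (auto simp: pillow_eq_def)
qed

lemma pillow_eq_refl: "pillow_eq z z"
  and pillow_eq_sym: "pillow_eq z w \<Longrightarrow> pillow_eq w z"
  and pillow_eq_trans: "pillow_eq z w \<Longrightarrow> pillow_eq w v \<Longrightarrow> pillow_eq z v"
  using pillow_eq_iff by metis+

text \<open>The saturation is the union of the images of \<open>U\<close> under all group elements,
  which are homeomorphisms of the plane.\<close>

lemma open_pillow_saturation: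
  assumes "open U"
  shows "open {w. \<exists>z\<in>U. pillow_eq z w}"
proof -
  have "{w. \<exists>z\<in>U. pillow_eq z w} =
      (\<Union>m::int. \<Union>n::int. (\<lambda>z. Complex (2 * real_of_int m) (2 * real_of_int n) + z) ` U \<union> (\<lambda>z. Complex (2 * real_of_int m) (2 * real_of_int n) - z) ` U)"
    (is "?A = ?B")
  proof (intro equalityI subsetI)
    fix w assume "w \<in> ?A"
    then obtain z and m n :: int where z: "z \<in> U"
      "Re w = Re z + 2 * real_of_int m \<and> Im w = Im z + 2 * real_of_int n \<or> Re w = - Re z + 2 * real_of_int m \<and> Im w = - Im z + 2 * real_of_int n"
      unfolding pillow_eq_def by blast
    then have "w = Complex (2 * real_of_int m) (2 * real_of_int n) + z \<or> w = Complex (2 * real_of_int m) (2 * real_of_int n) - z"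
      by (auto simp: complex_eq_iff)
    then show "w \<in> ?B" using z(1) by blast
  next
    fix w assume "w \<in> ?B"
    then obtain z and m n :: int where z: "z \<in> U"
      "w = Complex (2 * real_of_int m) (2 * real_of_int n) + z \<or> w = Complex (2 * real_of_int m) (2 * real_of_int n) - z" by blast
    then have "Re w = Re z + 2 * real_of_int m \<and> Im w = Im z + 2 * real_of_int n \<or> Re w = - Re z + 2 * real_of_int m \<and> Im w = - Im z + 2 * real_of_int n"
      by auto
    then show "w \<in> ?A" unfolding pillow_eq_def using z(1) by blast
  qed
  moreover have "open ((\<lambda>z. c + z) ` U)" for c :: complex
    using assms by (rule open_translation)
  moreover have "open ((\<lambda>z. c - z) ` U)" for c :: complex
  proof -
    have "(\<lambda>z. c - z) ` U = (\<lambda>w. c - w) -` U"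
    proof (intro equalityI subsetI)
      fix w assume "w \<in> (\<lambda>w. c - w) -` U"
      then show "w \<in> (\<lambda>z. c - z) ` U" by (intro image_eqI[of _ _ "c - w"]) auto
    qed auto
    then show ?thesis using assms by (simp add: open_vimage continuous_intros)
  qed
  ultimately show ?thesis by (auto intro!: open_UN open_Un)
qed

text \<open>Presents \<open>X\<close> as the pillowcase: an open continuous surjection from the
  plane whose fibres are the orbits. From here on the embedding in 3-space is no longer
  needed.\<close>

definition pillow_map :: "'a topology \<Rightarrow> (complex \<Rightarrow> 'a) \<Rightarrow> bool" where
  "pillow_map X p \<longleftrightarrow> continuous_map euclidean X p \<and> open_map euclidean X p \<and>
     p ` UNIV = topspace X \<and> (\<forall>z w. p z = p w \<longleftrightarrow> pillow_eq z w)"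

text \<open>For openness, the complement of the image of an open set is the image of a compact set,
  namely the closed square of side 2 minus the saturation of the open set.\<close>

lemma pillow_map_sphere: "pillow_map (top_of_set (sphere 0 1)) (\<lambda>z. sgn (pillow z))"
proof -
  let ?u = "\<lambda>z. sgn (pillow z)"
  have cp: "continuous_on S pillow" for S
    unfolding pillow_def Complex_eq by (intro continuous_intros)
  then have cont: "continuous_on S ?u" for S
    using pillow_nonzero by (intro continuous_on_sgn) auto
  have im: "?u ` UNIV = sphere 0 1"
  proof
    show "?u ` UNIV \<subseteq> sphere 0 1" using pillow_nonzero by (auto simp: norm_sgn)
    show "sphere 0 1 \<subseteq> ?u ` UNIV"
    proof
      fix v :: "complex \<times> real" assume "v \<in> sphere 0 1"
      then have "norm v = 1" by simp
      then obtain z where "?u z = v" by (rule normalized_pillow_surj)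
      then show "v \<in> ?u ` UNIV" by blast
    qed
  qed
  have "openin (top_of_set (sphere 0 1)) (?u ` U)" if "open U" for U
  proof -
    define T where "T = {w. \<exists>z\<in>U. pillow_eq z w}"
    define K where "K = cbox 0 (Complex 2 2) \<inter> - T"
    have "open T" using that unfolding T_def by (rule open_pillow_saturation)
    then have "compact K" unfolding K_def
      by (intro compact_Int_closed) (auto simp: closed_def)
    then have "compact (?u ` K)" using cont by (intro compact_continuous_image)
    then have "closed (?u ` K)" by (rule compact_imp_closed)
    moreover have "sphere 0 1 - ?u ` U = ?u ` K"
    proof (intro equalityI subsetI)
      fix v assume v: "v \<in> sphere 0 1 - ?u ` U"
      then have "norm v = 1" by simp
      then obtain z where z: "?u z = v" by (rule normalized_pillow_surj)
      obtain w where w: "pillow_eq z w" "0 \<le> Re w" "Re w < 2" "0 \<le> Im w" "Im w < 2"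
        by (rule pillow_eq_fundamental_domain)
      have uw: "?u w = v" using w(1) z normalized_pillow_eq_iff by metis
      have "w \<notin> T"
      proof
        assume "w \<in> T"
        then obtain z' where "z' \<in> U" "?u z' = ?u w" unfolding T_def using normalized_pillow_eq_iff by auto
        then show False using uw v by (metis DiffD2 image_eqI)
      qed
      then show "v \<in> ?u ` K" using w uw by (auto simp: K_def in_cbox_complex_iff)
    next
      fix v assume "v \<in> ?u ` K"
      then obtain w where w: "w \<notin> T" "v = ?u w" by (auto simp: K_def)
      then have "v \<notin> ?u ` U" using normalized_pillow_eq_iff by (auto simp: T_def dest: pillow_eq_sym)
      then show "v \<in> sphere 0 1 - ?u ` U" using im w by auto
    qed
    moreover have "?u ` U \<subseteq> sphere 0 1" using im by blast
    ultimately have "?u ` U = sphere 0 1 \<inter> - ?u ` K" "open (- ?u ` K)" by (blast, simp add: open_Compl)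
    then show ?thesis unfolding openin_open by blast
  qed
  then show ?thesis
    unfolding pillow_map_def using cont im normalized_pillow_eq_iff
    by (auto simp: open_map_def continuous_map_in_subtopology)
qed

lemma S2_pillow_map:
  assumes "X homeomorphic_space S2"
  obtains p where "pillow_map X p"
proof -
  have "top_of_set (sphere (0::complex \<times> real) 1) homeomorphic_space X"
    using assms S2_homeomorphic_sphere homeomorphic_space_trans homeomorphic_space_sym by metis
  then obtain g where g: "homeomorphic_map (top_of_set (sphere (0::complex \<times> real) 1)) X g"
    by (auto simp: homeomorphic_space)
  note g' = this[unfolded homeomorphic_eq_everything_map]
  let ?u = "\<lambda>z. sgn (pillow z)"
  have u: "continuous_map euclidean (top_of_set (sphere 0 1)) ?u"
    "open_map euclidean (top_of_set (sphere 0 1)) ?u" "?u ` UNIV = sphere 0 1"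
    using pillow_map_sphere by (auto simp: pillow_map_def)
  have "pillow_map X (g \<circ> ?u)"
    unfolding pillow_map_def
  proof (intro conjI allI)
    show "continuous_map euclidean X (g \<circ> ?u)" using u g' by (auto intro: continuous_map_compose)
    show "open_map euclidean X (g \<circ> ?u)" using u g' by (auto intro: open_map_compose)
    show "(g \<circ> ?u) ` UNIV = topspace X" using u(3) g' by (metis image_comp topspace_euclidean_subtopology)
    fix z w
    have "?u z \<in> sphere 0 1" "?u w \<in> sphere 0 1" using u(3) by auto
    then have "g (?u z) = g (?u w) \<longleftrightarrow> ?u z = ?u w" using g' by (auto simp: inj_on_def)
    then show "(g \<circ> ?u) z = (g \<circ> ?u) w \<longleftrightarrow> pillow_eq z w"
      using normalized_pillow_eq_iff by simp
  qed
  then show thesis by (rule that)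
qed

section \<open>Rescaling the pillowcase\<close>

text \<open>Two continuous open maps on \<open>N\<close> that make the same identifications have
  homeomorphic images. This turns functions on the plane into charts of the quotient.\<close>

lemma homeomorphic_map_factor:
  fixes s :: "complex \<Rightarrow> complex"
  assumes p: "continuous_map euclidean X p" "open_map euclidean X p" and N: "open N"
    and s: "continuous_on N s" "\<And>U. open U \<Longrightarrow> U \<subseteq> N \<Longrightarrow> open (s ` U)"
    and eq: "\<And>z w. z \<in> N \<Longrightarrow> w \<in> N \<Longrightarrow> p z = p w \<longleftrightarrow> s z = s w"
  obtains \<phi> where "homeomorphic_map (subtopology X (p ` N)) (top_of_set (s ` N)) \<phi>"
    "\<And>z. z \<in> N \<Longrightarrow> \<phi> (p z) = s z"
proof -
  define \<phi> where "\<phi> u = s (inv_into N p u)" for u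
  have \<phi>: "\<phi> (p z) = s z" if "z \<in> N" for z
  proof -
    have "inv_into N p (p z) \<in> N" "p (inv_into N p (p z)) = p z"
      using that by (auto intro: inv_into_into f_inv_into_f)
    then show ?thesis unfolding \<phi>_def using eq that by blast
  qed
  have open_p: "openin X (p ` U)" if "open U" for U
    using p(2) that by (simp add: open_map_def)
  have top: "topspace (subtopology X (p ` N)) = p ` N"
    using openin_subset[OF open_p[OF N]] by auto
  have "continuous_map (subtopology X (p ` N)) (top_of_set (s ` N)) \<phi>"
    unfolding continuous_map_def top
  proof (intro conjI allI impI)
    show "\<phi> \<in> p ` N \<rightarrow> topspace (top_of_set (s ` N))" using \<phi> by auto
    fix S assume "openin (top_of_set (s ` N)) S"
    then obtain S' where S': "open S'" "S = s ` N \<inter> S'" by (auto simp: openin_open)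
    have "open (N \<inter> s -` S')" using s(1) N S'(1) by (simp add: continuous_on_open_vimage Int_commute)
    then have "openin X (p ` (N \<inter> s -` S'))" by (rule open_p)
    moreover have "{x \<in> p ` N. \<phi> x \<in> S} = p ` (N \<inter> s -` S')"
    proof (intro equalityI subsetI)
      fix x assume "x \<in> {x \<in> p ` N. \<phi> x \<in> S}"
      then obtain z where "z \<in> N" "x = p z" "\<phi> x \<in> S" by blast
      then show "x \<in> p ` (N \<inter> s -` S')" using \<phi> S' by auto
    next
      fix x assume "x \<in> p ` (N \<inter> s -` S')"
      then show "x \<in> {x \<in> p ` N. \<phi> x \<in> S}" using \<phi> S' by auto
    qed
    ultimately show "openin (subtopology X (p ` N)) {x \<in> p ` N. \<phi> x \<in> S}"
      using openin_open_subtopology[OF open_p[OF N]] by auto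
  qed
  moreover have "open_map (subtopology X (p ` N)) (top_of_set (s ` N)) \<phi>"
    unfolding open_map_def
  proof (intro allI impI)
    fix W assume "openin (subtopology X (p ` N)) W"
    then have W: "openin X W" "W \<subseteq> p ` N" using openin_open_subtopology[OF open_p[OF N]] by auto
    have "open (p -` W)"
      using p(1) W(1) by (auto simp: continuous_map_def vimage_def)
    then have "open (s ` (N \<inter> p -` W))" using N by (intro s(2)) auto
    moreover have "\<phi> ` W = s ` (N \<inter> p -` W)"
    proof (intro equalityI subsetI)
      fix y assume "y \<in> \<phi> ` W"
      then obtain x where x: "x \<in> W" "y = \<phi> x" by blast
      then obtain z where "z \<in> N" "x = p z" using W(2) by blast
      then show "y \<in> s ` (N \<inter> p -` W)" using x \<phi> by auto
    next
      fix y assume "y \<in> s ` (N \<inter> p -` W)"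
      then obtain z where "z \<in> N" "p z \<in> W" "y = s z" by blast
      then show "y \<in> \<phi> ` W" using \<phi> by (metis image_eqI)
    qed
    moreover have "s ` (N \<inter> p -` W) \<subseteq> s ` N" by blast
    ultimately show "openin (top_of_set (s ` N)) (\<phi> ` W)"
      using s(2)[OF N] by (simp add: openin_open_eq)
  qed
  moreover have "\<phi> ` p ` N = s ` N" using \<phi> by (auto simp: image_image)
  moreover have "inj_on \<phi> (p ` N)" using \<phi> eq by (auto simp: inj_on_def)
  ultimately have "homeomorphic_map (subtopology X (p ` N)) (top_of_set (s ` N)) \<phi>"
    using top by (intro bijective_open_imp_homeomorphic_map) auto
  then show thesis using \<phi> by (rule that)
qed

text \<open>The order of the stabilizer of the point in the pillowcase group.\<close>

definition cone_order :: "complex \<Rightarrow> nat" where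
  "cone_order z = (if Re z \<in> \<int> \<and> Im z \<in> \<int> then 2 else 1)"

lemma non_integer_separated:
  fixes x :: real
  assumes "x \<notin> \<int>"
  obtains r where "r > 0" "\<And>m::int. r \<le> \<bar>x - of_int m\<bar>"
proof -
  define r where "r = min (x - of_int \<lfloor>x\<rfloor>) (of_int \<lfloor>x\<rfloor> + 1 - x)"
  have "x \<noteq> of_int \<lfloor>x\<rfloor>" using assms by (metis Ints_of_int)
  then have "r > 0" using floor_correct[of x] unfolding r_def by linarith
  moreover have "r \<le> \<bar>x - of_int m\<bar>" for m :: int
  proof -
    have "m \<le> \<lfloor>x\<rfloor> \<or> m \<ge> \<lfloor>x\<rfloor> + 1" by linarith
    then have "real_of_int m \<le> of_int \<lfloor>x\<rfloor> \<or> real_of_int m \<ge> of_int \<lfloor>x\<rfloor> + 1"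
      by (metis of_int_le_iff of_int_add of_int_1)
    then show ?thesis unfolding r_def by linarith
  qed
  ultimately show thesis by (rule that)
qed

text \<open>At a lattice point the half-turn about it belongs to the group, so nearby orbits are the
  fibres of the centred square; elsewhere a small ball contains at most one point of each
  orbit.\<close>

lemma pillow_eq_local:
  obtains r where "r > 0" "\<And>z w. z \<in> ball z0 r \<Longrightarrow> w \<in> ball z0 r \<Longrightarrow>
    pillow_eq z w \<longleftrightarrow> (z - z0) ^ cone_order z0 = (w - z0) ^ cone_order z0"
proof -
  have near: "\<bar>Re z - Re z0\<bar> < r" "\<bar>Im z - Im z0\<bar> < r" if "z \<in> ball z0 r" for z r
    using that abs_Re_le_cmod[of "z - z0"] abs_Im_le_cmod[of "z - z0"]
    by (auto simp: dist_norm norm_minus_commute)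
  have small: "m = 0" if "\<bar>2 * real_of_int m\<bar> < 2" for m
    using that by linarith
  \<comment> \<open>Points of a ball of radius 1/2 differ by less than 1 in each coordinate, while
    nontrivial translations move some coordinate by at least 2.\<close>
  have transl: "w = z" if "Re w = Re z + 2 * real_of_int m" "Im w = Im z + 2 * real_of_int n"
    "z \<in> ball z0 (1/2)" "w \<in> ball z0 (1/2)" for z w m n
  proof -
    have "m = 0" "n = 0" using near[OF that(3)] near[OF that(4)] that(1,2) by (intro small; linarith)+
    then show ?thesis using that by (simp add: complex_eq_iff)
  qed
  show thesis
  proof (cases "Re z0 \<in> \<int> \<and> Im z0 \<in> \<int>")
    case True
    then obtain i j :: int where ij: "Re z0 = i" "Im z0 = j" by (auto simp: Ints_def)
    have "pillow_eq z w \<longleftrightarrow> (z - z0) ^ 2 = (w - z0) ^ 2" if z: "z \<in> ball z0 (1/2)" and w: "w \<in> ball z0 (1/2)" for z w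
    proof
      assume "pillow_eq z w"
      then consider m n :: int where "Re w = Re z + 2 * real_of_int m" "Im w = Im z + 2 * real_of_int n"
        | m n :: int where "Re w = - Re z + 2 * real_of_int m" "Im w = - Im z + 2 * real_of_int n"
        unfolding pillow_eq_def by blast
      then show "(z - z0) ^ 2 = (w - z0) ^ 2"
      proof cases
        case 1
        then show ?thesis using transl z w by metis
      next
        case 2
        have "2 * real_of_int (m - i) = (Re w - Re z0) + (Re z - Re z0)"
          "2 * real_of_int (n - j) = (Im w - Im z0) + (Im z - Im z0)"
          using 2 ij by simp_all
        then have "\<bar>2 * real_of_int (m - i)\<bar> < 2" "\<bar>2 * real_of_int (n - j)\<bar> < 2"
          using near[OF z] near[OF w] by linarith+
        then have "m - i = 0" "n - j = 0" using small by blast+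
        then have eq: "w - z0 = - (z - z0)" using 2 ij by (simp add: complex_eq_iff)
        show ?thesis unfolding eq power2_minus ..
      qed
    next
      assume "(z - z0) ^ 2 = (w - z0) ^ 2"
      then consider "w = z" | "w - z0 = - (z - z0)" by (metis add_diff_cancel diff_add_cancel power2_eq_iff)
      then show "pillow_eq z w"
      proof cases
        case 1
        then show ?thesis by (simp add: pillow_eq_refl)
      next
        case 2
        then have "Re w = - Re z + 2 * real_of_int i \<and> Im w = - Im z + 2 * real_of_int j"
          using ij by (simp add: complex_eq_iff)
        then show ?thesis unfolding pillow_eq_def by blast
      qed
    qed
    then show thesis using True by (intro that[of "1/2"]) (auto simp: cone_order_def)
  next
    case False
    \<comment> \<open>The half-turn with shift (2m, 2n) is centred at the lattice point (m, n), the
      midpoint of any two points it exchanges. If both lay in the ball, that lattice point would be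
      closer to \<open>z0\<close> than \<open>r\<close> allows.\<close>
    obtain r where r: "r > 0" "\<And>m n::int. r \<le> \<bar>Re z0 - of_int m\<bar> \<or> r \<le> \<bar>Im z0 - of_int n\<bar>"
    proof (cases "Re z0 \<in> \<int>")
      case True
      then have "Im z0 \<notin> \<int>" using False by simp
      then show ?thesis using that non_integer_separated by metis
    next
      case False
      then show ?thesis using that non_integer_separated by metis
    qed
    define \<rho> where "\<rho> = min r (1/2)"
    have sub: "z \<in> ball z0 r" "z \<in> ball z0 (1/2)" if "z \<in> ball z0 \<rho>" for z
      using that by (auto simp: \<rho>_def)
    have "pillow_eq z w \<longleftrightarrow> z = w" if z: "z \<in> ball z0 \<rho>" and w: "w \<in> ball z0 \<rho>" for z w
    proof
      assume "pillow_eq z w"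
      then consider m n :: int where "Re w = Re z + 2 * real_of_int m" "Im w = Im z + 2 * real_of_int n"
        | m n :: int where "Re w = - Re z + 2 * real_of_int m" "Im w = - Im z + 2 * real_of_int n"
        unfolding pillow_eq_def by blast
      then show "z = w"
      proof cases
        case 1
        then show ?thesis using transl sub z w by metis
      next
        case 2
        have "\<bar>Re z0 - of_int m\<bar> < r" "\<bar>Im z0 - of_int n\<bar> < r"
          using near[OF sub(1)[OF z]] near[OF sub(1)[OF w]] 2 by linarith+
        then show ?thesis using r(2)[of m n] by linarith
      qed
    qed (simp add: pillow_eq_refl)
    then show thesis using False r(1) by (intro that[of \<rho>]) (auto simp: cone_order_def \<rho>_def)
  qed
qed

lemma open_power_image:
  assumes "open (U :: complex set)" "e \<ge> 1"
  shows "open ((\<lambda>z. z ^ e) ` U)"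
proof (rule open_mapping_thm[of "\<lambda>z. z ^ e" UNIV])
  show "\<not> (\<lambda>z::complex. z ^ e) constant_on UNIV"
  proof
    assume "(\<lambda>z::complex. z ^ e) constant_on UNIV"
    then obtain c where "\<And>z::complex. z ^ e = c" unfolding constant_on_def by blast
    then have "(0::complex) ^ e = 1 ^ e" by metis
    then show False using assms(2) by (cases e) auto
  qed
qed (use assms in \<open>auto intro!: holomorphic_intros\<close>)

definition rescale :: "nat \<Rightarrow> nat \<Rightarrow> complex \<Rightarrow> complex" where
  "rescale a b z = Complex (of_nat a * Re z) (of_nat b * Im z)"

lemma continuous_on_rescale: "continuous_on S (rescale a b)"
  unfolding rescale_def Complex_eq by (intro continuous_intros)

lemma rescale_eq_iff: "a \<ge> 1 \<Longrightarrow> b \<ge> 1 \<Longrightarrow> rescale a b z = rescale a b w \<longleftrightarrow> z = w"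
  by (auto simp: rescale_def complex_eq_iff)

lemma open_rescale_image:
  assumes "a \<ge> 1" "b \<ge> 1" "open U"
  shows "open (rescale a b ` U)"
proof -
  let ?g = "\<lambda>z. Complex (Re z / of_nat a) (Im z / of_nat b)"
  have inv: "rescale a b (?g z) = z" "?g (rescale a b z) = z" for z
    using assms by (auto simp: rescale_def complex_eq_iff)
  have "rescale a b ` U = ?g -` U"
  proof (intro equalityI subsetI)
    fix z assume "z \<in> ?g -` U"
    then show "z \<in> rescale a b ` U" using inv(1)[of z] by (metis imageI vimageD)
  qed (use inv in auto)
  moreover have "continuous_on UNIV ?g"
    unfolding Complex_eq using assms by (intro continuous_intros) auto
  ultimately show ?thesis using assms(3) by (simp add: open_vimage)
qed

lemma pillow_eq_rescale:
  assumes "pillow_eq z w"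
  shows "pillow_eq (rescale a b z) (rescale a b w)"
proof -
  obtain m n :: int where "Re w = Re z + 2 * real_of_int m \<and> Im w = Im z + 2 * real_of_int n \<or>
      Re w = - Re z + 2 * real_of_int m \<and> Im w = - Im z + 2 * real_of_int n"
    using assms unfolding pillow_eq_def by blast
  then have "Re (rescale a b w) = Re (rescale a b z) + 2 * real_of_int (int a * m) \<and>
      Im (rescale a b w) = Im (rescale a b z) + 2 * real_of_int (int b * n) \<or>
      Re (rescale a b w) = - Re (rescale a b z) + 2 * real_of_int (int a * m) \<and>
      Im (rescale a b w) = - Im (rescale a b z) + 2 * real_of_int (int b * n)"
    by (elim disjE conjE) (simp_all add: rescale_def ring_distribs)
  then show ?thesis unfolding pillow_eq_def by blast
qed

lemma cone_order_dvd_rescale: "cone_order z dvd cone_order (rescale a b z)"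
  by (auto simp: cone_order_def rescale_def)

lemma cone_order_pillow_eq:
  assumes "pillow_eq z w"
  shows "cone_order z = cone_order w"
proof -
  have "Re z \<in> \<int> \<longleftrightarrow> Re w \<in> \<int>" "Im z \<in> \<int> \<longleftrightarrow> Im w \<in> \<int>"
    using assms unfolding pillow_eq_def by (auto simp: Ints_minus minus_in_Ints_iff)
  then show ?thesis by (simp add: cone_order_def)
qed

text \<open>In the obvious charts, powers of \<open>z - z0\<close>, the map would not be a power
  map, because rescaling is not complex-linear. The source chart therefore uses the rescaled
  coordinate, and the map becomes exactly the power with exponent the quotient of the two cone
  orders.\<close>

lemma locally_power_map_rescale:
  assumes X: "pillow_map X p" and Y: "pillow_map Y q" and f: "\<And>z. f (p z) = q (rescale a b z)"
    and ab: "a \<ge> 1" "b \<ge> 1"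
  shows "locally_power_map X Y f (p z0) (cone_order (rescale a b z0) div cone_order z0)"
proof -
  let ?L = "rescale a b"
  define e0 e1 where "e0 = cone_order z0" and "e1 = cone_order (?L z0)"
  define k where "k = e1 div e0"
  have e: "e0 \<ge> 1" "e1 \<ge> 1" by (auto simp: e0_def e1_def cone_order_def)
  have ek: "e1 = e0 * k" using cone_order_dvd_rescale by (simp add: k_def e0_def e1_def)
  then have k: "k \<ge> 1" using e by (cases k) auto
  obtain r1 where r1: "r1 > 0" "\<And>z w. z \<in> ball (?L z0) r1 \<Longrightarrow> w \<in> ball (?L z0) r1 \<Longrightarrow>
    pillow_eq z w \<longleftrightarrow> (z - ?L z0) ^ e1 = (w - ?L z0) ^ e1"
    unfolding e1_def by (rule pillow_eq_local) blast
  obtain r0 where r0: "r0 > 0" "\<And>z w. z \<in> ball z0 r0 \<Longrightarrow> w \<in> ball z0 r0 \<Longrightarrow>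
    pillow_eq z w \<longleftrightarrow> (z - z0) ^ e0 = (w - z0) ^ e0"
    unfolding e0_def by (rule pillow_eq_local) blast
  define N where "N = ball z0 r0 \<inter> ?L -` ball (?L z0) r1"
  have N: "open N" "z0 \<in> N" "\<And>z. z \<in> N \<Longrightarrow> ?L z \<in> ball (?L z0) r1"
    using r0 r1 by (auto simp: N_def intro!: open_Int open_vimage continuous_on_rescale)
  \<comment> \<open>The source chart: the target coordinate of the image, but raised to the cone
    order of the source point.\<close>
  define s where "s z = (?L z - ?L z0) ^ e0" for z
  define s1 where "s1 w = (w - ?L z0) ^ e1" for w
  have L0: "?L z - ?L z0 = ?L (z - z0)" "?L (- z) = - ?L z" for z
    by (auto simp: rescale_def complex_eq_iff algebra_simps)
  \<comment> \<open>Powers cannot be pulled through a real-linear map, but the exponent is 1 or 2,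
    so it is enough that rescaling is injective and commutes with sign change.\<close>
  have seq: "s z = s w \<longleftrightarrow> (z - z0) ^ e0 = (w - z0) ^ e0" for z w
  proof -
    have "e0 = 1 \<or> e0 = 2" by (simp add: e0_def cone_order_def)
    then show ?thesis
    proof
      assume "e0 = 1" then show ?thesis using rescale_eq_iff[OF ab] by (simp add: s_def)
    next
      assume "e0 = 2"
      then have "s z = s w \<longleftrightarrow> ?L (z - z0) = ?L (w - z0) \<or> ?L (z - z0) = ?L (- (w - z0))"
        by (simp only: s_def L0 power2_eq_iff)
      also have "\<dots> \<longleftrightarrow> (z - z0) ^ e0 = (w - z0) ^ e0"
        by (simp only: rescale_eq_iff[OF ab] power2_eq_iff \<open>e0 = 2\<close>)
      finally show ?thesis .
    qed
  qed
  have pX: "continuous_map euclidean X p" "open_map euclidean X p" "\<And>z w. p z = p w \<longleftrightarrow> pillow_eq z w"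
    and qY: "continuous_map euclidean Y q" "open_map euclidean Y q" "\<And>z w. q z = q w \<longleftrightarrow> pillow_eq z w"
    using X Y by (auto simp: pillow_map_def)
  have open_s: "open (s ` U)" if "open U" for U
  proof -
    have "open ((\<lambda>z. z ^ e0) ` (\<lambda>z. - ?L z0 + z) ` ?L ` U)"
      using that e ab by (intro open_power_image open_translation open_rescale_image)
    then show ?thesis by (simp add: s_def image_image)
  qed
  have open_s1: "open (s1 ` U)" if "open U" for U
  proof -
    have "open ((\<lambda>z. z ^ e1) ` (\<lambda>z. - ?L z0 + z) ` U)"
      using that e by (intro open_power_image open_translation)
    then show ?thesis by (simp add: s1_def image_image)
  qed
  obtain \<phi> where \<phi>: "homeomorphic_map (subtopology X (p ` N)) (top_of_set (s ` N)) \<phi>"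
    "\<And>z. z \<in> N \<Longrightarrow> \<phi> (p z) = s z"
  proof (rule homeomorphic_map_factor[OF pX(1,2) N(1), of s])
    show "continuous_on N s" unfolding s_def by (intro continuous_intros continuous_on_rescale)
    show "p z = p w \<longleftrightarrow> s z = s w" if "z \<in> N" "w \<in> N" for z w
      using that r0(2)[of z w] pX(3)[of z w] seq[of z w] by (simp add: N_def)
  qed (use open_s in blast)+
  let ?N1 = "ball (?L z0) r1"
  obtain \<psi> where \<psi>: "homeomorphic_map (subtopology Y (q ` ?N1)) (top_of_set (s1 ` ?N1)) \<psi>"
    "\<And>z. z \<in> ?N1 \<Longrightarrow> \<psi> (q z) = s1 z"
  proof (rule homeomorphic_map_factor[OF qY(1,2) open_ball, of "?L z0" r1 s1])
    show "continuous_on ?N1 s1" unfolding s1_def by (intro continuous_intros)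
    show "q z = q w \<longleftrightarrow> s1 z = s1 w" if "z \<in> ?N1" "w \<in> ?N1" for z w
      using that r1(2)[of z w] qY(3)[of z w] by (simp add: s1_def)
  qed (use open_s1 in blast)+
  have "locally_power_map X Y f (p z0) k"
    unfolding locally_power_map_def
  proof (intro conjI exI)
    show "openin X (p ` N)" using pX(2) N(1) by (simp add: open_map_def)
    show "openin Y (q ` ?N1)" using qY(2) by (simp add: open_map_def)
    show "f ` p ` N \<subseteq> q ` ?N1" using N(3) f by auto
    show "open (s ` N)" using N(1) by (rule open_s)
    show "open (s1 ` ?N1)" using open_ball by (rule open_s1)
    show "homeomorphic_map (subtopology X (p ` N)) (top_of_set (s ` N)) \<phi>" by fact
    show "homeomorphic_map (subtopology Y (q ` ?N1)) (top_of_set (s1 ` ?N1)) \<psi>" by fact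
    show "\<phi> (p z0) = 0" using \<phi>(2)[OF N(2)] e by (simp add: s_def)
    show "\<psi> (f (p z0)) = 0" using \<psi>(2)[OF N(3)[OF N(2)]] e f by (simp add: s1_def)
    show "\<forall>u\<in>p ` N. \<psi> (f u) = \<phi> u ^ k"
    proof
      fix u assume "u \<in> p ` N"
      then obtain z where z: "z \<in> N" "u = p z" by blast
      have "\<psi> (f u) = s1 (?L z)" using \<psi>(2)[OF N(3)[OF z(1)]] f z(2) by simp
      also have "\<dots> = s z ^ k" by (simp add: s_def s1_def ek power_mult)
      also have "\<dots> = \<phi> u ^ k" using \<phi>(2) z by simp
      finally show "\<psi> (f u) = \<phi> u ^ k" .
    qed
  qed (use k N in auto)
  then show ?thesis by (simp add: k_def e0_def e1_def)
qed

section \<open>Counting fibres on the torus that doubly covers the pillowcase\<close>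

definition fundamental :: "complex set" where
  "fundamental = {z. 0 \<le> Re z \<and> Re z < 2 \<and> 0 \<le> Im z \<and> Im z < 2}"

definition corners :: "complex set" where
  "corners = {0, 1, \<i>, 1 + \<i>}"

text \<open>Equality on the torus, the quotient by the translations alone, where rescaling has
  fibres of exactly \<open>a * b\<close> points.\<close>

definition transl_eq :: "complex \<Rightarrow> complex \<Rightarrow> bool" where
  "transl_eq z w \<longleftrightarrow> (\<exists>(m::int) (n::int). Re w = Re z + 2 * real_of_int m \<and> Im w = Im z + 2 * real_of_int n)"

text \<open>The representative of \<open>- z\<close> in the half-open square; a zero coordinate
  stays zero, since 2 is excluded.\<close>

definition neg_rep :: "complex \<Rightarrow> complex" where
  "neg_rep z = Complex (if Re z = 0 then 0 else 2 - Re z) (if Im z = 0 then 0 else 2 - Im z)"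

lemma transl_eq_sym: "transl_eq z w \<Longrightarrow> transl_eq w z"
  unfolding transl_eq_def
proof (elim exE conjE)
  fix m n :: int assume "Re w = Re z + 2 * real_of_int m" "Im w = Im z + 2 * real_of_int n"
  then show "\<exists>(m::int) (n::int). Re z = Re w + 2 * real_of_int m \<and> Im z = Im w + 2 * real_of_int n"
    by (intro exI[of _ "- m"] exI[of _ "- n"]) simp
qed

lemma transl_eq_trans: "transl_eq z w \<Longrightarrow> transl_eq w v \<Longrightarrow> transl_eq z v"
  unfolding transl_eq_def
proof (elim exE conjE)
  fix m n i j :: int assume "Re w = Re z + 2 * real_of_int m" "Im w = Im z + 2 * real_of_int n"
    "Re v = Re w + 2 * real_of_int i" "Im v = Im w + 2 * real_of_int j"
  then show "\<exists>(m::int) (n::int). Re v = Re z + 2 * real_of_int m \<and> Im v = Im z + 2 * real_of_int n"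
    by (intro exI[of _ "m + i"] exI[of _ "n + j"]) simp
qed

lemma transl_eq_minus: "transl_eq z w \<Longrightarrow> transl_eq (- z) (- w)"
  unfolding transl_eq_def
proof (elim exE conjE)
  fix m n :: int assume "Re w = Re z + 2 * real_of_int m" "Im w = Im z + 2 * real_of_int n"
  then show "\<exists>(m::int) (n::int). Re (- w) = Re (- z) + 2 * real_of_int m \<and> Im (- w) = Im (- z) + 2 * real_of_int n"
    by (intro exI[of _ "- m"] exI[of _ "- n"]) simp
qed

lemma transl_eq_rescale: "transl_eq z w \<Longrightarrow> transl_eq (rescale a b z) (rescale a b w)"
  unfolding transl_eq_def
proof (elim exE conjE)
  fix m n :: int assume "Re w = Re z + 2 * real_of_int m" "Im w = Im z + 2 * real_of_int n"
  then show "\<exists>(m::int) (n::int). Re (rescale a b w) = Re (rescale a b z) + 2 * real_of_int m \<and>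
      Im (rescale a b w) = Im (rescale a b z) + 2 * real_of_int n"
    by (intro exI[of _ "int a * m"] exI[of _ "int b * n"]) (simp add: rescale_def ring_distribs)
qed

lemma rescale_minus: "rescale a b (- z) = - rescale a b z"
  by (simp add: rescale_def complex_eq_iff)

lemma pillow_eq_iff_transl: "pillow_eq z w \<longleftrightarrow> transl_eq z w \<or> transl_eq (- z) w"
  unfolding pillow_eq_def transl_eq_def by auto

lemma transl_eq_fundamental: 
  assumes "transl_eq z w" "z \<in> fundamental" "w \<in> fundamental"
  shows "z = w"
proof -
  obtain m n :: int where mn: "Re w = Re z + 2 * real_of_int m" "Im w = Im z + 2 * real_of_int n"
    using assms(1) unfolding transl_eq_def by blast
  have "0 \<le> Re z" "Re z < 2" "0 \<le> Im z" "Im z < 2" "0 \<le> Re w" "Re w < 2" "0 \<le> Im w" "Im w < 2"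
    using assms(2,3) by (auto simp: fundamental_def)
  then have "m = 0" "n = 0" using mn by linarith+
  then show ?thesis using mn by (simp add: complex_eq_iff)
qed

lemma neg_rep_fundamental: "z \<in> fundamental \<Longrightarrow> neg_rep z \<in> fundamental"
  by (auto simp: fundamental_def neg_rep_def)

lemma transl_eq_neg_rep: "transl_eq (- z) (neg_rep z)"
  unfolding transl_eq_def
  by (intro exI[of _ "if Re z = 0 then 0 else 1"] exI[of _ "if Im z = 0 then 0 else 1"])
     (auto simp: neg_rep_def)

text \<open>The half-open square meets each translation class once, hence each orbit of the whole
  group in one point and its negative, which coincide exactly at cone points.\<close>

lemma pillow_eq_fundamental:
  assumes "z \<in> fundamental" "w \<in> fundamental"
  shows "pillow_eq z w \<longleftrightarrow> w = z \<or> w = neg_rep z"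
proof
  assume "pillow_eq z w"
  then consider "transl_eq z w" | "transl_eq (- z) w" unfolding pillow_eq_iff_transl by blast
  then show "w = z \<or> w = neg_rep z"
  proof cases
    case 1
    then show ?thesis using transl_eq_fundamental assms by blast
  next
    case 2
    then have "transl_eq (neg_rep z) w" using transl_eq_neg_rep transl_eq_sym transl_eq_trans by blast
    then show ?thesis using transl_eq_fundamental assms neg_rep_fundamental by blast
  qed
next
  assume "w = z \<or> w = neg_rep z"
  then show "pillow_eq z w" using transl_eq_neg_rep pillow_eq_iff_transl pillow_eq_refl by blast
qed

lemma fundamental_integer:
  assumes "0 \<le> x" "x < (2::real)"
  shows "x \<in> \<int> \<longleftrightarrow> x = 0 \<or> x = 1"
proof
  assume "x \<in> \<int>"
  then obtain i :: int where "x = i" by (auto simp: Ints_def)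
  then show "x = 0 \<or> x = 1" using assms by simp linarith
qed auto

lemma corners_iff: "z \<in> corners \<longleftrightarrow> z \<in> fundamental \<and> cone_order z = 2"
proof -
  have "z \<in> fundamental \<and> cone_order z = 2 \<longleftrightarrow> (Re z = 0 \<or> Re z = 1) \<and> (Im z = 0 \<or> Im z = 1)"
    using fundamental_integer[of "Re z"] fundamental_integer[of "Im z"]
    unfolding fundamental_def cone_order_def by auto
  also have "\<dots> \<longleftrightarrow> z \<in> corners" by (auto simp: corners_def complex_eq_iff)
  finally show ?thesis ..
qed

lemma neg_rep_fixed_iff:
  assumes "z \<in> fundamental"
  shows "neg_rep z = z \<longleftrightarrow> cone_order z = 2"
proof -
  have "neg_rep z = z \<longleftrightarrow> (Re z = 0 \<or> Re z = 1) \<and> (Im z = 0 \<or> Im z = 1)"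
    unfolding neg_rep_def by (auto simp: complex_eq_iff split: if_splits)
  also have "\<dots> \<longleftrightarrow> cone_order z = 2"
    using assms fundamental_integer[of "Re z"] fundamental_integer[of "Im z"]
    unfolding fundamental_def cone_order_def by auto
  finally show ?thesis .
qed

lemma transl_eq_minus_self_iff: "transl_eq (- w) w \<longleftrightarrow> cone_order w = 2"
proof
  assume "transl_eq (- w) w"
  then obtain m n :: int where "Re w = of_int m" "Im w = of_int n" unfolding transl_eq_def by auto
  then show "cone_order w = 2" by (simp add: cone_order_def)
next
  assume "cone_order w = 2"
  then obtain i j :: int where "Re w = of_int i" "Im w = of_int j"
    by (auto simp: cone_order_def Ints_def split: if_splits)
  then show "transl_eq (- w) w"
    unfolding transl_eq_def by (intro exI[of _ i] exI[of _ j]) simp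
qed

text \<open>A fibre of the rescaling of the torus. Passing to the pillowcase merges its points in
  groups whose size is the local degree.\<close>

definition grid :: "nat \<Rightarrow> nat \<Rightarrow> complex \<Rightarrow> complex set" where
  "grid a b w = {z \<in> fundamental. transl_eq w (rescale a b z)}"

text \<open>In each coordinate \<open>c * x\<close> has to be y + 2i, and the bounds 0 and 2 on x
  and y leave exactly the indices 0, ..., c - 1.\<close>

lemma card_grid:
  assumes "a \<ge> 1" "b \<ge> 1" "w \<in> fundamental"
  shows "finite (grid a b w)" "card (grid a b w) = a * b"
proof -
  define g where "g = (\<lambda>(i::nat, j::nat). Complex ((Re w + 2 * real i) / real a) ((Im w + 2 * real j) / real b))"
  have line: "\<exists>i<c. real c * x = y + 2 * real i"
    if "0 \<le> x" "x < 2" "0 \<le> y" "y < 2" "real c * x = y + 2 * real_of_int m" "c \<ge> 1" for x y c m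
  proof -
    have "0 \<le> real c * x" "real c * x < real c * 2"
      using that(1,2,6) by (auto intro: mult_nonneg_nonneg)
    then have "- 1 < m" "m < int c" using that by linarith+
    then show ?thesis using that by (intro exI[of _ "nat m"]) auto
  qed
  have "grid a b w = g ` ({..<a} \<times> {..<b})"
  proof (intro equalityI subsetI)
    fix z assume "z \<in> grid a b w"
    then obtain m n :: int where mn: "real a * Re z = Re w + 2 * real_of_int m" "real b * Im z = Im w + 2 * real_of_int n"
      and z: "0 \<le> Re z" "Re z < 2" "0 \<le> Im z" "Im z < 2"
      unfolding grid_def transl_eq_def fundamental_def rescale_def by auto
    have w: "0 \<le> Re w" "Re w < 2" "0 \<le> Im w" "Im w < 2" using assms(3) by (auto simp: fundamental_def)
    obtain i where i: "i < a" "real a * Re z = Re w + 2 * real i" using line[OF z(1,2) w(1,2) mn(1) assms(1)] by blast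
    obtain j where j: "j < b" "real b * Im z = Im w + 2 * real j" using line[OF z(3,4) w(3,4) mn(2) assms(2)] by blast
    have "z = g (i, j)" using i j assms(1,2) by (simp add: g_def complex_eq_iff eq_divide_eq mult.commute)
    then show "z \<in> g ` ({..<a} \<times> {..<b})" using i j by blast
  next
    fix z assume "z \<in> g ` ({..<a} \<times> {..<b})"
    then obtain i j where ij: "i < a" "j < b" "z = g (i, j)" by auto
    have "0 \<le> (x + 2 * real i) / real c \<and> (x + 2 * real i) / real c < 2" if "0 \<le> x" "x < 2" "i < c" for x i c
    proof -
      have "real i + 1 \<le> real c" using that(3) by linarith
      then have "x + 2 * real i < 2 * real c" using that by linarith
      then show ?thesis using that by (simp add: divide_less_eq)
    qed
    then have "z \<in> fundamental" using ij assms(3) by (auto simp: fundamental_def g_def)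
    moreover have "transl_eq w (rescale a b z)"
      unfolding transl_eq_def using ij assms(1,2)
      by (intro exI[of _ "int i"] exI[of _ "int j"]) (simp add: g_def rescale_def)
    ultimately show "z \<in> grid a b w" by (simp add: grid_def)
  qed
  moreover have "inj_on g ({..<a} \<times> {..<b})"
    using assms(1,2) by (auto simp: inj_on_def g_def)
  ultimately show "finite (grid a b w)" "card (grid a b w) = a * b"
    by (auto simp: card_image)
qed

text \<open>The orbit of \<open>z\<close> meets the square in \<open>z\<close> and
  \<open>neg_rep z\<close>. The second lies over \<open>w\<close> exactly when \<open>w\<close> and
  \<open>- w\<close> agree on the torus, that is, when \<open>w\<close> is a cone point, and it
  differs from \<open>z\<close> exactly when \<open>z\<close> is not one.\<close>

lemma card_grid_class:
  assumes "w \<in> fundamental" "z \<in> grid a b w"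
  shows "card {z' \<in> grid a b w. pillow_eq z z'} = cone_order w div cone_order z"
proof -
  have z: "z \<in> fundamental" "transl_eq w (rescale a b z)" using assms(2) by (auto simp: grid_def)
  have co: "cone_order w = cone_order (rescale a b z)"
    using z(2) pillow_eq_iff_transl cone_order_pillow_eq by blast
  have "transl_eq (rescale a b (- z)) (rescale a b (neg_rep z))"
    by (intro transl_eq_rescale transl_eq_neg_rep)
  then have s: "transl_eq (- w) (rescale a b (neg_rep z))"
    using transl_eq_minus[OF z(2)] transl_eq_trans unfolding rescale_minus by blast
  have "neg_rep z \<in> grid a b w \<longleftrightarrow> transl_eq w (rescale a b (neg_rep z))"
    using neg_rep_fundamental[OF z(1)] by (simp add: grid_def)
  also have "\<dots> \<longleftrightarrow> transl_eq (- w) w"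
    using s transl_eq_trans transl_eq_sym by blast
  finally have ng: "neg_rep z \<in> grid a b w \<longleftrightarrow> cone_order w = 2"
    unfolding transl_eq_minus_self_iff .
  have eq: "{z' \<in> grid a b w. pillow_eq z z'} = {z, neg_rep z} \<inter> grid a b w"
    using pillow_eq_fundamental[OF z(1)] by (auto simp: grid_def)
  have w12: "cone_order w = 1 \<or> cone_order w = 2" by (simp add: cone_order_def)
  have z12: "cone_order z = 1 \<or> cone_order z = 2" by (simp add: cone_order_def)
  show ?thesis
  proof (cases "cone_order w = 2")
    case True
    then have "{z' \<in> grid a b w. pillow_eq z z'} = {z, neg_rep z}" using eq ng assms(2) by auto
    then show ?thesis using True z12 neg_rep_fixed_iff[OF z(1)] by auto
  next
    case False
    then have 1: "{z' \<in> grid a b w. pillow_eq z z'} = {z}" using eq ng assms(2) by auto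
    have "cone_order z = 1" using False z12 cone_order_dvd_rescale[of z a b] co w12 by auto
    then show ?thesis using False 1 w12 by simp
  qed
qed

text \<open>This will be the number of ones in the partition over \<open>w\<close>: at a preimage of
  a cone point the local degree is 1 exactly if the preimage is itself a cone point.\<close>

definition corner_count :: "nat \<Rightarrow> nat \<Rightarrow> complex \<Rightarrow> nat" where
  "corner_count a b w = card {c \<in> corners. pillow_eq (rescale a b c) w}"

text \<open>Rescaling respects orbits and so descends to the quotients. Degrees are obtained by
  grouping torus fibres into orbits. The hypothesis \<open>branch\<close> guarantees a point of
  local degree 2 over each of the four cone points, so that all of them are branching
  points.\<close>

lemma realizable_rescale:
  assumes X: "X homeomorphic_space S2" and Y: "Y homeomorphic_space S2" and ab: "a \<ge> 1" "b \<ge> 1"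
    and branch: "\<And>w. w \<in> corners \<Longrightarrow> corner_count a b w < a * b"
  shows "realizable X Y (a * b) (image_mset (\<lambda>w. ones_twos (a * b) (corner_count a b w)) (mset_set corners))"
proof -
  let ?L = "rescale a b"
  obtain p where p: "pillow_map X p" using S2_pillow_map[OF X] .
  obtain q where q: "pillow_map Y q" using S2_pillow_map[OF Y] .
  have p_eq: "p z = p w \<longleftrightarrow> pillow_eq z w" and q_eq: "q z = q w \<longleftrightarrow> pillow_eq z w" for z w
    using p q by (auto simp: pillow_map_def)
  have p_surj: "p ` UNIV = topspace X" and q_surj: "q ` UNIV = topspace Y"
    using p q by (auto simp: pillow_map_def)
  define f where "f x = q (?L (inv_into UNIV p x))" for x
  have f: "f (p z) = q (?L z)" for z
  proof -
    have "p (inv_into UNIV p (p z)) = p z" by (simp add: f_inv_into_f)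
    then have "pillow_eq (?L (inv_into UNIV p (p z))) (?L z)" using p_eq pillow_eq_rescale by blast
    then show ?thesis unfolding f_def using q_eq by blast
  qed
  have lpm: "locally_power_map X Y f (p z) (cone_order (?L z) div cone_order z)" for z
    using locally_power_map_rescale[OF p q f ab] .
  then have ld: "local_degree X Y f (p z) = cone_order (?L z) div cone_order z" for z
    by (rule local_degree_eqI)
  have "quotient_map euclidean X p"
    using p by (intro continuous_open_imp_quotient_map) (auto simp: pillow_map_def)
  moreover have "continuous_map euclidean Y (f \<circ> p)"
  proof -
    have "continuous_map euclidean Y (q \<circ> ?L)"
      using q continuous_on_rescale by (intro continuous_map_compose[of _ euclidean]) (auto simp: pillow_map_def)
    moreover have "f \<circ> p = q \<circ> ?L" using f by auto
    ultimately show ?thesis by simp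
  qed
  ultimately have "continuous_map X Y f" by (rule continuous_compose_quotient_map)
  then have bc: "branched_cover X Y f"
    unfolding branched_cover_def using lpm p_surj by (metis imageE)
  have fibre: "fibre X f (q w) = p ` grid a b w" if "w \<in> fundamental" for w
  proof (intro equalityI subsetI)
    fix x assume "x \<in> fibre X f (q w)"
    then obtain z where "x = p z" "f x = q w" unfolding fibre_def using p_surj by blast
    then have z: "x = p z" "pillow_eq w (?L z)" using f[of z] q_eq[of w "?L z"] by simp_all
    \<comment> \<open>Replacing z by its negative if necessary, its image becomes a translate of
      \<open>w\<close> itself rather than of \<open>- w\<close>, as membership in
      \<open>grid\<close> demands.\<close>
    obtain z' where z': "pillow_eq z z'" "transl_eq w (?L z')"
    proof (cases "transl_eq w (?L z)")
      case True
      then show ?thesis using that pillow_eq_refl by blast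
    next
      case False
      then have "transl_eq (- w) (?L z)" using z pillow_eq_iff_transl by blast
      then have "transl_eq w (?L (- z))" using transl_eq_minus[of "- w"] by (simp add: rescale_minus)
      moreover have "transl_eq (- z) (- z)" unfolding transl_eq_def by (intro exI[of _ 0]) simp
      then have "pillow_eq z (- z)" by (simp add: pillow_eq_iff_transl)
      ultimately show ?thesis using that by blast
    qed
    obtain v where v: "pillow_eq z' v" "0 \<le> Re v" "Re v < 2" "0 \<le> Im v" "Im v < 2"
      "\<exists>(m::int) (n::int). Re v = Re z' + 2 * real_of_int m \<and> Im v = Im z' + 2 * real_of_int n"
      by (rule pillow_eq_fundamental_domain)
    then have "transl_eq z' v" by (simp add: transl_eq_def)
    then have "transl_eq w (?L v)" using z'(2) transl_eq_rescale transl_eq_trans by blast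
    then have "v \<in> grid a b w" using v by (simp add: grid_def fundamental_def)
    moreover have "x = p v" using z(1) z'(1) v(1) p_eq by metis
    ultimately show "x \<in> p ` grid a b w" by blast
  next
    fix x assume "x \<in> p ` grid a b w"
    then obtain z where z: "x = p z" "transl_eq w (?L z)" by (auto simp: grid_def)
    then have "f x = q w" using f q_eq pillow_eq_iff_transl by metis
    then show "x \<in> fibre X f (q w)" using z(1) p_surj by (auto simp: fibre_def)
  qed
  have ld_grid: "local_degree X Y f (p z) = cone_order w div cone_order z" if "z \<in> grid a b w" for z w
  proof -
    have "cone_order w = cone_order (?L z)"
      using that pillow_eq_iff_transl cone_order_pillow_eq by (simp add: grid_def)
    then show ?thesis using ld by simp
  qed
  have fin: "finite (fibre X f (q w))" if "w \<in> fundamental" for w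
    using fibre[OF that] card_grid(1)[OF ab that] by simp
  have sum: "(\<Sum>x\<in>fibre X f (q w). local_degree X Y f x) = a * b" if w: "w \<in> fundamental" for w
  proof -
    have "a * b = (\<Sum>z\<in>grid a b w. 1)" using card_grid[OF ab w] by simp
    \<comment> \<open>Groups the \<open>a * b\<close> torus points by their image in the pillowcase;
      each group has as many points as the local degree there.\<close>
    also have "\<dots> = (\<Sum>x\<in>p ` grid a b w. \<Sum>z | z \<in> grid a b w \<and> p z = x. 1)"
      by (rule sum.image_gen[OF card_grid(1)[OF ab w]])
    also have "\<dots> = (\<Sum>x\<in>p ` grid a b w. local_degree X Y f x)"
    proof (rule sum.cong[OF refl])
      fix x assume "x \<in> p ` grid a b w"
      then obtain z where z: "z \<in> grid a b w" "x = p z" by blast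
      have "p z' = x \<longleftrightarrow> pillow_eq z z'" for z' using z(2) p_eq[of z z'] by auto
      then have "{z' \<in> grid a b w. p z' = x} = {z' \<in> grid a b w. pillow_eq z z'}" by simp
      then show "(\<Sum>z | z \<in> grid a b w \<and> p z = x. 1) = local_degree X Y f x"
        using card_grid_class[OF w z(1)] ld_grid[OF z(1)] z(2) by simp
    qed
    finally show ?thesis using fibre[OF w] by simp
  qed
  have surj: "\<exists>w\<in>fundamental. y = q w" if "y \<in> topspace Y" for y
  proof -
    have "y \<in> q ` UNIV" using that q_surj by simp
    then obtain z where z: "y = q z" by (rule imageE)
    obtain w where "pillow_eq z w" "0 \<le> Re w" "Re w < 2" "0 \<le> Im w" "Im w < 2"
      by (rule pillow_eq_fundamental_domain)
    then show ?thesis using z q_eq by (intro bexI[of _ w]) (auto simp: fundamental_def)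
  qed
  have deg: "has_degree X Y f (a * b)"
    unfolding has_degree_def
  proof
    fix y assume y: "y \<in> topspace Y - branching_points X Y f"
    then obtain w where w: "w \<in> fundamental" "y = q w" using surj by blast
    have "local_degree X Y f x = 1" if "x \<in> fibre X f y" for x
    proof -
      have "\<not> 1 < local_degree X Y f x" using y that by (auto simp: branching_points_def)
      moreover have "1 \<le> local_degree X Y f x"
        using locally_power_map_imp_topspace(3)[OF locally_power_map_local_degree[OF bc]] that
        by (simp add: fibre_def)
      ultimately show ?thesis by simp
    qed
    then have "card (fibre X f y) = (\<Sum>x\<in>fibre X f y. local_degree X Y f x)" by simp
    then show "finite (fibre X f y) \<and> card (fibre X f y) = a * b"
      using fin sum w by simp
  qed
  have corner_fund: "corners \<subseteq> fundamental" using corners_iff by blast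
  have degs: "local_degrees X Y f (q w) = ones_twos (a * b) (corner_count a b w)" if w: "w \<in> corners" for w
  proof -
    let ?M = "local_degrees X Y f (q w)" and ?F = "fibre X f (q w)"
    have wf: "w \<in> fundamental" "cone_order w = 2" using w corners_iff by auto
    have F: "?F = p ` grid a b w" by (rule fibre[OF wf(1)])
    have 12: "local_degree X Y f (p z) = 2 div cone_order z" if "z \<in> grid a b w" for z
      using ld_grid[OF that] wf(2) by simp
    have set: "set_mset ?M \<subseteq> {1, 2}"
      using fin[OF wf(1)] F 12 by (auto simp: local_degrees_def cone_order_def)
    have "sum_mset ?M = a * b"
      unfolding local_degrees_def using sum[OF wf(1)] by (simp add: sum_unfold_sum_mset)
    then have part: "partition_of (a * b) ?M" using set by (auto simp: partition_of_def)
    have "{x \<in> ?F. local_degree X Y f x = 1} = p ` {c \<in> corners. pillow_eq (?L c) w}"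
    proof (intro equalityI subsetI)
      fix x assume "x \<in> {x \<in> ?F. local_degree X Y f x = 1}"
      then obtain z where z: "z \<in> grid a b w" "x = p z" "local_degree X Y f (p z) = 1" using F by auto
      then have "cone_order z = 2" using 12 by (auto simp: cone_order_def split: if_splits)
      then have "z \<in> corners" using z corners_iff by (simp add: grid_def)
      moreover have "pillow_eq (?L z) w"
        using z(1) pillow_eq_iff_transl pillow_eq_sym unfolding grid_def by blast
      ultimately show "x \<in> p ` {c \<in> corners. pillow_eq (?L c) w}" using z by blast
    next
      fix x assume "x \<in> p ` {c \<in> corners. pillow_eq (?L c) w}"
      then obtain c where c: "c \<in> corners" "pillow_eq (?L c) w" "x = p c" by blast
      have cc: "cone_order c = 2" using c corners_iff by blast
      have "cone_order (?L c) = 2" using cone_order_pillow_eq[OF c(2)] wf by simp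
      then have "local_degree X Y f x = 1" using ld c cc by simp
      moreover have "x \<in> ?F" using c(2,3) f q_eq p_surj by (auto simp: fibre_def)
      ultimately show "x \<in> {x \<in> ?F. local_degree X Y f x = 1}" by simp
    qed
    moreover have "inj_on p {c \<in> corners. pillow_eq (?L c) w}"
    proof (rule inj_onI)
      fix c c' assume "c \<in> {c \<in> corners. pillow_eq (?L c) w}" "c' \<in> {c \<in> corners. pillow_eq (?L c) w}" "p c = p c'"
      then show "c = c'" using p_eq pillow_eq_fundamental corners_iff neg_rep_fixed_iff by (metis mem_Collect_eq)
    qed
    ultimately have "card {x \<in> ?F. local_degree X Y f x = 1} = corner_count a b w"
      by (simp add: card_image corner_count_def)
    then have "count ?M 1 = corner_count a b w"
      using fin[OF wf(1)] unfolding local_degrees_def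
      by (simp add: count_image_mset vimage_def Int_def conj_commute)
    then show ?thesis using partition_determined_by_ones[OF part set] by simp
  qed
  have inj_q: "inj_on q corners"
  proof (rule inj_onI)
    fix c c' assume "c \<in> corners" "c' \<in> corners" "q c = q c'"
    then show "c = c'" using q_eq pillow_eq_fundamental corners_iff neg_rep_fixed_iff by metis
  qed
  have bp: "branching_points X Y f = q ` corners"
  proof (intro equalityI subsetI)
    fix y assume y: "y \<in> branching_points X Y f"
    then obtain x where x: "x \<in> fibre X f y" "1 < local_degree X Y f x" by (auto simp: branching_points_def)
    obtain w where w: "w \<in> fundamental" "y = q w" using surj y by (auto simp: branching_points_def)
    then obtain z where z: "z \<in> grid a b w" "x = p z" using x fibre by blast
    have "cone_order w = 2" using x(2) ld_grid[OF z(1)] z(2)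
      by (auto simp: cone_order_def split: if_splits)
    then show "y \<in> q ` corners" using w corners_iff by blast
  next
    fix y assume "y \<in> q ` corners"
    then obtain w where w: "w \<in> corners" "y = q w" by blast
    \<comment> \<open>Without a 2 the partition would consist of \<open>corner_count a b w\<close>
      ones, too few to sum to \<open>a * b\<close>.\<close>
    have "2 \<in># ones_twos (a * b) (corner_count a b w)"
    proof (rule ccontr)
      assume "2 \<notin># ones_twos (a * b) (corner_count a b w)"
      then have "ones_twos (a * b) (corner_count a b w) = replicate_mset (corner_count a b w) 1"
        by (simp add: ones_twos_def split: if_splits)
      moreover have "sum_mset (local_degrees X Y f y) = a * b"
        using sum w corner_fund by (auto simp: local_degrees_def sum_unfold_sum_mset)
      ultimately show False using degs[OF w(1)] w(2) branch[OF w(1)] by simp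
    qed
    then have "2 \<in># local_degrees X Y f y" using degs w by simp
    then obtain x where "x \<in> fibre X f y" "local_degree X Y f x = 2"
      using fin w corner_fund by (auto simp: local_degrees_def)
    then show "y \<in> branching_points X Y f"
      using w q_surj by (auto simp: branching_points_def intro!: bexI[of _ x])
  qed
  have "finite corners" by (simp add: corners_def)
  then have "image_mset (local_degrees X Y f) (mset_set (branching_points X Y f)) =
      image_mset (\<lambda>w. ones_twos (a * b) (corner_count a b w)) (mset_set corners)"
    unfolding bp image_mset_mset_set[OF inj_q, symmetric] multiset.map_comp
    using degs by (intro image_mset_cong) auto
  then show ?thesis
    unfolding realizable_def using bc deg bp \<open>finite corners\<close> by (intro exI[of _ f]) auto
qed

section \<open>The action of rescaling on the cone points\<close>

lemma pillow_eq_integers: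
  "pillow_eq (Complex (of_int i) (of_int j)) (Complex (of_int i') (of_int j')) \<longleftrightarrow> even (i - i') \<and> even (j - j')"
proof
  assume "pillow_eq (Complex (of_int i) (of_int j)) (Complex (of_int i') (of_int j'))"
  then obtain m n :: int where "real_of_int i' = of_int i + 2 * of_int m \<and> real_of_int j' = of_int j + 2 * of_int n \<or>
      real_of_int i' = - of_int i + 2 * of_int m \<and> real_of_int j' = - of_int j + 2 * of_int n"
    unfolding pillow_eq_def by auto
  then have "i' = i + 2 * m \<and> j' = j + 2 * n \<or> i' = - i + 2 * m \<and> j' = - j + 2 * n" by linarith
  then show "even (i - i') \<and> even (j - j')" by presburger
next
  assume "even (i - i') \<and> even (j - j')"
  then obtain m n where "i - i' = 2 * m" "j - j' = 2 * n" by (meson evenE)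
  then have "i' = i + 2 * (- m)" "j' = j + 2 * (- n)" by linarith+
  then have "real_of_int i' = of_int i + 2 * of_int (- m)" "real_of_int j' = of_int j + 2 * of_int (- n)"
    by simp_all
  then show "pillow_eq (Complex (of_int i) (of_int j)) (Complex (of_int i') (of_int j'))"
    unfolding pillow_eq_def by (metis complex.sel)
qed

lemma corner_count_eq:
  fixes i' j' :: int
  shows "corner_count a b (Complex (of_int i') (of_int j')) =
    card {(i, j). i \<in> {0, 1} \<and> j \<in> {0, 1} \<and> even (int a * i - i') \<and> even (int b * j - j')}"
proof -
  define g where "g = (\<lambda>(i::int, j::int). Complex (of_int i) (of_int j))"
  define S :: "(int \<times> int) set" where "S = {0, 1} \<times> {0, 1}"
  let ?Q = "\<lambda>c. pillow_eq (rescale a b c) (Complex (of_int i') (of_int j'))"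
  have "S = {(0, 0), (1, 0), (0, 1), (1, 1)}" by (auto simp: S_def)
  moreover have "g (0, 0) = 0" "g (1, 0) = 1" "g (0, 1) = \<i>" "g (1, 1) = 1 + \<i>"
    by (simp_all add: g_def complex_eq_iff)
  ultimately have corners: "corners = g ` S"
    unfolding corners_def by simp
  have "{c \<in> corners. ?Q c} = g ` {x \<in> S. ?Q (g x)}" unfolding corners by blast
  moreover have "inj_on g A" for A by (auto simp: inj_on_def g_def)
  ultimately have "corner_count a b (Complex (of_int i') (of_int j')) = card {x \<in> S. ?Q (g x)}"
    by (simp add: corner_count_def card_image)
  moreover have Q: "?Q (g (i, j)) \<longleftrightarrow> even (int a * i - i') \<and> even (int b * j - j')" for i j
    using pillow_eq_integers[of "int a * i" "int b * j" i' j'] by (simp add: rescale_def g_def)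
  have "{x \<in> S. ?Q (g x)} = {(i, j). i \<in> {0, 1} \<and> j \<in> {0, 1} \<and> even (int a * i - i') \<and> even (int b * j - j')}"
    by (auto simp: S_def Q simp del: even_diff)
  ultimately show ?thesis by simp
qed

lemma parity_count:
  "card {i::int. i \<in> {0, 1} \<and> even (int a * i - i')} = (if even a then if even i' then 2 else 0 else 1)"
proof (cases "even a")
  case True
  then have "{i::int. i \<in> {0, 1} \<and> even (int a * i - i')} = (if even i' then {0, 1} else {})" by auto
  then show ?thesis using True by simp
next
  case False
  then have "{i::int. i \<in> {0, 1} \<and> even (int a * i - i')} = (if even i' then {0} else {1})" by auto
  then show ?thesis using False by simp
qed

text \<open>The cone points form (Z/2)^2 and rescaling acts by the diagonal matrix with entries
  \<open>a\<close> and \<open>b\<close>. Fibre sizes depend on its rank: all 1 in rank 2; 2, 2, 0, 0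
  in rank 1; 4, 0, 0, 0 in rank 0.\<close>

lemma corner_count_corners:
  "image_mset (corner_count a b) (mset_set corners) =
    (if even a then if even b then {#4, 0, 0, 0#} else {#2, 2, 0, 0#}
     else if even b then {#2, 2, 0, 0#} else {#1, 1, 1, 1#})"
proof -
  define n where "n c i = (if even c then if even i then 2 else 0 else 1::nat)" for c :: nat and i :: int
  have cc: "corner_count a b (Complex (of_int i') (of_int j')) = n a i' * n b j'" for i' j' :: int
  proof -
    have "{(i, j). i \<in> {0, 1} \<and> j \<in> {0, 1} \<and> even (int a * i - i') \<and> even (int b * j - j')} =
        {i. i \<in> {0, 1} \<and> even (int a * i - i')} \<times> {j. j \<in> {0, 1} \<and> even (int b * j - j')}"
      by blast
    then show ?thesis
      unfolding corner_count_eq n_def by (simp only: card_cartesian_product parity_count)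
  qed
  have "0 = Complex (of_int 0) (of_int 0)" "1 = Complex (of_int 1) (of_int 0)"
    "\<i> = Complex (of_int 0) (of_int 1)" "1 + \<i> = Complex (of_int 1) (of_int 1)"
    by (simp_all add: complex_eq_iff)
  then have vals: "corner_count a b 0 = n a 0 * n b 0" "corner_count a b 1 = n a 1 * n b 0"
    "corner_count a b \<i> = n a 0 * n b 1" "corner_count a b (1 + \<i>) = n a 1 * n b 1"
    using cc by metis+
  have "(1::complex) \<noteq> \<i>" "(1::complex) \<noteq> 1 + \<i>" "\<i> \<noteq> 1 + \<i>" "(0::complex) \<noteq> 1 + \<i>"
    by (simp_all add: complex_eq_iff)
  then have "mset_set corners = {#0, 1, \<i>, 1 + \<i>#}"
    unfolding corners_def by (simp add: complex_i_not_zero[symmetric])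
  then show ?thesis by (simp add: vals n_def add_mset_commute)
qed

lemma realizable_rescale_parity:
  assumes X: "X homeomorphic_space S2" and Y: "Y homeomorphic_space S2" and ab: "a \<ge> 1" "b \<ge> 1"
    and M: "M = image_mset (corner_count a b) (mset_set corners)" "\<forall>n\<in>#M. n < a * b"
  shows "realizable X Y (a * b) (image_mset (ones_twos (a * b)) M)"
proof -
  have "finite corners" by (simp add: corners_def)
  then have "corner_count a b w < a * b" if "w \<in> corners" for w
    using M that by auto
  then have "realizable X Y (a * b) (image_mset (\<lambda>w. ones_twos (a * b) (corner_count a b w)) (mset_set corners))"
    by (rule realizable_rescale[OF X Y ab])
  then show ?thesis unfolding M(1) by (simp add: multiset.map_comp o_def)
qed

lemma realizable_types:
  assumes X: "X homeomorphic_space S2" and Y: "Y homeomorphic_space S2" and k: "k \<ge> 1"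
  shows "realizable X Y (2 * k + 1) (partitions_type1 k)"
    and "realizable X Y (2 * k + 2) (partitions_type2 k)"
    and "4 dvd 2 * k + 4 \<Longrightarrow> realizable X Y (2 * k + 4) (partitions_type3 k)"
proof -
  \<comment> \<open>In all three cases \<open>k \<ge> 1\<close> enters through the strict bound on
    the number of ones.\<close>
  have "realizable X Y ((2 * k + 1) * 1) (image_mset (ones_twos ((2 * k + 1) * 1)) {#1, 1, 1, 1#})"
    by (rule realizable_rescale_parity[OF X Y]) (use k in \<open>auto simp: corner_count_corners\<close>)
  then show "realizable X Y (2 * k + 1) (partitions_type1 k)"
    unfolding partitions_ones_twos by simp
  have "realizable X Y ((2 * k + 2) * 1) (image_mset (ones_twos ((2 * k + 2) * 1)) {#2, 2, 0, 0#})"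
    by (rule realizable_rescale_parity[OF X Y]) (use k in \<open>auto simp: corner_count_corners\<close>)
  then show "realizable X Y (2 * k + 2) (partitions_type2 k)"
    unfolding partitions_ones_twos by simp
  assume "4 dvd 2 * k + 4"
  \<comment> \<open>The factors \<open>k + 2\<close> and 2 must both be even for all four cone
    points to land on a single one.\<close>
  then have "even k" by presburger
  then have "realizable X Y ((k + 2) * 2) (image_mset (ones_twos ((k + 2) * 2)) {#4, 0, 0, 0#})"
    by (intro realizable_rescale_parity[OF X Y]) (use k in \<open>auto simp: corner_count_corners\<close>)
  moreover have "(k + 2) * 2 = 2 * k + 4" by simp
  ultimately show "realizable X Y (2 * k + 4) (partitions_type3 k)"
    unfolding partitions_ones_twos by metis
qed

section \<open>Continuous square roots on punctured planes\<close>

text \<open>The quotient of the two roots is continuous with values 1 and -1, hence constant on a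
  connected set.\<close>

lemma continuous_square_roots_connected:
  fixes g h :: "'a::topological_space \<Rightarrow> complex"
  assumes "connected S" "continuous_on S g" "continuous_on S h"
    and eq: "\<And>x. x \<in> S \<Longrightarrow> g x ^ 2 = h x ^ 2" and nz: "\<And>x. x \<in> S \<Longrightarrow> h x \<noteq> 0"
  obtains \<epsilon> where "\<epsilon> = 1 \<or> \<epsilon> = -1" "\<And>x. x \<in> S \<Longrightarrow> g x = \<epsilon> * h x"
proof -
  let ?E = "\<lambda>x. g x / h x"
  have "?E x = 1 \<or> ?E x = -1" if "x \<in> S" for x
  proof -
    have "(?E x) ^ 2 = 1" using eq[OF that] nz[OF that] by (simp add: power_divide)
    then show ?thesis by (simp only: power2_eq_1_iff)
  qed
  then have sub: "?E ` S \<subseteq> {1, -1}" by blast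
  then have "finite (?E ` S)" by (rule finite_subset) simp
  moreover have "connected (?E ` S)"
    using assms by (intro connected_continuous_image continuous_intros) auto
  ultimately consider "?E ` S = {}" | e where "?E ` S = {e}"
    using connected_finite_iff_sing by blast
  then show thesis
  proof cases
    case 1
    then show ?thesis using that[of 1] by simp
  next
    case 2
    then have e: "e = 1 \<or> e = -1" using sub by blast
    have "g x = e * h x" if "x \<in> S" for x
    proof -
      have "?E x = e" using 2 that by blast
      then show ?thesis using nz[OF that] by (simp add: field_simps)
    qed
    then show ?thesis using that[of e] e by blast
  qed
qed

text \<open>\<open>W\<close> itself may have odd winding number around 0 and then no root; composing
  with squaring doubles the winding number. The root is found on a half-plane, which covers the
  punctured disc by \<open>exp\<close>, and is then shown to descend.\<close>

lemma continuous_sqrt_pullback_square: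
  fixes W :: "complex \<Rightarrow> complex"
  assumes s: "s > 0" and W: "continuous_on (ball 0 (s\<^sup>2) - {0}) W"
    and nz: "\<And>z. z \<in> ball 0 (s\<^sup>2) - {0} \<Longrightarrow> W z \<noteq> 0"
  obtains V where "continuous_on (ball 0 s - {0}) V" "\<And>z. z \<in> ball 0 s - {0} \<Longrightarrow> V z ^ 2 = W (z ^ 2)"
proof -
  define P where "P = {\<zeta>. Re \<zeta> < ln s}"
  have P: "open P" "convex P" unfolding P_def
    by (simp_all add: open_halfspace_Re_lt convex_halfspace_Re_lt)
  have expP: "exp \<zeta> \<in> ball 0 s - {0} \<longleftrightarrow> \<zeta> \<in> P" for \<zeta>
  proof -
    have "norm (exp \<zeta>) < s \<longleftrightarrow> exp (Re \<zeta>) < exp (ln s)" using s by (simp add: norm_exp_eq_Re)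
    then show ?thesis by (simp add: P_def)
  qed
  have sq: "z ^ 2 \<in> ball 0 (s\<^sup>2) - {0}" if "z \<in> ball 0 s - {0}" for z :: complex
    using that s by (auto simp: norm_power power_strict_mono)
  have cont: "continuous_on P (\<lambda>\<zeta>. W (exp \<zeta> ^ 2))"
  proof (rule continuous_on_compose2[OF W])
    show "(\<lambda>\<zeta>. exp \<zeta> ^ 2) ` P \<subseteq> ball 0 (s\<^sup>2) - {0}"
    proof
      fix w assume "w \<in> (\<lambda>\<zeta>. exp \<zeta> ^ 2) ` P"
      then obtain \<zeta> where "\<zeta> \<in> P" "w = exp \<zeta> ^ 2" by blast
      then show "w \<in> ball 0 (s\<^sup>2) - {0}" using sq[of "exp \<zeta>"] expP[of \<zeta>] by simp
    qed
  qed (intro continuous_intros)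
  have nzP: "W (exp \<zeta> ^ 2) \<noteq> 0" if "\<zeta> \<in> P" for \<zeta>
    using nz[OF sq] expP[of \<zeta>] that by simp
  obtain g where g: "continuous_on P g" "\<And>\<zeta>. \<zeta> \<in> P \<Longrightarrow> W (exp \<zeta> ^ 2) = g \<zeta> ^ 2"
    using continuous_sqrt_on_contractible[OF cont convex_imp_contractible[OF P(2)] nzP] by metis
  have shiftP: "\<zeta> + of_real t * \<i> \<in> P \<longleftrightarrow> \<zeta> \<in> P" for \<zeta> t by (simp add: P_def)
  have exp_pi: "exp (\<zeta> + of_real pi * \<i>) = - exp \<zeta>" for \<zeta>
    by (simp add: exp_add)
  \<comment> \<open>Moving by pi upwards changes the sign of \<open>exp\<close>, hence not its
    square, so the root g changes by a fixed sign. Moving by 2 pi applies this sign twice, and g is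
    invariant.\<close>
  obtain \<epsilon> where \<epsilon>: "\<epsilon> = 1 \<or> \<epsilon> = -1" "\<And>\<zeta>. \<zeta> \<in> P \<Longrightarrow> g (\<zeta> + of_real pi * \<i>) = \<epsilon> * g \<zeta>"
  proof (rule continuous_square_roots_connected[of P "\<lambda>\<zeta>. g (\<zeta> + of_real pi * \<i>)" g])
    show "connected P" using P(2) by (rule convex_connected)
    show "continuous_on P (\<lambda>\<zeta>. g (\<zeta> + of_real pi * \<i>))"
      using shiftP by (intro continuous_on_compose2[OF g(1)] continuous_intros) auto
    show "g (\<zeta> + of_real pi * \<i>) ^ 2 = g \<zeta> ^ 2" if "\<zeta> \<in> P" for \<zeta>
      using g(2)[OF that] g(2)[of "\<zeta> + of_real pi * \<i>"] that shiftP[of \<zeta> pi] exp_pi[of \<zeta>] by simp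
    show "g \<zeta> \<noteq> 0" if "\<zeta> \<in> P" for \<zeta>
      using g(2)[OF that] nzP[OF that] by auto
  qed (use g(1) in auto)
  have period: "g (\<zeta> + of_real (2 * pi) * \<i>) = g \<zeta>" if "\<zeta> \<in> P" for \<zeta>
  proof -
    have e: "\<zeta> + of_real (2 * pi) * \<i> = (\<zeta> + of_real pi * \<i>) + of_real pi * \<i>" by (simp add: algebra_simps)
    have "\<zeta> + of_real pi * \<i> \<in> P" using shiftP that by blast
    then have "g (\<zeta> + of_real (2 * pi) * \<i>) = \<epsilon> * (\<epsilon> * g \<zeta>)"
      unfolding e \<epsilon>(2)[OF that, symmetric] by (rule \<epsilon>(2))
    then show ?thesis using \<epsilon>(1) by auto
  qed
  have period_nat: "g (\<zeta> + of_real (2 * pi * real n) * \<i>) = g \<zeta>" if "\<zeta> \<in> P" for \<zeta> n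
  proof (induction n)
    case (Suc n)
    have "\<zeta> + of_real (2 * pi * real (Suc n)) * \<i> = (\<zeta> + of_real (2 * pi * real n) * \<i>) + of_real (2 * pi) * \<i>"
      by (simp add: algebra_simps)
    then show ?case using Suc period[of "\<zeta> + of_real (2 * pi * real n) * \<i>"] shiftP[of \<zeta> "2 * pi * real n"] that
      by metis
  qed simp
  have g_exp: "g \<zeta> = g \<xi>" if "\<zeta> \<in> P" "\<xi> \<in> P" "exp \<zeta> = exp \<xi>" for \<zeta> \<xi>
  proof -
    obtain n :: int where n: "\<zeta> = \<xi> + (of_int (2 * n) * pi) * \<i>"
      using \<open>exp \<zeta> = exp \<xi>\<close> unfolding exp_eq by blast
    show ?thesis
    proof (cases "n \<ge> 0")
      case True
      then have "\<zeta> = \<xi> + of_real (2 * pi * real (nat n)) * \<i>" using n by simp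
      then show ?thesis using period_nat[OF that(2)] by simp
    next
      case False
      then have "\<xi> = \<zeta> + of_real (2 * pi * real (nat (- n))) * \<i>" using n by (simp add: algebra_simps)
      then show ?thesis using period_nat[OF that(1)] by metis
    qed
  qed
  define V where "V z = g (Ln z)" for z
  have LnP: "Ln z \<in> P" if "z \<in> ball 0 s - {0}" for z
    using expP[of "Ln z"] that by simp
  have "continuous_on (ball 0 s - {0}) V"
  proof (rule continuous_at_imp_continuous_on, rule ballI)
    fix z0 :: complex assume z0: "z0 \<in> ball 0 s - {0}"
    \<comment> \<open>A logarithm that is continuous near \<open>z0\<close> even where
      \<open>Ln\<close> jumps. As g depends only on the exponential of its argument, using it
      instead of \<open>Ln\<close> does not change \<open>V\<close>.\<close>
    define \<zeta> where "\<zeta> z = Ln (z / z0) + Ln z0" for z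
    have nz0: "z0 \<noteq> 0" using z0 by simp
    have c\<zeta>: "isCont \<zeta> z0" unfolding \<zeta>_def using nz0
      by (intro continuous_intros) (auto simp: complex_nonpos_Reals_iff)
    have \<zeta>0: "\<zeta> z0 = Ln z0" using nz0 by (simp add: \<zeta>_def)
    have "isCont g (\<zeta> z0)"
      using g(1) P(1) LnP[OF z0] \<zeta>0 by (simp add: continuous_on_eq_continuous_at)
    then have c: "isCont (\<lambda>z. g (\<zeta> z)) z0" using c\<zeta> by (rule isCont_o2[rotated])
    have "open (ball 0 s - {0 :: complex})" by (simp add: open_Diff)
    then have "eventually (\<lambda>z. z \<in> ball 0 s - {0}) (nhds z0)" using z0 eventually_nhds_in_open by blast
    then have "eventually (\<lambda>z. V z = g (\<zeta> z)) (nhds z0)"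
    proof eventually_elim
      case (elim z)
      then have "exp (\<zeta> z) = z" using nz0 by (simp add: \<zeta>_def exp_add)
      then have "\<zeta> z \<in> P" "exp (Ln z) = exp (\<zeta> z)" using elim expP[of "\<zeta> z"] by auto
      then show ?case unfolding V_def using g_exp LnP[OF elim] by blast
    qed
    from isCont_cong[OF this] show "isCont V z0" using c by simp
  qed
  moreover have "V z ^ 2 = W (z ^ 2)" if "z \<in> ball 0 s - {0}" for z
    using g(2)[OF LnP[OF that]] that by (simp add: V_def)
  ultimately show thesis by (rule that)
qed

text \<open>Composes \<open>u\<close> with the radial retraction of the punctured plane onto the
  punctured closed disc of half the radius.\<close>

lemma radial_extension:
  fixes u :: "complex \<Rightarrow> complex"
  assumes r: "r > 0" and u: "continuous_on (ball a r - {a}) u" and nz: "\<And>z. z \<in> ball a r - {a} \<Longrightarrow> u z \<noteq> 0"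
  obtains G where "continuous_on (- {a}) G" "\<And>z. z \<noteq> a \<Longrightarrow> G z \<noteq> 0"
    "\<And>z. z \<in> ball a (r / 2) - {a} \<Longrightarrow> G z = u z"
proof -
  define t where "t z = a + of_real (min 1 (r / 2 / norm (z - a))) * (z - a)" for z
  have t: "t z \<in> ball a r - {a}" if "z \<noteq> a" for z
  proof -
    have n: "norm (z - a) > 0" using that by simp
    then have m: "min 1 (r / 2 / norm (z - a)) > 0" using r by simp
    have "min 1 (r / 2 / norm (z - a)) * norm (z - a) \<le> r / 2 / norm (z - a) * norm (z - a)"
      by (intro mult_right_mono) auto
    then have "norm (t z - a) \<le> r / 2" using n m by (simp add: t_def norm_mult)
    then have "t z \<in> ball a r" using r by (simp add: dist_norm norm_minus_commute)
    moreover have "t z \<noteq> a" using m n by (simp add: t_def)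
    ultimately show ?thesis by simp
  qed
  have "continuous_on (- {a}) t"
    unfolding t_def by (intro continuous_intros) auto
  moreover have "t ` (- {a}) \<subseteq> ball a r - {a}" using t by (intro image_subsetI) simp
  ultimately have "continuous_on (- {a}) (\<lambda>z. u (t z))"
    by (rule continuous_on_compose2[OF u])
  moreover have "t z = z" if "z \<in> ball a (r / 2) - {a}" for z
  proof -
    have "norm (z - a) < r / 2" "norm (z - a) > 0" using that by (auto simp: dist_norm norm_minus_commute)
    then have "min 1 (r / 2 / norm (z - a)) = 1" by (simp add: min_def divide_simps)
    then show ?thesis by (simp add: t_def)
  qed
  ultimately show thesis using that[of "\<lambda>z. u (t z)"] t nz by simp
qed

text \<open>Dividing out radial extensions of the local roots removes the punctures one by one.\<close>
lemma continuous_sqrt_punctured_plane: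
  fixes F :: "complex \<Rightarrow> complex"
  assumes "finite Z" "continuous_on (- Z) F" "\<And>z. z \<notin> Z \<Longrightarrow> F z \<noteq> 0"
    and "\<And>a. a \<in> Z \<Longrightarrow> \<exists>r>0. \<exists>u. continuous_on (ball a r - {a}) u \<and> (\<forall>z\<in>ball a r - {a}. F z = u z ^ 2)"
  shows "\<exists>h. continuous_on (- Z) h \<and> (\<forall>z. z \<notin> Z \<longrightarrow> F z = h z ^ 2)"
  using assms
proof (induction Z arbitrary: F rule: finite_induct)
  case empty
  then obtain g where "continuous_on UNIV g" "\<And>z. F z = g z ^ 2"
    using continuous_sqrt_on_contractible[OF _ convex_imp_contractible[OF convex_UNIV], of F] by auto
  then show ?case by auto
next
  case (insert a Z)
  obtain r0 u where r0: "r0 > 0" and u0: "continuous_on (ball a r0 - {a}) u" "\<forall>z\<in>ball a r0 - {a}. F z = u z ^ 2"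
    using insert.prems(3)[of a] by blast
  have "open (- Z)" using insert.hyps(1) by (simp add: finite_imp_closed open_Compl)
  then obtain r1 where r1: "r1 > 0" "ball a r1 \<subseteq> - Z"
    using insert.hyps(2) openE[of "- Z" a] by auto
  define r where "r = min r0 r1"
  have r: "r > 0" "ball a r \<subseteq> ball a r0" "ball a r \<subseteq> - Z" using r0 r1 by (auto simp: r_def)
  have u: "continuous_on (ball a r - {a}) u" "\<And>z. z \<in> ball a r - {a} \<Longrightarrow> F z = u z ^ 2"
    using u0 r(2) by (auto intro: continuous_on_subset)
  have unz: "u z \<noteq> 0" if "z \<in> ball a r - {a}" for z
    using u(2)[OF that] insert.prems(2)[of z] that r(3) by fastforce
  obtain G where G: "continuous_on (- {a}) G" "\<And>z. z \<noteq> a \<Longrightarrow> G z \<noteq> 0"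
    "\<And>z. z \<in> ball a (r / 2) - {a} \<Longrightarrow> G z = u z"
    using radial_extension[OF r(1) u(1) unz] by blast
  define F' where "F' z = (if z = a then 1 else F z / G z ^ 2)" for z
  \<comment> \<open>Near \<open>a\<close> the extension G is the local root itself, so the quotient
    is constantly 1 and filling in the value 1 at \<open>a\<close> is continuous.\<close>
  have one: "F' z = 1" if "z \<in> ball a (r / 2)" for z
  proof (cases "z = a")
    case False
    then have "z \<in> ball a (r / 2) - {a}" "z \<in> ball a r - {a}" using that r(1) by auto
    then show ?thesis using G(3) u(2) G(2)[OF False] False by (simp add: F'_def)
  qed (simp add: F'_def)
  have contF: "continuous_on (- insert a Z) (\<lambda>z. F z / G z ^ 2)"
    using G(2) by (intro continuous_intros insert.prems(1) continuous_on_subset[OF G(1)]) auto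
  have "continuous_on (- insert a Z) F'"
    using contF by (rule continuous_on_eq) (auto simp: F'_def)
  moreover have "continuous_on (ball a (r / 2)) F'"
    using continuous_on_const[of _ 1] by (rule continuous_on_eq) (simp only: one)
  moreover have "open (- insert a Z)" using insert.hyps(1) by (simp add: finite_imp_closed open_Compl)
  ultimately have "continuous_on (- insert a Z \<union> ball a (r / 2)) F'"
    by (intro continuous_on_open_Un) auto
  moreover have "- Z \<subseteq> - insert a Z \<union> ball a (r / 2)" using r(1) by auto
  ultimately have cF': "continuous_on (- Z) F'" by (rule continuous_on_subset)
  have nzF': "F' z \<noteq> 0" if "z \<notin> Z" for z
    using insert.prems(2)[of z] that G(2) by (auto simp: F'_def)
  have "\<exists>r>0. \<exists>u. continuous_on (ball b r - {b}) u \<and> (\<forall>z\<in>ball b r - {b}. F' z = u z ^ 2)" if b: "b \<in> Z" for b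
  proof -
    obtain s v where s: "s > 0" "continuous_on (ball b s - {b}) v" "\<forall>z\<in>ball b s - {b}. F z = v z ^ 2"
      using insert.prems(3)[of b] b by blast
    have "b \<noteq> a" using b insert.hyps(2) by auto
    \<comment> \<open>At another puncture b the local root becomes v / G; the disc is shrunk to
      avoid \<open>a\<close>, where G is not controlled.\<close>
    define s' where "s' = min s (dist a b)"
    have s': "s' > 0" "ball b s' \<subseteq> ball b s" "a \<notin> ball b s'" using s(1) \<open>b \<noteq> a\<close> by (auto simp: s'_def dist_commute)
    have nzG: "G z \<noteq> 0" if "z \<in> ball b s' - {b}" for z
      using that s'(3) by (intro G(2)) blast
    have "ball b s' - {b} \<subseteq> ball b s - {b}" "ball b s' - {b} \<subseteq> - {a}" using s' by blast+
    then have "continuous_on (ball b s' - {b}) (\<lambda>z. v z / G z)"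
      using nzG by (intro continuous_on_divide continuous_on_subset[OF s(2)] continuous_on_subset[OF G(1)]) auto
    moreover have "F' z = (v z / G z) ^ 2" if "z \<in> ball b s' - {b}" for z
    proof -
      have "z \<noteq> a" "z \<in> ball b s - {b}" using that s' by auto
      then show ?thesis using s(3) by (simp add: F'_def power_divide)
    qed
    ultimately show ?thesis using s'(1) by blast
  qed
  then obtain h where h: "continuous_on (- Z) h" "\<And>z. z \<notin> Z \<Longrightarrow> F' z = h z ^ 2"
    using insert.IH[OF cF' nzF'] by blast
  have "continuous_on (- insert a Z) (\<lambda>z. h z * G z)"
    by (intro continuous_intros continuous_on_subset[OF h(1)] continuous_on_subset[OF G(1)]) auto
  moreover have "F z = (h z * G z) ^ 2" if "z \<notin> insert a Z" for z
  proof -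
    have "F z / G z ^ 2 = h z ^ 2" using h(2)[of z] that by (simp add: F'_def)
    then show ?thesis using G(2)[of z] that by (simp add: field_simps power_mult_distrib)
  qed
  ultimately show ?case by blast
qed

section \<open>Lifting through a double cover\<close>

lemma finite_disjoint_neighbourhoods:
  assumes "Hausdorff_space X" "finite S" "S \<subseteq> topspace X"
  obtains W where "\<And>x. x \<in> S \<Longrightarrow> openin X (W x) \<and> x \<in> W x"
    "\<And>x y. x \<in> S \<Longrightarrow> y \<in> S \<Longrightarrow> x \<noteq> y \<Longrightarrow> W x \<inter> W y = {}"
proof -
  have "\<exists>U V. openin X U \<and> openin X V \<and> x \<in> U \<and> y \<in> V \<and> U \<inter> V = {}"
    if "x \<in> S" "y \<in> S" "x \<noteq> y" for x y
    using assms(1,3) that unfolding Hausdorff_space_def disjnt_def by blast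
  then obtain A B where AB: "\<And>x y. x \<in> S \<Longrightarrow> y \<in> S \<Longrightarrow> x \<noteq> y \<Longrightarrow>
      openin X (A x y) \<and> openin X (B x y) \<and> x \<in> A x y \<and> y \<in> B x y \<and> A x y \<inter> B x y = {}"
    by metis
  define W where "W x = (\<Inter>y\<in>S - {x}. A x y \<inter> B y x) \<inter> topspace X" for x
  show thesis
  proof
    fix x assume x: "x \<in> S"
    have "openin X (W x)" unfolding W_def using assms(2) AB x by (intro openin_INT) auto
    moreover have "x \<in> W x" unfolding W_def using AB x assms(3) by auto
    ultimately show "openin X (W x) \<and> x \<in> W x" ..
  next
    fix x y assume xy: "x \<in> S" "y \<in> S" "x \<noteq> y"
    have "W x \<subseteq> A x y" "W y \<subseteq> B x y" unfolding W_def using xy by auto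
    then show "W x \<inter> W y = {}" using AB[OF xy] by blast
  qed
qed

text \<open>The balls of radius \<open>norm y0\<close> around \<open>y0\<close> and
  \<open>- y0\<close> are disjoint, since their centres are 2 \<open>norm y0\<close> apart. Near
  \<open>y0\<close> the two square roots of a value cannot be confused.\<close>

lemma dist_antipodes:
  fixes y y0 w :: complex
  assumes "dist y y0 < norm y0" "dist w z < norm y0" "w = y \<and> z = - y0 \<or> w = - y \<and> z = y0"
  shows False
proof -
  have "norm (y + y0) < norm y0"
    using assms(2,3) norm_minus_cancel[of "y + y0"] by (auto simp: dist_norm)
  moreover have "norm (y - y0) < norm y0" using assms(1) by (simp add: dist_norm)
  moreover have "norm ((y + y0) - (y - y0)) \<le> norm (y + y0) + norm (y - y0)" by (rule norm_triangle_ineq4)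
  moreover have "(y + y0) - (y - y0) = 2 * y0" by simp
  ultimately show False by (simp add: norm_mult)
qed

text \<open>The map q is a two-to-one parametrization of an open part of \<open>Y\<close> by the
  punctured plane, with \<open>y\<close> and \<open>- y\<close> identified; \<open>X0\<close> is the
  part of \<open>X\<close> above it, and h lifts f through q.\<close>

context
  fixes X :: "'a topology" and Y :: "'b topology" and f :: "'a \<Rightarrow> 'b"
    and q :: "complex \<Rightarrow> 'b" and h :: "'a \<Rightarrow> complex" and X0 :: "'a set"
  assumes bc: "branched_cover X Y f" and compX: "compact_space X" and hausX: "Hausdorff_space X"
    and hausY: "Hausdorff_space Y"
    and open_q: "openin Y (q ` (- {0}))" and cont_q: "continuous_map (top_of_set (- {0})) Y q"
    and q_eq: "\<And>y y'. y \<noteq> 0 \<Longrightarrow> y' \<noteq> 0 \<Longrightarrow> q y = q y' \<longleftrightarrow> y' = y \<or> y' = - y"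
    and X0: "X0 = {x \<in> topspace X. f x \<in> q ` (- {0})}"
    and cont_h: "continuous_map (subtopology X X0) (top_of_set (- {0})) h"
    and lift: "\<And>x. x \<in> X0 \<Longrightarrow> q (h x) = f x"
begin

definition sheet :: "complex \<Rightarrow> 'a set" where
  "sheet y = {x \<in> X0. h x = y}"

text \<open>The degree of h over \<open>y\<close>. The local degrees of f are the right weights
  because q is injective near every nonzero point.\<close>

definition sheet_sum :: "complex \<Rightarrow> nat" where
  "sheet_sum y = (\<Sum>x\<in>sheet y. local_degree X Y f x)"

lemma h_nonzero: "x \<in> X0 \<Longrightarrow> h x \<noteq> 0"
  using cont_h X0 by (auto simp: continuous_map_def)

lemma fibre_eq_sheets:
  assumes "y \<noteq> 0"
  shows "fibre X f (q y) = sheet y \<union> sheet (- y)"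
proof (intro equalityI subsetI)
  fix x assume "x \<in> fibre X f (q y)"
  then have x: "x \<in> topspace X" "f x = q y" by (auto simp: fibre_def)
  then have "x \<in> X0" using assms by (simp add: X0)
  then have "q y = q (h x)" using lift x by simp
  then have "h x = y \<or> h x = - y" using q_eq[OF assms h_nonzero[OF \<open>x \<in> X0\<close>]] by simp
  then show "x \<in> sheet y \<union> sheet (- y)" using \<open>x \<in> X0\<close> by (auto simp: sheet_def)
next
  fix x assume "x \<in> sheet y \<union> sheet (- y)"
  then have x: "x \<in> X0" "h x = y \<or> h x = - y" by (auto simp: sheet_def)
  have "q (- y) = q y" using q_eq[of "- y" y] assms by simp
  then have "f x = q y" using lift[OF x(1)] x(2) by auto
  then show "x \<in> fibre X f (q y)" using x(1) by (simp add: X0 fibre_def)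
qed

lemma finite_sheet:
  assumes "y \<noteq> 0"
  shows "finite (sheet y)"
  using finite_fibre[OF bc compX Hausdorff_imp_t1_space[OF hausY], of "q y"] fibre_eq_sheets[OF assms]
  by simp

text \<open>Compactness of the source confines the preimages of nearby values to small
  neighbourhoods of the fibre over \<open>q y0\<close>. Each fibre point attracts as many of them as
  its local degree, and closeness of h decides which of them lie over \<open>y\<close> and which
  over \<open>- y\<close>.\<close>

lemma card_sheet_near:
  assumes y0: "y0 \<noteq> 0"
  obtains D where "open D" "y0 \<in> D" "0 \<notin> D" "\<And>y. y \<in> D \<Longrightarrow> y \<noteq> y0 \<Longrightarrow> card (sheet y) = sheet_sum y0"
proof -
  have contf: "continuous_map X Y f" using bc by (simp add: branched_cover_def)
  define S where "S = fibre X f (q y0)"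
  have finS: "finite S" unfolding S_def by (rule finite_fibre[OF bc compX Hausdorff_imp_t1_space[OF hausY]])
  have S_X: "S \<subseteq> topspace X" by (auto simp: S_def fibre_def)
  have S_sheets: "S = sheet y0 \<union> sheet (- y0)" unfolding S_def by (rule fibre_eq_sheets[OF y0])
  have S_X0: "S \<subseteq> X0" unfolding S_sheets by (auto simp: sheet_def)
  have openX0: "openin X X0" unfolding X0 using contf open_q by (rule openin_continuous_map_preimage)
  then have X0sub: "X0 \<subseteq> topspace X" by (rule openin_subset)
  obtain W where W: "\<And>x. x \<in> S \<Longrightarrow> openin X (W x) \<and> x \<in> W x"
    "\<And>x y. x \<in> S \<Longrightarrow> y \<in> S \<Longrightarrow> x \<noteq> y \<Longrightarrow> W x \<inter> W y = {}"
    by (rule finite_disjoint_neighbourhoods[OF hausX finS S_X]) blast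
  \<comment> \<open>On these sets h stays within \<open>norm y0\<close> of its value at the centre,
    which is \<open>y0\<close> or \<open>- y0\<close>; this lets \<open>dist_antipodes\<close>
    separate the two sheets.\<close>
  define W' where "W' x = W x \<inter> {u \<in> X0. h u \<in> ball (h x) (norm y0)}" for x
  have W': "openin X (W' x)" "x \<in> W' x" if x: "x \<in> S" for x
  proof -
    have "openin (top_of_set (- {0})) ((- {0}) \<inter> ball (h x) (norm y0))" by (simp add: openin_open_Int)
    then have "openin (subtopology X X0) {u \<in> topspace (subtopology X X0). h u \<in> (- {0}) \<inter> ball (h x) (norm y0)}"
      using cont_h by (rule openin_continuous_map_preimage[rotated])
    moreover have "{u \<in> topspace (subtopology X X0). h u \<in> (- {0}) \<inter> ball (h x) (norm y0)} = {u \<in> X0. h u \<in> ball (h x) (norm y0)}"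
      using h_nonzero X0sub by auto
    ultimately have "openin X {u \<in> X0. h u \<in> ball (h x) (norm y0)}"
      using openin_open_subtopology[OF openX0] by simp
    then show "openin X (W' x)" unfolding W'_def using W(1)[OF x] by (intro openin_Int) auto
    show "x \<in> W' x" unfolding W'_def using W(1)[OF x] x S_X0 y0 by auto
  qed
  define good where "good x N V \<longleftrightarrow> openin X N \<and> x \<in> N \<and> N \<subseteq> W' x \<and> openin Y V \<and> f x \<in> V \<and>
      (\<forall>y\<in>V - {f x}. finite {u \<in> N. f u = y} \<and> card {u \<in> N. f u = y} = local_degree X Y f x)" for x N V
  have "\<exists>N V. good x N V" if x: "x \<in> S" for x
  proof -
    have lpm: "locally_power_map X Y f x (local_degree X Y f x)"
      using bc S_X x by (intro locally_power_map_local_degree) auto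
    obtain N V where "openin X N" "x \<in> N" "N \<subseteq> W' x" "openin Y V" "f x \<in> V" "{u \<in> N. f u = f x} = {x}"
      "\<And>y. y \<in> V \<Longrightarrow> y \<noteq> f x \<Longrightarrow> finite {u \<in> N. f u = y} \<and> card {u \<in> N. f u = y} = local_degree X Y f x"
      by (rule locally_power_map_count[OF lpm W'[OF x]]) blast
    then have "good x N V" unfolding good_def by blast
    then show ?thesis by blast
  qed
  then obtain N V where good: "\<And>x. x \<in> S \<Longrightarrow> good x (N x) (V x)" by metis
  have N: "openin X (N x) \<and> x \<in> N x \<and> N x \<subseteq> W' x" and V: "openin Y (V x) \<and> f x \<in> V x" if "x \<in> S" for x
    using good[OF that] unfolding good_def by blast+
  have NV: "finite {u \<in> N x. f u = y} \<and> card {u \<in> N x. f u = y} = local_degree X Y f x"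
    if "x \<in> S" "y \<in> V x - {f x}" for x y
    using good[OF that(1)] that(2) unfolding good_def by blast
  \<comment> \<open>The part of the source outside the chosen neighbourhoods. Its image is closed
    and misses \<open>q y0\<close>, so values near \<open>q y0\<close> have no preimages
    there.\<close>
  define K where "K = topspace X - (\<Union>x\<in>S. N x)"
  have "closedin X K" unfolding K_def using N by (intro closedin_diff closedin_topspace openin_Union) auto
  moreover have "closed_map X Y f" using contf compX hausY by (rule continuous_imp_closed_map)
  ultimately have closedK: "closedin Y (f ` K)" by (simp add: closed_map_def)
  define V' where "V' = (\<Inter>x\<in>S. V x) \<inter> topspace Y - f ` K"
  have openV': "openin Y V'"
    unfolding V'_def using finS V closedK by (intro openin_diff openin_INT) auto
  have qtop: "q y \<in> topspace Y" if "y \<noteq> 0" for y using cont_q that by (auto simp: continuous_map_def)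
  have qV': "q y0 \<in> V'"
  proof -
    have "q y0 \<notin> f ` K"
    proof
      assume "q y0 \<in> f ` K"
      then obtain x where "x \<in> K" "f x = q y0" by auto
      then have "x \<in> S" "x \<in> K" by (auto simp: S_def fibre_def K_def)
      then show False using N by (auto simp: K_def)
    qed
    moreover have "q y0 \<in> V x" if "x \<in> S" for x using V[OF that] that by (auto simp: S_def fibre_def)
    ultimately show ?thesis using qtop[OF y0] by (auto simp: V'_def)
  qed
  \<comment> \<open>The ball of radius \<open>norm y0\<close> excludes 0 and also the antipode
    \<open>- y0\<close>, which has the same image under q as \<open>y0\<close>.\<close>
  define D where "D = {y \<in> - {0}. q y \<in> V'} \<inter> ball y0 (norm y0)"
  have "openin (top_of_set (- {0})) {y \<in> topspace (top_of_set (- {0})). q y \<in> V'}"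
    using cont_q openV' by (rule openin_continuous_map_preimage)
  then have "open {y \<in> - {0}. q y \<in> V'}"
    by (simp add: openin_open_eq open_Compl)
  then have "open D" unfolding D_def by (intro open_Int) auto
  moreover have "y0 \<in> D" using y0 qV' by (simp add: D_def)
  moreover have "0 \<notin> D" by (simp add: D_def)
  moreover have "card (sheet y) = sheet_sum y0" if y: "y \<in> D" "y \<noteq> y0" for y
  proof -
    have ynz: "y \<noteq> 0" and yV: "q y \<in> V'" and yd: "dist y y0 < norm y0"
      using y by (auto simp: D_def dist_commute)
    have qneq: "q y \<noteq> q y0"
    proof
      assume "q y = q y0"
      then have "y0 = - y" using q_eq[OF ynz y0] y(2) by auto
      then have "dist y y0 = 2 * norm y0" using norm_mult[of 2 y] by (simp add: dist_norm)
      then show False using yd by (metis norm_ge_zero not_less mult_2 le_add_same_cancel1)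
    qed
    have sheet: "sheet y = (\<Union>x\<in>sheet y0. {u \<in> N x. f u = q y})"
    proof (intro equalityI subsetI)
      fix u assume "u \<in> sheet y"
      then have u: "u \<in> X0" "h u = y" by (auto simp: sheet_def)
      then have fu: "f u = q y" using lift[OF u(1)] by simp
      then have "u \<notin> K" using yV by (metis DiffD2 V'_def imageI)
      then obtain x where x: "x \<in> S" "u \<in> N x" using u(1) X0sub by (auto simp: K_def)
      then have "u \<in> W' x" using N[OF x(1)] by blast
      then have d: "dist (h u) (h x) < norm y0" by (simp add: W'_def dist_commute)
      have "x \<in> sheet y0"
      proof (rule ccontr)
        assume "x \<notin> sheet y0"
        then have "h x = - y0" using x(1) unfolding S_sheets by (auto simp: sheet_def)
        then show False using dist_antipodes[OF yd d] u(2) by blast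
      qed
      then show "u \<in> (\<Union>x\<in>sheet y0. {u \<in> N x. f u = q y})" using x(2) fu by blast
    next
      fix u assume "u \<in> (\<Union>x\<in>sheet y0. {u \<in> N x. f u = q y})"
      then obtain x where x: "x \<in> sheet y0" "u \<in> N x" "f u = q y" by blast
      then have xS: "x \<in> S" "h x = y0" unfolding S_sheets by (auto simp: sheet_def)
      then have "u \<in> W' x" using N[OF xS(1)] x(2) by blast
      then have u: "u \<in> X0" and d: "dist (h u) (h x) < norm y0" by (simp_all add: W'_def dist_commute)
      have "q y = q (h u)" using lift[OF u] x(3) by simp
      then have "h u = y \<or> h u = - y" using q_eq[OF ynz h_nonzero[OF u]] by simp
      moreover have "h u \<noteq> - y" using dist_antipodes[OF yd d] xS(2) by blast
      ultimately show "u \<in> sheet y" using u by (simp add: sheet_def)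
    qed
    have sub: "sheet y0 \<subseteq> S" unfolding S_sheets by blast
    have qyV: "q y \<in> V x - {f x}" if "x \<in> S" for x
      using yV qneq that by (auto simp: V'_def S_def fibre_def)
    have "card (\<Union>x\<in>sheet y0. {u \<in> N x. f u = q y}) = (\<Sum>x\<in>sheet y0. card {u \<in> N x. f u = q y})"
    proof (rule card_UN_disjoint[OF finite_sheet[OF y0]])
      show "\<forall>x\<in>sheet y0. finite {u \<in> N x. f u = q y}" using NV qyV sub by blast
      show "\<forall>x\<in>sheet y0. \<forall>x'\<in>sheet y0. x \<noteq> x' \<longrightarrow> {u \<in> N x. f u = q y} \<inter> {u \<in> N x'. f u = q y} = {}"
      proof (intro ballI impI)
        fix x x' assume "x \<in> sheet y0" "x' \<in> sheet y0" "x \<noteq> x'"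
        then have xx': "x \<in> S" "x' \<in> S" "x \<noteq> x'" using sub by blast+
        then have "N x \<subseteq> W x" "N x' \<subseteq> W x'" using N by (auto simp: W'_def)
        moreover have "W x \<inter> W x' = {}" by (rule W(2)[OF xx'])
        ultimately show "{u \<in> N x. f u = q y} \<inter> {u \<in> N x'. f u = q y} = {}" by blast
      qed
    qed
    also have "\<dots> = sheet_sum y0" unfolding sheet_sum_def
    proof (rule sum.cong[OF refl])
      fix x assume "x \<in> sheet y0"
      then show "card {u \<in> N x. f u = q y} = local_degree X Y f x" using NV[OF _ qyV] sub by blast
    qed
    finally show ?thesis unfolding sheet .
  qed
  ultimately show thesis by (rule that)
qed

text \<open>The previous lemma counts only at points other than the centre. For y1 near y0, both
  sums are therefore compared with the cardinality of \<open>sheet\<close> at a third point close to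
  both; connectedness of the punctured plane then makes the locally constant sum constant.\<close>

lemma sheet_sum_constant:
  assumes "y \<noteq> 0" "y' \<noteq> 0"
  shows "sheet_sum y = sheet_sum y'"
proof -
  have "sheet_sum constant_on (- {0})"
  proof (rule locally_constant_imp_constant)
    show "connected (- {0 :: complex})" by (intro connected_punctured_universe) simp
    fix y0 :: complex assume "y0 \<in> - {0}"
    then have y0: "y0 \<noteq> 0" by simp
    obtain D where D: "open D" "y0 \<in> D" "0 \<notin> D" "\<And>y. y \<in> D \<Longrightarrow> y \<noteq> y0 \<Longrightarrow> card (sheet y) = sheet_sum y0"
      by (rule card_sheet_near[OF y0]) blast
    have "sheet_sum y1 = sheet_sum y0" if y1: "y1 \<in> D" for y1
    proof -
      have "y1 \<noteq> 0" using y1 D(3) by auto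
      then obtain D' where D': "open D'" "y1 \<in> D'" "\<And>y. y \<in> D' \<Longrightarrow> y \<noteq> y1 \<Longrightarrow> card (sheet y) = sheet_sum y1"
        by (rule card_sheet_near) blast
      have "open (D \<inter> D')" using D D' by auto
      then have "infinite (D \<inter> D')" using y1 D'(2) finite_imp_not_open by blast
      then have "infinite (D \<inter> D' - {y0, y1})" by simp
      then obtain y where "y \<in> D \<inter> D'" "y \<noteq> y0" "y \<noteq> y1" by (metis DiffE insertCI finite.emptyI ex_in_conv)
      then show ?thesis using D(4)[of y] D'(3)[of y] by simp
    qed
    moreover have "openin (top_of_set (- {0})) D"
      using D(1,3) by (intro open_subset) auto
    ultimately show "\<exists>T. openin (top_of_set (- {0})) T \<and> y0 \<in> T \<and> (\<forall>x\<in>T. sheet_sum x = sheet_sum y0)"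
      using D(2) by blast
  qed
  then show ?thesis using assms by (auto simp: constant_on_def)
qed

lemma even_card_fibre:
  assumes y: "y \<noteq> 0" and two: "\<And>x. x \<in> fibre X f (q y) \<Longrightarrow> local_degree X Y f x = 2"
  shows "even (card (fibre X f (q y)))"
proof -
  have y': "- y \<noteq> 0" using y by simp
  have eq: "sheet_sum z = 2 * card (sheet z)" if "z = y \<or> z = - y" for z
  proof -
    have "sheet_sum z = (\<Sum>x\<in>sheet z. 2)"
      unfolding sheet_sum_def using two that fibre_eq_sheets[OF y] by (intro sum.cong) auto
    then show ?thesis by simp
  qed
  have "card (sheet y) = card (sheet (- y))"
    using sheet_sum_constant[OF y y'] eq by simp
  moreover have "sheet y \<inter> sheet (- y) = {}" using y by (auto simp: sheet_def)
  then have "card (fibre X f (q y)) = card (sheet y) + card (sheet (- y))"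
    unfolding fibre_eq_sheets[OF y] using finite_sheet y y' by (intro card_Un_disjoint) auto
  ultimately show ?thesis by simp
qed

end

section \<open>Obstruction and conclusion\<close>

text \<open>In polar coordinates around a point of local degree two, a nonvanishing function of the
  target pulls back to one of even winding number.\<close>
lemma local_sqrt_of_pullback:
  assumes lpm: "locally_power_map X Y f x 2"
    and \<kappa>: "continuous_map euclidean X \<kappa>" "inj \<kappa>" "\<kappa> a = x"
    and O: "openin Y O'" "f x \<in> O'"
    and g: "continuous_map (subtopology Y (O' - {f x})) (top_of_set (- {0})) (g :: 'b \<Rightarrow> complex)"
  shows "\<exists>r>0. \<exists>u. continuous_on (ball a r - {a}) u \<and> (\<forall>z\<in>ball a r - {a}. g (f (\<kappa> z)) = u z ^ 2)"
proof -
  obtain U V \<phi> \<psi> and A B :: "complex set" where *: "openin X U" "x \<in> U" "openin Y V"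
      "f ` U \<subseteq> V" "open A" "open B" "\<phi> x = 0" "\<psi> (f x) = 0" "\<And>u. u \<in> U \<Longrightarrow> \<psi> (f u) = \<phi> u ^ 2"
    and \<phi>h: "homeomorphic_map (subtopology X U) (top_of_set A) \<phi>"
    and \<psi>h: "homeomorphic_map (subtopology Y V) (top_of_set B) \<psi>"
    using lpm unfolding locally_power_map_def by metis
  note \<phi> = homeomorphic_map_to_open_properties[OF \<phi>h *(1,5)]
  note \<psi> = homeomorphic_map_to_open_properties[OF \<psi>h *(3,6)]
  have Vtop: "topspace (subtopology Y V) = V" using openin_subset[OF *(3)] by auto
  obtain \<psi>' where \<psi>': "homeomorphic_maps (subtopology Y V) (top_of_set B) \<psi> \<psi>'"
    using \<psi>h by (auto simp: homeomorphic_map_maps)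
  then have \<psi>'c: "continuous_map (top_of_set B) (subtopology Y V) \<psi>'"
    and \<psi>\<psi>': "\<And>\<zeta>. \<zeta> \<in> B \<Longrightarrow> \<psi> (\<psi>' \<zeta>) = \<zeta>" and \<psi>'\<psi>: "\<And>y. y \<in> V \<Longrightarrow> \<psi>' (\<psi> y) = y"
    using Vtop by (auto simp: homeomorphic_maps_def)
  have fxV: "f x \<in> V" using * by blast
  have "open (\<psi> ` (V \<inter> O'))" using *(3) O by (intro \<psi>(4)) auto
  moreover have "0 \<in> \<psi> ` (V \<inter> O')" using *(8) fxV O(2) by force
  ultimately obtain \<epsilon> where \<epsilon>: "\<epsilon> > 0" "ball 0 \<epsilon> \<subseteq> \<psi> ` (V \<inter> O')" by (meson open_contains_ball)
  \<comment> \<open>Squaring carries the ball of radius s into the target ball, where the function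
    is defined through the chart.\<close>
  define s where "s = sqrt \<epsilon>"
  have s: "s > 0" "s\<^sup>2 = \<epsilon>" using \<epsilon>(1) by (auto simp: s_def)
  let ?D = "ball 0 (s\<^sup>2) - {0 :: complex}"
  have D_B: "?D \<subseteq> B" using \<epsilon>(2) \<psi>(2) s(2) by blast
  have \<psi>'D: "\<psi>' \<zeta> \<in> O' - {f x}" if \<zeta>: "\<zeta> \<in> ?D" for \<zeta>
  proof -
    obtain y where y: "y \<in> V \<inter> O'" "\<zeta> = \<psi> y" using \<zeta> \<epsilon>(2) s(2) by blast
    then have "\<psi>' \<zeta> = y" using \<psi>'\<psi> by simp
    moreover have "y \<noteq> f x" using y(2) *(8) \<zeta> by auto
    ultimately show ?thesis using y by simp
  qed
  have "continuous_map (top_of_set ?D) Y \<psi>'"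
    using \<psi>'c D_B continuous_map_from_subtopology_mono continuous_map_into_fulltopology by blast
  then have "continuous_map (top_of_set ?D) (subtopology Y (O' - {f x})) \<psi>'"
    using \<psi>'D by (auto simp: continuous_map_in_subtopology)
  then have W: "continuous_map (top_of_set ?D) (top_of_set (- {0})) (g \<circ> \<psi>')"
    using g by (rule continuous_map_compose)
  then have cW: "continuous_on ?D (g \<circ> \<psi>')" and nzW: "\<And>\<zeta>. \<zeta> \<in> ?D \<Longrightarrow> (g \<circ> \<psi>') \<zeta> \<noteq> 0"
    by (auto simp: continuous_map_in_subtopology)
  obtain v where v: "continuous_on (ball 0 s - {0}) v" "\<And>z. z \<in> ball 0 s - {0} \<Longrightarrow> v z ^ 2 = (g \<circ> \<psi>') (z ^ 2)"
    using continuous_sqrt_pullback_square[OF s(1) cW nzW] by blast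
  have "openin X {u \<in> U. \<phi> u \<in> ball 0 s}" by (rule \<phi>(3)) simp
  then have "openin euclidean {z \<in> topspace euclidean. \<kappa> z \<in> {u \<in> U. \<phi> u \<in> ball 0 s}}"
    using \<kappa>(1) by (rule openin_continuous_map_preimage[rotated])
  then have "open {z. \<kappa> z \<in> {u \<in> U. \<phi> u \<in> ball 0 s}}" by simp
  moreover have "a \<in> {z. \<kappa> z \<in> {u \<in> U. \<phi> u \<in> ball 0 s}}" using \<kappa>(3) * s(1) by simp
  ultimately obtain r where r: "r > 0" "ball a r \<subseteq> {z. \<kappa> z \<in> {u \<in> U. \<phi> u \<in> ball 0 s}}"
    by (meson open_contains_ball)
  have \<kappa>U: "\<kappa> z \<in> U" "\<phi> (\<kappa> z) \<in> ball 0 s" if "z \<in> ball a r" for z using r(2) that by auto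
  have \<phi>\<kappa>: "\<phi> (\<kappa> z) \<in> ball 0 s - {0}" if z: "z \<in> ball a r - {a}" for z
  proof -
    have "\<kappa> z \<noteq> x" using z \<kappa>(2,3) by (metis DiffD2 injD singletonI)
    then have "\<phi> (\<kappa> z) \<noteq> \<phi> x" using inj_onD[OF \<phi>(1)] \<kappa>U(1) z *(2) by blast
    then show ?thesis using \<kappa>U z *(7) by auto
  qed
  have "continuous_map (top_of_set (ball a r)) (subtopology X U) \<kappa>"
    using \<kappa>(1) \<kappa>U by (auto simp: continuous_map_in_subtopology continuous_map_from_subtopology)
  then have "continuous_map (top_of_set (ball a r)) (top_of_set A) (\<phi> \<circ> \<kappa>)"
    using \<phi>h by (intro continuous_map_compose) (auto simp: homeomorphic_eq_everything_map)
  then have "continuous_on (ball a r) (\<phi> \<circ> \<kappa>)" by (simp add: continuous_map_in_subtopology)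
  then have "continuous_on (ball a r - {a}) (\<phi> \<circ> \<kappa>)" by (rule continuous_on_subset) blast
  moreover have "(\<phi> \<circ> \<kappa>) ` (ball a r - {a}) \<subseteq> ball 0 s - {0}"
    using \<phi>\<kappa> by (intro image_subsetI) simp
  ultimately have "continuous_on (ball a r - {a}) (\<lambda>z. v ((\<phi> \<circ> \<kappa>) z))"
    by (rule continuous_on_compose2[OF v(1)])
  moreover have "g (f (\<kappa> z)) = v ((\<phi> \<circ> \<kappa>) z) ^ 2" if z: "z \<in> ball a r - {a}" for z
  proof -
    have U: "\<kappa> z \<in> U" using \<kappa>U z by blast
    then have "f (\<kappa> z) \<in> V" using *(4) by blast
    then have "f (\<kappa> z) = \<psi>' (\<phi> (\<kappa> z) ^ 2)" using \<psi>'\<psi> *(9)[OF U] by metis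
    then show ?thesis using v(2)[OF \<phi>\<kappa>[OF z]] by simp
  qed
  ultimately show ?thesis using r(1) by blast
qed

text \<open>The local roots at the zeros and poles of the map come from local degree 2 over c2 and
  c3; over c4 the same condition makes all weights in the sheet count equal, so that the two sheets
  have equally many points.\<close>

lemma even_fibre_of_three_double_fibres:
  assumes X: "X homeomorphic_space S2" and Y: "Y homeomorphic_space S2" and bc: "branched_cover X Y f"
    and c: "c2 \<in> topspace Y" "c3 \<in> topspace Y" "c4 \<in> topspace Y" "c2 \<noteq> c3" "c4 \<noteq> c2" "c4 \<noteq> c3"
    and two: "\<And>x. x \<in> topspace X \<Longrightarrow> f x \<in> {c2, c3, c4} \<Longrightarrow> local_degree X Y f x = 2"
    and ne: "fibre X f c3 \<noteq> {}"
  shows "even (card (fibre X f c4))"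
proof -
  note Xp = sphere_space_properties[OF X] and Yp = sphere_space_properties[OF Y]
  have contf: "continuous_map X Y f" using bc by (simp add: branched_cover_def)
  have lpm: "locally_power_map X Y f x 2" if "x \<in> topspace X" "f x \<in> {c2, c3}" for x
    using locally_power_map_local_degree[OF bc that(1)] two[OF that(1)] that(2) by auto
  \<comment> \<open>The point removed to make the source a plane is taken over c3, so that it lies
    outside the region where the root has to be defined.\<close>
  obtain x0 where x0: "x0 \<in> topspace X" "f x0 = c3" using ne by (auto simp: fibre_def)
  obtain \<kappa>i \<kappa> where \<kappa>h: "homeomorphic_maps (subtopology X (topspace X - {x0})) (euclidean :: complex topology) \<kappa>i \<kappa>"
    using punctured_S2_homeomorphic_plane[OF X x0(1)] by (auto simp: homeomorphic_space_def)
  have \<kappa>: "continuous_map euclidean (subtopology X (topspace X - {x0})) \<kappa>"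
    "continuous_map (subtopology X (topspace X - {x0})) euclidean \<kappa>i"
    "\<And>z. \<kappa>i (\<kappa> z) = z" "\<And>x. x \<in> topspace X - {x0} \<Longrightarrow> \<kappa> (\<kappa>i x) = x"
    using \<kappa>h by (auto simp: homeomorphic_maps_def)
  have \<kappa>im: "\<kappa> z \<in> topspace X - {x0}" for z using \<kappa>(1) by (auto simp: continuous_map_def)
  have \<kappa>X: "continuous_map euclidean X \<kappa>" using \<kappa>(1) by (rule continuous_map_into_fulltopology)
  have inj\<kappa>: "inj \<kappa>" using \<kappa>(3) by (metis injI)
  let ?Y3 = "subtopology Y (topspace Y - {c3})"
  obtain \<omega>0 \<omega>0' where \<omega>0h: "homeomorphic_maps ?Y3 (euclidean :: complex topology) \<omega>0 \<omega>0'"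
    using punctured_S2_homeomorphic_plane[OF Y c(2)] by (auto simp: homeomorphic_space_def)
  define \<omega> where "\<omega> y = \<omega>0 y - \<omega>0 c2" for y
  define \<omega>' where "\<omega>' w = \<omega>0' (w + \<omega>0 c2)" for w
  have \<omega>c: "continuous_map ?Y3 euclidean \<omega>"
    unfolding \<omega>_def using \<omega>0h by (intro continuous_map_diff) (auto simp: homeomorphic_maps_def)
  have \<omega>'c: "continuous_map euclidean ?Y3 \<omega>'"
  proof -
    have "continuous_map euclidean ?Y3 (\<omega>0' \<circ> (\<lambda>w. w + \<omega>0 c2))"
      using \<omega>0h by (intro continuous_map_compose[of _ euclidean]) (auto simp: homeomorphic_maps_def intro!: continuous_intros)
    moreover have "\<omega>0' \<circ> (\<lambda>w. w + \<omega>0 c2) = \<omega>'" by (auto simp: \<omega>'_def)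
    ultimately show ?thesis by simp
  qed
  have \<omega>\<omega>': "\<omega> (\<omega>' w) = w" for w using \<omega>0h by (auto simp: homeomorphic_maps_def \<omega>_def \<omega>'_def)
  have \<omega>'\<omega>: "\<omega>' (\<omega> y) = y" if "y \<in> topspace Y - {c3}" for y
    using \<omega>0h that by (auto simp: homeomorphic_maps_def \<omega>_def \<omega>'_def)
  have \<omega>'im: "\<omega>' w \<in> topspace Y - {c3}" for w using \<omega>'c by (auto simp: continuous_map_def)
  have \<omega>0: "\<omega> y = 0 \<longleftrightarrow> y = c2" if "y \<in> topspace Y - {c3}" for y
  proof -
    have "\<omega> c2 = 0" by (simp add: \<omega>_def)
    moreover have "c2 \<in> topspace Y - {c3}" using c by simp
    ultimately show ?thesis using \<omega>'\<omega> that by metis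
  qed
  define E where "E = topspace Y - {c2, c3}"
  have openY: "openin Y (topspace Y - C)" if "finite C" "C \<subseteq> topspace Y" for C
    using that Yp(6) by (intro openin_diff openin_topspace) (simp add: t1_space_closedin_finite)
  have openE: "openin Y E" unfolding E_def using c by (intro openY) auto
  have \<omega>E: "continuous_map (subtopology Y E) (top_of_set (- {0})) \<omega>"
  proof -
    have "continuous_map (subtopology Y E) euclidean \<omega>"
      using \<omega>c by (rule continuous_map_from_subtopology_mono) (auto simp: E_def)
    moreover have "\<omega> y \<noteq> 0" if "y \<in> E" for y using \<omega>0[of y] that by (auto simp: E_def)
    ultimately show ?thesis by (auto simp: continuous_map_in_subtopology)
  qed
  \<comment> \<open>The zeros and the remaining poles of the map, seen in the planar coordinate of
    the source.\<close>
  define Z where "Z = {z. f (\<kappa> z) \<in> {c2, c3}}"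
  have "finite Z"
  proof -
    have "\<kappa> ` Z \<subseteq> fibre X f c2 \<union> fibre X f c3" using \<kappa>im by (auto simp: Z_def fibre_def)
    moreover have "finite (fibre X f c2 \<union> fibre X f c3)" using finite_fibre[OF bc Xp(2) Yp(6)] by simp
    ultimately have "finite (\<kappa> ` Z)" by (rule finite_subset)
    then show ?thesis using inj\<kappa> by (metis finite_imageD inj_on_subset subset_UNIV)
  qed
  have ftop: "f x \<in> topspace Y" if "x \<in> topspace X" for x using contf that by (auto simp: continuous_map_def)
  have fE: "f (\<kappa> z) \<in> E" if "z \<notin> Z" for z using that ftop[of "\<kappa> z"] \<kappa>im[of z] by (auto simp: Z_def E_def)
  have "continuous_map (top_of_set (- Z)) (subtopology Y E) (f \<circ> \<kappa>)"
  proof -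
    have "continuous_map euclidean Y (f \<circ> \<kappa>)" using \<kappa>X contf by (rule continuous_map_compose)
    then have "continuous_map (top_of_set (- Z)) Y (f \<circ> \<kappa>)" by (rule continuous_map_from_subtopology)
    then show ?thesis using fE by (auto simp: continuous_map_in_subtopology)
  qed
  then have "continuous_map (top_of_set (- Z)) (top_of_set (- {0})) (\<omega> \<circ> (f \<circ> \<kappa>))"
    using \<omega>E by (rule continuous_map_compose)
  then have F: "continuous_on (- Z) (\<lambda>z. \<omega> (f (\<kappa> z)))" "\<And>z. z \<notin> Z \<Longrightarrow> \<omega> (f (\<kappa> z)) \<noteq> 0"
    by (auto simp: continuous_map_in_subtopology o_def)
  have "\<exists>hC. continuous_on (- Z) hC \<and> (\<forall>z. z \<notin> Z \<longrightarrow> \<omega> (f (\<kappa> z)) = hC z ^ 2)"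
  proof (rule continuous_sqrt_punctured_plane[OF \<open>finite Z\<close> F])
    fix a assume "a \<in> Z"
    then have fa: "f (\<kappa> a) \<in> {c2, c3}" by (simp add: Z_def)
    \<comment> \<open>Omits only the other one of the two special values, so that removing the value
      at \<open>a\<close> as well leaves exactly E.\<close>
    define O' where "O' = topspace Y - ({c2, c3} - {f (\<kappa> a)})"
    have O': "openin Y O'" unfolding O'_def using c by (intro openY) auto
    have faO: "f (\<kappa> a) \<in> O'" using fa c by (auto simp: O'_def)
    have "O' - {f (\<kappa> a)} = E" using fa by (auto simp: O'_def E_def)
    then show "\<exists>r>0. \<exists>u. continuous_on (ball a r - {a}) u \<and> (\<forall>z\<in>ball a r - {a}. \<omega> (f (\<kappa> z)) = u z ^ 2)"
      using local_sqrt_of_pullback[OF lpm \<kappa>X inj\<kappa> refl O' faO, of \<omega>] \<omega>E fa \<kappa>im by auto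
  qed
  then obtain hC where hC: "continuous_on (- Z) hC" "\<And>z. z \<notin> Z \<Longrightarrow> \<omega> (f (\<kappa> z)) = hC z ^ 2" by blast
  \<comment> \<open>Squaring in the coordinate that puts c2 at 0 and c3 at infinity: the double
    cover of E by the punctured plane.\<close>
  define q where "q y = \<omega>' (y ^ 2)" for y
  define h where "h x = hC (\<kappa>i x)" for x
  have qE: "q ` (- {0}) = E"
  proof (intro equalityI subsetI)
    fix y assume "y \<in> q ` (- {0})"
    then obtain w where w: "w \<noteq> 0" "y = \<omega>' (w ^ 2)" by (auto simp: q_def)
    then have "\<omega> y \<noteq> 0" using \<omega>\<omega>' by simp
    then show "y \<in> E" using \<omega>0[of y] \<omega>'im[of "w ^ 2"] w(2) by (auto simp: E_def)
  next
    fix y assume "y \<in> E"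
    then have y: "y \<in> topspace Y - {c3}" "y \<noteq> c2" by (auto simp: E_def)
    then have "\<omega> y \<noteq> 0" using \<omega>0 by simp
    then have "csqrt (\<omega> y) \<noteq> 0" "q (csqrt (\<omega> y)) = y" using \<omega>'\<omega>[OF y(1)] by (auto simp: q_def)
    then show "y \<in> q ` (- {0})" by (metis ComplI image_eqI singletonD)
  qed
  have cont_q: "continuous_map (top_of_set (- {0})) Y q"
  proof -
    have "continuous_map (top_of_set (- {0})) Y (\<omega>' \<circ> (\<lambda>y. y ^ 2))"
      using continuous_map_into_fulltopology[OF \<omega>'c]
      by (intro continuous_map_compose[of _ euclidean]) (auto intro!: continuous_intros)
    moreover have "\<omega>' \<circ> (\<lambda>y. y ^ 2) = q" by (auto simp: q_def)
    ultimately show ?thesis by simp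
  qed
  have q_eq: "q y = q y' \<longleftrightarrow> y' = y \<or> y' = - y" for y y'
  proof -
    have "q y = q y' \<longleftrightarrow> y ^ 2 = y' ^ 2" unfolding q_def using \<omega>\<omega>' by metis
    then show ?thesis using power2_eq_iff[of y' y] by auto
  qed
  define X0 where "X0 = {x \<in> topspace X. f x \<in> q ` (- {0})}"
  have X0: "x \<in> topspace X - {x0}" "\<kappa>i x \<notin> Z" if "x \<in> X0" for x
  proof -
    show 1: "x \<in> topspace X - {x0}" using that x0 by (auto simp: X0_def qE E_def)
    show "\<kappa>i x \<notin> Z" using that \<kappa>(4)[OF 1] by (auto simp: X0_def qE E_def Z_def)
  qed
  have lift: "q (h x) = f x" if x: "x \<in> X0" for x
  proof -
    have "q (h x) = \<omega>' (\<omega> (f (\<kappa> (\<kappa>i x))))" using hC(2)[OF X0(2)[OF x]] by (simp add: q_def h_def)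
    also have "\<dots> = f x" using \<kappa>(4)[OF X0(1)[OF x]] \<omega>'\<omega>[of "f x"] x by (simp add: X0_def qE E_def)
    finally show ?thesis .
  qed
  have cont_h: "continuous_map (subtopology X X0) (top_of_set (- {0})) h"
  proof -
    have "continuous_map (subtopology X X0) euclidean \<kappa>i"
      using \<kappa>(2) by (rule continuous_map_from_subtopology_mono) (use X0 in blast)
    then have "continuous_map (subtopology X X0) (top_of_set (- Z)) \<kappa>i"
      using X0(2) by (auto simp: continuous_map_in_subtopology)
    moreover have "continuous_map (top_of_set (- Z)) (top_of_set (- {0})) hC"
      using hC F(2) by (auto simp: continuous_map_in_subtopology)
    ultimately have "continuous_map (subtopology X X0) (top_of_set (- {0})) (hC \<circ> \<kappa>i)"
      by (rule continuous_map_compose)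
    moreover have "hC \<circ> \<kappa>i = h" by (auto simp: h_def)
    ultimately show ?thesis by simp
  qed
  have "c4 \<in> E" using c by (simp add: E_def)
  then obtain y where y: "y \<noteq> 0" "q y = c4" using qE by blast
  have openq: "openin Y (q ` (- {0}))" using openE qE by simp
  have "even (card (fibre X f (q y)))"
  proof (rule even_card_fibre[OF bc Xp(2,3) Yp(3) openq cont_q q_eq X0_def cont_h lift y(1)])
    fix x assume "x \<in> fibre X f (q y)"
    then show "local_degree X Y f x = 2" using two y(2) by (simp add: fibre_def)
  qed
  then show ?thesis using y(2) by simp
qed

lemma realizable_type3_imp:
  assumes X: "X homeomorphic_space S2" and Y: "Y homeomorphic_space S2"
    and r: "realizable X Y (2 * k + 4) (partitions_type3 k)"
  shows "4 dvd 2 * k + 4"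
proof -
  obtain f where bc: "branched_cover X Y f" and fin: "finite (branching_points X Y f)"
    and ld: "image_mset (local_degrees X Y f) (mset_set (branching_points X Y f)) = partitions_type3 k"
    using r unfolding realizable_def by blast
  let ?P = "replicate_mset (k + 2) (2::nat)"
  let ?B = "{c \<in> branching_points X Y f. local_degrees X Y f c = ?P}"
  \<comment> \<open>The two shapes of partition have different lengths, so the all-twos partition
    occurs exactly three times and yields three distinct branching points.\<close>
  have "size (replicate_mset k 2 + {#1, 1, 1, 1 :: nat#}) \<noteq> size ?P" by simp
  then have ne: "replicate_mset k 2 + {#1, 1, 1, 1#} \<noteq> ?P" by (metis (no_types))
  have "count {#A, B, B, B#} B = 3" if "A \<noteq> B" for A B :: "nat multiset" using that by simp
  from this[OF ne] have "count (partitions_type3 k) ?P = 3" unfolding partitions_type3_def .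
  moreover have "count (image_mset (local_degrees X Y f) (mset_set (branching_points X Y f))) ?P = card ?B"
    using fin by (simp add: count_image_mset vimage_def Int_def conj_commute)
  ultimately have "card ?B = 3" using ld by simp
  then obtain c2 c3 c4 where B: "?B = {c2, c3, c4}" and neq: "c2 \<noteq> c3" "c2 \<noteq> c4" "c3 \<noteq> c4"
    by (auto simp: card_3_iff)
  have cB: "c \<in> topspace Y \<and> local_degrees X Y f c = ?P" if "c \<in> {c2, c3, c4}" for c
  proof -
    have "c \<in> ?B" using that B by simp
    then show ?thesis by (simp add: branching_points_def)
  qed
  have finf: "finite (fibre X f c)" for c
    by (rule finite_fibre[OF bc sphere_space_properties(2)[OF X] sphere_space_properties(6)[OF Y]])
  have card: "card (fibre X f c) = k + 2" if "c \<in> {c2, c3, c4}" for c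
  proof -
    have "size (local_degrees X Y f c) = card (fibre X f c)" by (simp add: local_degrees_def)
    then show ?thesis using cB[OF that] by simp
  qed
  have two: "local_degree X Y f x = 2" if "x \<in> topspace X" "f x \<in> {c2, c3, c4}" for x
  proof -
    have "x \<in># mset_set (fibre X f (f x))" using finf that(1) by (simp add: fibre_def)
    then have "local_degree X Y f x \<in># local_degrees X Y f (f x)" unfolding local_degrees_def by simp
    then show ?thesis using cB[OF that(2)] by (simp split: if_splits)
  qed
  have "fibre X f c3 \<noteq> {}" using card[of c3] by auto
  then have "even (card (fibre X f c4))"
    using even_fibre_of_three_double_fibres[OF X Y bc, of c2 c3 c4] cB neq two by simp
  then have "even (k + 2)" using card[of c4] by simp
  then show ?thesis by presburger
qed

theorem theorem3p7:
  fixes X :: "'a topology" and Y :: "'b topology"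
  shows
    "(\<forall>(d::nat) (Ps :: nat multiset multiset).
        candidate_branched_cover X Y d Ps \<and> induces_orbifold_cover X Y Ps S2_2222 S2_2222
        \<longleftrightarrow>
        X homeomorphic_space S2 \<and> Y homeomorphic_space S2 \<and>
        (\<exists>k::nat. k \<ge> 1 \<and>
           (d = 2 * k + 1 \<and> Ps = partitions_type1 k \<or>
            d = 2 * k + 2 \<and> Ps = partitions_type2 k \<or>
            d = 2 * k + 4 \<and> Ps = partitions_type3 k)))
     \<and>
     (X homeomorphic_space S2 \<and> Y homeomorphic_space S2 \<longrightarrow>
       (\<forall>k::nat. k \<ge> 1 \<longrightarrow>
          realizable X Y (2 * k + 1) (partitions_type1 k) \<and>
          realizable X Y (2 * k + 2) (partitions_type2 k) \<and>
          (realizable X Y (2 * k + 4) (partitions_type3 k) \<longleftrightarrow> 4 dvd 2 * k + 4)))"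
proof (intro conjI allI impI)
  fix d Ps
  show "candidate_branched_cover X Y d Ps \<and> induces_orbifold_cover X Y Ps S2_2222 S2_2222 \<longleftrightarrow>
        X homeomorphic_space S2 \<and> Y homeomorphic_space S2 \<and>
        (\<exists>k::nat. k \<ge> 1 \<and>
           (d = 2 * k + 1 \<and> Ps = partitions_type1 k \<or>
            d = 2 * k + 2 \<and> Ps = partitions_type2 k \<or>
            d = 2 * k + 4 \<and> Ps = partitions_type3 k))" (is "?L \<longleftrightarrow> ?X \<and> ?Y \<and> ?R")
  proof (cases "?X \<and> ?Y")
    case True
    then have "?L \<longleftrightarrow> ?R" by (intro candidates_iff_types) auto
    then show ?thesis using True by blast
  next
    case False
    \<comment> \<open>Inducing the given orbifolds includes that both underlying surfaces are
      homeomorphic to the sphere.\<close>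
    then have "\<not> ?L"
      by (auto simp: induces_orbifold_cover_def same_orbifold_def induced_source_def induced_target_def)
    then show ?thesis using False by blast
  qed
next
  fix k :: nat
  assume XY: "X homeomorphic_space S2 \<and> Y homeomorphic_space S2" and k: "1 \<le> k"
  then have X: "X homeomorphic_space S2" and Y: "Y homeomorphic_space S2" by auto
  show "realizable X Y (2 * k + 1) (partitions_type1 k)" by (rule realizable_types(1)[OF X Y k])
  show "realizable X Y (2 * k + 2) (partitions_type2 k)" by (rule realizable_types(2)[OF X Y k])
  show "realizable X Y (2 * k + 4) (partitions_type3 k) \<longleftrightarrow> 4 dvd 2 * k + 4"
    using realizable_type3_imp[OF X Y] realizable_types(3)[OF X Y k] by blast
qed

end
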